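(* Let $\phi\in\mathbb{Q}(x)$ be a rational function of degree $2$ having a $2$-periodic critical point, and suppose that $\operatorname{Aut}(\phi)$ is trivial. Then there exists $v\in\mathbb{Q}\setminus\{0\}$ such that $\phi$ is linearly conjugate over $\mathbb{Q}$ to \[\phi_v:=\frac{v(x-1)}{x^2}.\] Moreover, for any such $v$ with $v\neq 3$: if $v\in\operatorname{Im}\eta$, then $G_{3,\phi}\cong C$; otherwise $G_{3,\phi}\cong(\mathbb{Z}/3\mathbb{Z})\wr S_2$.
   Context: The degree of a rational function $\phi=p/q$ with $p,q$ coprime polynomials is $\max\{\deg p,\deg q\}$; $\phi$ induces a map $\mathbb{P}^1(\overline{\mathbb{Q}})\to\mathbb{P}^1(\overline{\mathbb{Q}})$. A point $P$ is $n$-periodic if $\phi^n(P)=P$ and $n$ is the least such positive integer ($\phi^n$ = $n$-fold composition). A critical point is a point of $\mathbb{P}^1(\overline{\mathbb{Q}})$ at which the morphism $\phi:\mathbb{P}^1\to\mathbb{P}^1$ ramifies. Two rational functions $\phi,\psi\in\mathbb{Q}(x)$ are linearly conjugate over a field $K$ if $\psi=\sigma^{-1}\circ\phi\circ\sigma$ for some degree-one $\sigma\in K(x)$. $\operatorname{Aut}(\phi)$ is the group of degree-one $\sigma\in\overline{\mathbb{Q}}(x)$ with $\sigma^{-1}\circ\phi\circ\sigma=\phi$. The $3$rd dynatomic group $G_{3,\phi}$ is $\operatorname{Gal}(\mathbb{Q}_{3,\phi}/\mathbb{Q})$, where $\mathbb{Q}_{3,\phi}$ is the compositum of the fields of definition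 $\mathbb{Q}(P)$ of all $3$-periodic points $P\in\mathbb{P}^1(\overline{\mathbb{Q}})$ of $\phi$ (with $\mathbb{Q}(\infty)=\mathbb{Q}$). Let $\eta(t)=\dfrac{t^3+3t^2-6t+1}{t(t-1)}\in\mathbb{Q}(t)$ and $\operatorname{Im}\eta=\{\eta(u):u\in\mathbb{Q}\setminus\{0,1\}\}$. Let $C$ be the subgroup of the symmetric group $S_6$ generated by $(1,6)(2,4)(3,5)$ and $(1,2,3)(4,6,5)$ (it is isomorphic to $S_3$). The wreath product $(\mathbb{Z}/3\mathbb{Z})\wr S_2$ may be realized as the centralizer of $(1,2,3)(4,5,6)$ in $S_6$. *)

theory Defs
  imports "HOL-Computational_Algebra.Polynomial" "HOL-Algebra.Sym_Groups"
    "HOL-Combinatorics.Cycles"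
begin

text \<open>P^1 over an algebraically closed field containing Qbar is modelled as
  complex option, None being the point at infinity.  A rational function is
  given by a pair of coprime polynomials (p, q) with q nonzero.\<close>

definition in_P1_Qbar :: "complex option \<Rightarrow> bool" where
  "in_P1_Qbar P = (case P of None \<Rightarrow> True | Some x \<Rightarrow> algebraic x)"

definition cpoly :: "rat poly \<Rightarrow> complex poly" where
  "cpoly p = map_poly of_rat p"

definition rf_apply :: "complex poly \<Rightarrow> complex poly \<Rightarrow> complex option \<Rightarrow> complex option" where
  "rf_apply p q P =
     (case P of
        Some x \<Rightarrow> (if poly q x = 0 then None else Some (poly p x / poly q x))
      | None \<Rightarrow> (if degree p > degree q then None
                 else Some (if degree p = degree q then lead_coeff p / lead_coeff q else 0)))"

definition rf_degree :: "complex poly \<Rightarrow> complex poly \<Rightarrow> nat" where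
  "rf_degree p q = max (degree p) (degree q)"

text \<open>Ramification index e_P: the multiplicity of P as a solution of phi(z) = phi(P).\<close>
definition ram_index :: "complex poly \<Rightarrow> complex poly \<Rightarrow> complex option \<Rightarrow> nat" where
  "ram_index p q P =
     (case P of
        Some x \<Rightarrow> (case rf_apply p q (Some x) of
                     Some c \<Rightarrow> Polynomial.order x (p - smult c q)
                   | None \<Rightarrow> Polynomial.order x q)
      | None \<Rightarrow> (case rf_apply p q None of
                   Some c \<Rightarrow> rf_degree p q - degree (p - smult c q)
                 | None \<Rightarrow> degree p - degree q))"

definition critical_point :: "complex poly \<Rightarrow> complex poly \<Rightarrow> complex option \<Rightarrow> bool" where
  "critical_point p q P \<longleftrightarrow> ram_index p q P > 1"

definition periodic_pt :: "complex poly \<Rightarrow> complex poly \<Rightarrow> nat \<Rightarrow> complex option \<Rightarrow> bool" where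
  "periodic_pt p q n P \<longleftrightarrow> n > 0 \<and> (rf_apply p q ^^ n) P = P \<and>
      (\<forall>m. 0 < m \<and> m < n \<longrightarrow> (rf_apply p q ^^ m) P \<noteq> P)"

definition mobius :: "complex \<Rightarrow> complex \<Rightarrow> complex \<Rightarrow> complex \<Rightarrow> complex option \<Rightarrow> complex option" where
  "mobius a b c d = rf_apply [:b, a:] [:d, c:]"

definition lin_conj_over :: "complex set \<Rightarrow> complex poly \<Rightarrow> complex poly \<Rightarrow> complex poly \<Rightarrow> complex poly \<Rightarrow> bool" where
  "lin_conj_over K p q p' q' \<longleftrightarrow>
     (\<exists>a\<in>K. \<exists>b\<in>K. \<exists>c\<in>K. \<exists>d\<in>K. a * d - b * c \<noteq> 0 \<and>
        Hilbert_Choice.inv (mobius a b c d) \<circ> rf_apply p q \<circ> mobius a b c d = rf_apply p' q')"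

definition Aut_set :: "complex poly \<Rightarrow> complex poly \<Rightarrow> (complex option \<Rightarrow> complex option) set" where
  "Aut_set p q = {mobius a b c d | a b c d. algebraic a \<and> algebraic b \<and> algebraic c \<and> algebraic d
      \<and> a * d - b * c \<noteq> 0
      \<and> Hilbert_Choice.inv (mobius a b c d) \<circ> rf_apply p q \<circ> mobius a b c d = rf_apply p q}"

definition phi_v_num :: "rat \<Rightarrow> rat poly" where
  "phi_v_num v = [:- v, v:]"

definition phi_v_den :: "rat poly" where
  "phi_v_den = [:0, 0, 1:]"

definition eta :: "rat \<Rightarrow> rat" where
  "eta t = (t ^ 3 + 3 * t ^ 2 - 6 * t + 1) / (t * (t - 1))"

definition Im_eta :: "rat set" where
  "Im_eta = {eta u | u. u \<noteq> 0 \<and> u \<noteq> 1}"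

definition is_subfield :: "complex set \<Rightarrow> bool" where
  "is_subfield K \<longleftrightarrow> 0 \<in> K \<and> 1 \<in> K \<and>
     (\<forall>x\<in>K. \<forall>y\<in>K. x + y \<in> K \<and> x * y \<in> K) \<and>
     (\<forall>x\<in>K. - x \<in> K \<and> inverse x \<in> K)"

definition gen_field :: "complex set \<Rightarrow> complex set" where
  "gen_field S = \<Inter>{K. is_subfield K \<and> S \<subseteq> K}"

text \<open>Q_{3,phi}: compositum of Q(P) over all 3-periodic P (Q(infinity) = Q).\<close>
definition dynatomic_field3 :: "complex poly \<Rightarrow> complex poly \<Rightarrow> complex set" where
  "dynatomic_field3 p q = gen_field {x. algebraic x \<and> periodic_pt p q 3 (Some x)}"

definition Gal_group :: "complex set \<Rightarrow> (complex \<Rightarrow> complex) monoid" where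
  "Gal_group K = \<lparr> carrier = {s. bij_betw s K K \<and>
       (\<forall>x\<in>K. \<forall>y\<in>K. s (x + y) = s x + s y \<and> s (x * y) = s x * s y) \<and>
       (\<forall>r::rat. s (of_rat r) = of_rat r) \<and>
       (\<forall>x. x \<notin> K \<longrightarrow> s x = x)},
     mult = (\<circ>), one = id \<rparr>"

definition C_group :: "(nat \<Rightarrow> nat) monoid" where
  "C_group = (sym_group 6) \<lparr> carrier := generate (sym_group 6)
      {cycle_of_list [1, 6] \<circ> cycle_of_list [2, 4] \<circ> cycle_of_list [3, 5],
       cycle_of_list [1, 2, 3] \<circ> cycle_of_list [4, 6, 5]} \<rparr>"

definition wreath_group :: "(nat \<Rightarrow> nat) monoid" where
  "wreath_group = (sym_group 6) \<lparr> carrier :=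
      {g \<in> carrier (sym_group 6).
         g \<circ> (cycle_of_list [1, 2, 3] \<circ> cycle_of_list [4, 5, 6])
           = (cycle_of_list [1, 2, 3] \<circ> cycle_of_list [4, 5, 6]) \<circ> g} \<rparr>"

end

theory Submission
  imports Defs "HOL-Computational_Algebra.Nth_Powers"
begin

text \<open>
  A critical point of period 2 is rational: an irrational one would be swapped with its conjugate, and
  then the map is conjugate to \<open>1/z\<^sup>2\<close> and has an automorphism of order 3. Moving the 2-cycle to
  \<open>0, \<infinity>\<close> gives the normal form \<open>\<phi>\<^sub>v\<close>.

  Let \<open>\<omega>\<close> be a primitive third root of unity. The dynatomic sextic of \<open>\<phi>\<^sub>v\<close> splits over \<open>\<rat>(\<omega>)\<close> into
  two conjugate cubics, and in the coordinate \<open>\<theta> = 1 - (2 + \<omega>)/x\<close> the first of them becomes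
  \<open>\<theta>\<^sup>3 = \<alpha>\<close> with \<open>\<alpha> = 1 - 3(2 + \<omega>)/v\<close>, on which \<open>\<phi>\<^sub>v\<close> acts as \<open>\<theta> \<mapsto> \<omega>\<^sup>2 \<theta>\<close>. Hence the dynatomic field
  is \<open>\<rat>(\<omega>, \<theta>, cnj \<theta>)\<close>, and its Galois group is determined by Kummer theory. The norm of \<open>\<alpha>\<close> is
  \<open>((v - 3)\<^sup>3 + 27) / v\<^sup>3\<close>, which is not a cube for \<open>v \<noteq> 0, 3\<close> by Fermat's theorem for exponent 3, so the
  only possible degeneration is that \<open>cnj \<alpha> / \<alpha>\<close> is a cube in \<open>\<rat>(\<omega>)\<close>; this happens exactly when
  \<open>v = \<eta>(t)\<close>, with cube root \<open>(t + \<omega>)/(t + \<omega>\<^sup>2)\<close>.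
\<close>

section \<open>Fermat's theorem for cubes\<close>

text \<open>The classes of \<alpha> and \<open>cnj \<alpha>\<close> span a vector space over the
  field with three elements inside the units of \<rat>(\<omega>) modulo cubes, and conjugation swaps
  them. The relations between them are stable under this involution, so if there is a nontrivial
  one, then \<open>\<alpha> * cnj \<alpha>\<close> or \<open>cnj \<alpha> / \<alpha>\<close> is a
  cube. The former is rational, and a rational number that is a cube in \<rat>(\<omega>) is the cube
  of a rational: this is where Fermat enters. The value v = 3 is genuinely exceptional, since there
  \<alpha> = \<open>\<omega>^2\<close> has norm 1. The upper bound on the Galois group is dynamical:
  automorphisms commute with the map, which permutes the six periodic points in two 3-cycles. The
  lower bound exhibits automorphisms instead of counting degrees. The origin of \<eta> is the cube
  \<open>(t + \<omega>^2)^3\<close>: its coordinates with respect to 1 and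
  \<open>- 3 * (2 + \<omega>)\<close> are the numerator and the denominator of \<eta>. Triviality of
  Aut is used twice: against an irrational critical point, and against a vanishing middle
  coefficient in the normal form.\<close>

lemmas expand = power2_eq_square power3_eq_cube algebra_simps

lemma coprime_add_multI: "coprime m n \<Longrightarrow> coprime m (k * m + n)" for m n k :: int
  by (simp add: coprime_iff_gcd_eq_1 gcd_add_mult)

text \<open>Unique factorization applied to absolute values; the sign is absorbed because -1 is a
  cube.\<close>

lemma coprime_mult_eq_cube:
  fixes a b c :: int
  assumes "coprime a b" "a * b = c ^ 3"
  obtains d where "a = d ^ 3"
proof -
  have "nat \<bar>a\<bar> * nat \<bar>b\<bar> = nat \<bar>c\<bar> ^ 3"
    using assms(2) by (metis abs_mult nat_abs_mult_distrib nat_power_eq power_abs abs_ge_zero)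
  moreover have "coprime (nat \<bar>a\<bar>) (nat \<bar>b\<bar>)"
    using assms(1) by (simp add: coprime_nat_abs_left_iff coprime_nat_abs_right_iff)
  ultimately have "is_nth_power 3 (nat \<bar>a\<bar>)"
    by (metis is_nth_power_mult_coprime_nat_iff is_nth_power_nth_power)
  then obtain m where m: "nat \<bar>a\<bar> = m ^ 3"
    by (elim is_nth_powerE)
  then have "\<bar>a\<bar> = int m ^ 3"
    by (metis abs_ge_zero int_nat_eq of_nat_power)
  then have "a = (if a < 0 then - int m else int m) ^ 3"
    by (auto simp: abs_if split: if_splits)
  then show thesis using that by blast
qed

text \<open>Pigeonhole: with n the integer part of the square root of r, the (n+1)^2 > r pairs in
  the square [0,n] x [0,n] cannot have distinct residues \<open>i - x * j\<close> modulo r. The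
  difference of two colliding pairs is the answer; its bounds are strict because a prime is not a
  perfect square.\<close>

lemma thue:
  fixes r x :: int
  assumes r: "prime r"
  obtains c d where "(c, d) \<noteq> (0, 0)" "c\<^sup>2 < r" "d\<^sup>2 < r" "r dvd c - x * d"
proof -
  have r0: "r > 0" using r by (simp add: prime_gt_0_int)
  define n where "n = nat \<lfloor>sqrt (of_int r)\<rfloor>"
  have n1: "int n ^ 2 \<le> r"
  proof -
    have "of_int (int n) \<le> sqrt (of_int r)" unfolding n_def using r0 by simp
    then have "(of_int (int n))\<^sup>2 \<le> (of_int r :: real)"
      using r0 by (metis of_int_0_le_iff of_nat_0_le_iff of_int_of_nat_eq order_less_imp_le power_mono real_sqrt_pow2)
    then show ?thesis by (metis of_int_le_iff of_int_power)
  qed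
  have n2: "r < (int n + 1) ^ 2"
  proof -
    have "sqrt (of_int r) < of_int (int n + 1)" unfolding n_def using r0 by linarith
    then have "of_int r < (of_int (int n + 1) :: real)\<^sup>2"
      using real_less_lsqrt sqrt_le_D by (metis linorder_not_less of_int_0_le_iff of_nat_0_le_iff add_nonneg_nonneg real_le_rsqrt zero_le_one)
    then show ?thesis by (metis of_int_less_iff of_int_power)
  qed
  have n3: "int n ^ 2 \<noteq> r"
    using r prime_power_iff[of "int n" 2] by auto
  let ?S = "{0..int n} \<times> {0..int n}"
  let ?f = "\<lambda>(i, j). (i - x * j) mod r"
  have "?f ` ?S \<subseteq> {0..<r}" using r0 by auto
  then have "card (?f ` ?S) \<le> nat r"
    using card_mono[of "{0..<r}" "?f ` ?S"] by simp
  moreover have "int (card ?S) > r" using n2 by (simp add: power2_eq_square algebra_simps)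
  ultimately have "\<not> inj_on ?f ?S"
    using card_image[of ?f ?S] r0 by linarith
  then obtain i j i' j' where ij: "i \<in> {0..int n}" "j \<in> {0..int n}" "i' \<in> {0..int n}" "j' \<in> {0..int n}"
    "(i, j) \<noteq> (i', j')" "(i - x * j) mod r = (i' - x * j') mod r"
    unfolding inj_on_def by auto
  have bd: "(s - t)\<^sup>2 < r" if "s \<in> {0..int n}" "t \<in> {0..int n}" for s t
  proof -
    have "\<bar>s - t\<bar> \<le> \<bar>int n\<bar>" using that by auto
    then have "(s - t)\<^sup>2 \<le> (int n)\<^sup>2" using abs_le_square_iff by blast
    then show ?thesis using n1 n3 by linarith
  qed
  have "r dvd (i - x * j) - (i' - x * j')" using ij(6) by (simp add: mod_eq_dvd_iff)
  then have "r dvd (i - i') - x * (j - j')" by (simp add: algebra_simps)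
  moreover have "(i - i', j - j') \<noteq> (0, 0)" using ij(5) by auto
  ultimately show thesis using that[of "i - i'" "j - j'"] bd ij by blast
qed

text \<open>Thue's lemma applied to a square root of -3 modulo r yields
  \<open>c^2 + 3 * d^2 = r * m\<close> with 0 < m < 4. If m = 2, then c and d have the same parity,
  so 4 divides the left side and r would be even; if m = 3, then 3 divides c and one divides by
  3.\<close>

lemma prime_eq_square_plus_3_square:
  fixes r p q :: int
  assumes r: "prime r" "odd r" and dvd: "r dvd p\<^sup>2 + 3 * q\<^sup>2" and q: "\<not> r dvd q"
  obtains c d where "r = c\<^sup>2 + 3 * d\<^sup>2"
proof -
  have r0: "r > 1" using r by (simp add: prime_gt_1_int)
  have "coprime q r" using r q by (meson coprime_commute prime_imp_coprime)
  then obtain t t'' where "t * q + t'' * r = 1" using bezout_int[of q r] by auto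
  then have "q * t - 1 = - t'' * r" by (simp add: algebra_simps)
  then have t': "r dvd q * t - 1" by simp
  \<comment> \<open>As t inverts q modulo r, the residue \<open>p * t\<close> is a square root of
    -3.\<close>
  obtain c d where cd: "(c, d) \<noteq> (0, 0)" "c\<^sup>2 < r" "d\<^sup>2 < r" "r dvd c - p * t * d"
    using thue[OF r(1)] by metis
  have "r dvd c\<^sup>2 + 3 * d\<^sup>2"
  proof -
    have "c\<^sup>2 + 3 * d\<^sup>2 = (c - p*t*d) * (c + p*t*d) + d\<^sup>2 * (t\<^sup>2 * (p\<^sup>2 + 3 * q\<^sup>2)) - 3 * d\<^sup>2 * ((q*t-1)*(q*t+1))"
      by (simp add: power2_eq_square algebra_simps)
    then show ?thesis using cd(4) dvd t' by (simp add: dvd_add dvd_diff dvd_mult dvd_mult2)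
  qed
  then obtain m where m: "c\<^sup>2 + 3 * d\<^sup>2 = r * m" by (elim dvdE)
  have pos: "c\<^sup>2 + 3 * d\<^sup>2 > 0" using cd(1)
    by (metis Pair_inject add_nonneg_pos add_pos_nonneg mult_pos_pos mult_nonneg_nonneg zero_less_numeral zero_le_power2 zero_less_power2 zero_le_numeral)
  have "r * m < r * 4" using m cd by linarith
  then have "m < 4" using r0 by simp
  moreover have "m > 0" using m pos r0 by (simp add: zero_less_mult_iff)
  ultimately consider "m = 1" | "m = 2" | "m = 3" by linarith
  then show thesis
  proof cases
    case 1 then show thesis using m that[of c d] by simp
  next
    case 2
    have par: "even c \<longleftrightarrow> even d"
    proof -
      have "even (c\<^sup>2 + 3 * d\<^sup>2)" using m 2 by simp
      then show ?thesis by simp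
    qed
    have "4 dvd c\<^sup>2 + 3 * d\<^sup>2"
    proof (cases "even c")
      case True
      then obtain c' d' where "c = 2 * c'" "d = 2 * d'" using par by (metis evenE)
      then show ?thesis by (simp add: power2_eq_square)
    next
      case False
      then obtain c' d' where "c = 2 * c' + 1" "d = 2 * d' + 1" using par by (metis oddE)
      then have "c\<^sup>2 + 3 * d\<^sup>2 = 4 * (c'*c' + c' + 3*d'*d' + 3*d' + 1)"
        by (simp add: power2_eq_square algebra_simps)
      then show ?thesis by simp
    qed
    then have "4 dvd 2 * r" using m 2 by (simp add: mult.commute)
    then have "even r" by presburger
    then show thesis using r by simp
  next
    case 3
    then have "3 dvd c\<^sup>2" using m by presburger
    then have "3 dvd c" using prime_dvd_power_int[of 3 c 2] by simp
    then obtain e where "c = 3 * e" by (elim dvdE)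
    then have "d\<^sup>2 + 3 * e\<^sup>2 = r" using m 3 by (simp add: power2_eq_square)
    then show thesis using that by metis
  qed
qed

lemma dvd_one_of_dvd_mult_power:
  fixes r a b :: int
  assumes "prime r" "r ^ n dvd a * b" "\<not> (r dvd a \<and> r dvd b)"
  shows "r ^ n dvd a \<or> r ^ n dvd b"
proof (cases "r dvd a")
  case True
  then have "coprime (r ^ n) b" using assms by (simp add: prime_imp_coprime)
  then show ?thesis using assms(2) by (simp add: coprime_dvd_mult_left_iff)
next
  case False
  then have "coprime (r ^ n) a" using assms by (simp add: prime_imp_coprime)
  then show ?thesis using assms(2) by (simp add: coprime_dvd_mult_right_iff)
qed

text \<open>The formulas are the components of \<open>(u + v \<surd>(-3))\<^sup>3\<close>. The induction divides
  \<open>p + q \<surd>(-3)\<close> by the cube of an element of norm \<open>r\<close>, for a prime \<open>r\<close> dividing \<open>s\<close>.\<close>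
lemma norm_cube_imp_cube:
  fixes p q s :: int
  assumes "p\<^sup>2 + 3 * q\<^sup>2 = s ^ 3" "coprime p q" "odd s"
  shows "\<exists>u v. p = u ^ 3 - 9 * u * v\<^sup>2 \<and> q = 3 * u\<^sup>2 * v - 3 * v ^ 3"
  using assms
proof (induction "nat s" arbitrary: s p q rule: less_induct)
  case less
  note eq = less.prems(1) and cop = less.prems(2) and odd = less.prems(3)
  have "s ^ 3 \<ge> 0" using eq by (metis add_nonneg_nonneg mult_nonneg_nonneg zero_le_numeral zero_le_power2)
  then have s0: "s > 0" using odd by (cases "s = 0") (auto simp: zero_le_power_eq)
  show ?case
  proof (cases "s = 1")
    case True
    then have e: "p\<^sup>2 + 3 * q\<^sup>2 = 1" using eq by simp
    have "q = 0"
    proof (rule ccontr)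
      assume "q \<noteq> 0"
      then have "q\<^sup>2 \<ge> 1" by (simp add: int_one_le_iff_zero_less)
      then show False using e zero_le_power2[of p] by linarith
    qed
    moreover have "p ^ 3 = p" using e \<open>q = 0\<close> by (simp add: power2_eq_square power3_eq_cube)
    ultimately have "p = p ^ 3 - 9 * p * 0\<^sup>2 \<and> q = 3 * p\<^sup>2 * 0 - 3 * 0 ^ 3" by simp
    then show ?thesis by blast
  next
    case False
    then obtain r where r: "prime r" "r dvd s" using prime_factor_int[of s] s0 by auto
    obtain t where t: "s = r * t" using r by (elim dvdE)
    have r0: "r > 1" using r by (simp add: prime_gt_1_int)
    have oddr: "odd r" using odd t by auto
    have rd: "r dvd p\<^sup>2 + 3 * q\<^sup>2" using eq t by (simp add: power3_eq_cube)
    have r3: "r \<noteq> 3"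
    proof
      assume r3: "r = 3"
      have "3 dvd p\<^sup>2" using rd r3 by presburger
      then have "3 dvd p" using prime_dvd_power_int[of 3 p 2] by simp
      then obtain p' where p': "p = 3 * p'" by (elim dvdE)
      have "3 * q\<^sup>2 = 27 * t^3 - 9 * p'^2" using eq t r3 p' by (simp add: power_mult_distrib)
      then have "3 dvd q\<^sup>2" by presburger
      then have "3 dvd q" using prime_dvd_power_int[of 3 q 2] by simp
      then show False using \<open>3 dvd p\<close> cop not_coprimeI[of 3 p q] by (auto dest: coprime_common_divisor)
    qed
    have unit: "\<not> (r dvd p \<and> r dvd q)" using cop r0 by (auto dest: coprime_common_divisor)
    have r2: "\<not> r dvd 2" using oddr r primes_dvd_imp_eq[of r 2] by auto
    have r3': "\<not> r dvd 3" using r3 r primes_dvd_imp_eq[of r 3] by auto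
    have rq: "\<not> r dvd q"
    proof
      assume "r dvd q"
      then have "r dvd p\<^sup>2" using rd by (metis dvd_add_left_iff dvd_mult dvd_power dvd_trans zero_less_numeral)
      then have "r dvd p" using r prime_dvd_power_int by blast
      then show False using unit \<open>r dvd q\<close> by simp
    qed
    obtain c d where cd: "r = c\<^sup>2 + 3 * d\<^sup>2" using prime_eq_square_plus_3_square[OF r(1) oddr rd rq] .
    have rd': "\<not> r dvd d"
    proof
      assume "r dvd d"
      moreover then have "r dvd c\<^sup>2" using cd by (metis dvd_add_left_iff dvd_mult dvd_power dvd_refl dvd_trans zero_less_numeral)
      then have "r dvd c" using r prime_dvd_power_int by blast
      ultimately obtain c' d' where cd': "c = r * c'" "d = r * d'" by (auto elim!: dvdE)
      have "c\<^sup>2 + 3 * d\<^sup>2 = r * (r * (c'\<^sup>2 + 3 * d'\<^sup>2))"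
        unfolding cd' by (simp add: power2_eq_square algebra_simps)
      then have "r * 1 = r * (r * (c'\<^sup>2 + 3 * d'\<^sup>2))" using cd by simp
      then have "r dvd 1" using r0 by (metis dvd_triv_left mult_cancel_left not_one_less_zero)
      then show False using r0 by simp
    qed
    \<comment> \<open>Since \<open>c^2 = r - 3 * d^2\<close>, D is congruent to
      \<open>- 12 * d^3\<close> modulo r. This keeps the two conjugate candidates for division apart
      below.\<close>
    have D: "\<not> r dvd 3 * c\<^sup>2 * d - 3 * d^3"
    proof
      assume "r dvd 3 * c\<^sup>2 * d - 3 * d^3"
      moreover have "3 * c\<^sup>2 * d - 3 * d^3 = 3 * d * r - 2 * 2 * 3 * d * d * d"
        by (simp add: cd power2_eq_square power3_eq_cube algebra_simps)
      ultimately have "r dvd 2 * 2 * 3 * d * d * d" by (metis dvd_diff_commute dvd_diff_left_iff dvd_triv_right dvd_diff_right_iff)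
      then show False using r r2 r3' rd' by (simp only: prime_dvd_mult_iff prime_imp_prime_elem prime_elem_dvd_mult_iff simp_thms)
    qed
    \<comment> \<open>Division of \<open>p + q * sqrt (-3)\<close> by
      \<open>C + D * sqrt (-3)\<close>, the cube of \<open>c + d * sqrt (-3)\<close>: multiplying by
      the conjugate gives \<open>(p*C + 3*q*D) + (q*C - p*D) * sqrt (-3)\<close>. If
      \<open>r^3\<close> divides the second coordinate, the norm equation forces it to divide the
      first.\<close>
    have step: ?thesis if rr: "r = c\<^sup>2 + 3 * d\<^sup>2" and CD: "C = c^3 - 9*c*d\<^sup>2" "D = 3*c\<^sup>2*d - 3*d^3"
      and dv: "r^3 dvd q * C - p * D" for c d C D
    proof -
      have n: "C\<^sup>2 + 3 * D\<^sup>2 = r^3" unfolding CD rr by (simp add: expand)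
      have "(p*C + 3*q*D)\<^sup>2 + 3 * (q*C - p*D)\<^sup>2 = (p\<^sup>2 + 3*q\<^sup>2) * (C\<^sup>2 + 3 * D\<^sup>2)" by (simp add: expand)
      also have "\<dots> = (r^3)\<^sup>2 * t^3" unfolding n eq t by (simp add: expand)
      finally have e: "(p*C + 3*q*D)\<^sup>2 + 3 * (q*C - p*D)\<^sup>2 = (r^3)\<^sup>2 * t^3" .
      obtain q' where q': "q * C - p * D = r^3 * q'" using dv by (elim dvdE)
      have "(p*C + 3*q*D)\<^sup>2 = (r^3)\<^sup>2 * (t^3 - 3 * q'\<^sup>2)" using e unfolding q' by (simp add: power_mult_distrib algebra_simps)
      then have "(r^3)\<^sup>2 dvd (p*C + 3*q*D)\<^sup>2" by simp
      then have "r^3 dvd p*C + 3*q*D" by (simp only: pow_divides_pow_iff zero_less_numeral)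
      then obtain p' where p': "p*C + 3*q*D = r^3 * p'" by (elim dvdE)
      have r30: "r^3 \<noteq> 0" using r0 by simp
      have "(C\<^sup>2 + 3 * D\<^sup>2) * p = C * (p*C + 3*q*D) - 3 * D * (q * C - p * D)"
        by (simp add: expand)
      then have "r^3 * p = r^3 * (p'*C - 3*q'*D)"
        unfolding n p' q' by (simp add: algebra_simps)
      then have pp: "p = p'*C - 3*q'*D" using r30 by simp
      have "(C\<^sup>2 + 3 * D\<^sup>2) * q = D * (p*C + 3*q*D) + C * (q * C - p * D)"
        by (simp add: expand)
      then have "r^3 * q = r^3 * (p'*D + q'*C)"
        unfolding n p' q' by (simp add: algebra_simps)
      then have qq: "q = p'*D + q'*C" using r30 by simp
      have "(r^3)\<^sup>2 * (p'\<^sup>2 + 3 * q'\<^sup>2) = (r^3)\<^sup>2 * t^3" using e unfolding p' q' by (simp add: power_mult_distrib algebra_simps)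
      then have n': "p'\<^sup>2 + 3 * q'\<^sup>2 = t^3" using r30 by simp
      have cop': "coprime p' q'"
      proof (rule coprimeI)
        fix g assume "g dvd p'" "g dvd q'"
        then have "g dvd p" "g dvd q" unfolding pp qq by (auto intro!: dvd_add dvd_diff simp: dvd_mult dvd_mult2)
        then show "is_unit g" using cop by (meson coprime_common_divisor)
      qed
      have "odd t" using odd t by auto
      have "t > 0" using s0 t r0 by (simp add: zero_less_mult_iff)
      then have "nat t < nat s" using t r0 by simp
      from less.hyps[OF this n' cop' \<open>odd t\<close>] obtain u v where
        uv: "p' = u^3 - 9*u*v\<^sup>2" "q' = 3*u\<^sup>2*v - 3*v^3" by blast
      \<comment> \<open>The new pair is the product of \<open>u + v * sqrt (-3)\<close> and
        \<open>c + d * sqrt (-3)\<close>.\<close>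
      have "p = (u*c - 3*v*d)^3 - 9*(u*c-3*v*d)*(u*d+v*c)\<^sup>2"
        unfolding pp uv CD by (simp add: expand)
      moreover have "q = 3*(u*c-3*v*d)\<^sup>2*(u*d+v*c) - 3*(u*d+v*c)^3"
        unfolding qq uv CD by (simp add: expand)
      ultimately show ?thesis by blast
    qed
    define C where "C = c^3 - 9*c*d\<^sup>2"
    define D where "D = 3*c\<^sup>2*d - 3*d^3"
    \<comment> \<open>The two factors correspond to dividing by the cube or by its conjugate. Their
      product is divisible by \<open>r^3\<close>, but r cannot divide both, so the whole power lies
      in one of them.\<close>
    have "(q*C - p*D) * (q*C + p*D) = q\<^sup>2*(C\<^sup>2+3*D\<^sup>2) - D\<^sup>2*(p\<^sup>2+3*q\<^sup>2)" by (simp add: expand)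
    also have "C\<^sup>2+3*D\<^sup>2 = r^3" unfolding C_def D_def cd by (simp add: expand)
    also have "q\<^sup>2*r^3 - D\<^sup>2*(p\<^sup>2+3*q\<^sup>2) = r^3 * (q\<^sup>2 - D\<^sup>2*t^3)" unfolding eq t by (simp add: expand)
    finally have "r^3 dvd (q*C - p*D) * (q*C + p*D)" by simp
    moreover have "\<not> (r dvd q*C - p*D \<and> r dvd q*C + p*D)"
    proof
      assume a: "r dvd q*C - p*D \<and> r dvd q*C + p*D"
      then have "r dvd (q*C + p*D) - (q*C - p*D)" by (blast intro: dvd_diff)
      then have "r dvd 2 * p * D" by (simp add: algebra_simps)
      then have "r dvd p" using r r2 D by (simp add: prime_dvd_mult_iff D_def)
      then have "r dvd 3 * q\<^sup>2" using rd by (metis dvd_add_right_iff dvd_power dvd_trans zero_less_numeral)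
      then have "r dvd q" using r r3' by (simp add: prime_dvd_mult_iff prime_dvd_power_iff)
      then show False using rq by simp
    qed
    ultimately consider "r^3 dvd q*C - p*D" | "r^3 dvd q*C + p*D"
      using dvd_one_of_dvd_mult_power[OF r(1)] by blast
    then show ?thesis
    proof cases
      case 1
      then show ?thesis using step[OF cd C_def D_def] by simp
    next
      case 2
      have "r = c\<^sup>2 + 3*(-d)\<^sup>2" "C = c^3 - 9*c*(-d)\<^sup>2" "-D = 3*c\<^sup>2*(-d) - 3*(-d)^3"
        using cd by (simp_all add: C_def D_def)
      moreover have "r^3 dvd q * C - p * - D" using 2 by simp
      ultimately show ?thesis by (rule step)
    qed
  qed
qed

section \<open>Euler's infinite descent for sums of two cubes\<close>

lemma cube_dvd_lt:
  fixes A z s u :: int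
  assumes "A ^ 3 = u" "u dvd w" "w * s = z ^ 3" "z \<noteq> 0" "\<bar>s\<bar> > 1"
  shows "\<bar>A\<bar> < \<bar>z\<bar>"
proof -
  have w0: "w \<noteq> 0" using assms by auto
  have "\<bar>A\<bar> ^ 3 = \<bar>u\<bar>" using assms(1) by (simp flip: power_abs)
  also have "\<dots> \<le> \<bar>w\<bar>" using w0 assms(2) by (simp add: dvd_imp_le_int)
  also have "\<dots> < \<bar>w\<bar> * \<bar>s\<bar>" using w0 assms(5) by simp
  also have "\<dots> = \<bar>z\<bar> ^ 3" using assms(3) by (simp flip: power_abs abs_mult)
  finally show ?thesis by (rule power_less_imp_less_base) simp
qed

text \<open>With \<open>x = p + q\<close> and \<open>y = p - q\<close> the equation reads
  \<open>2 * p * (p^2 + 3 * q^2) = z^3\<close>, where the two factors share at most a 3. Once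
  \<open>p^2 + 3 * q^2\<close> is isolated as a cube, \<open>norm_cube_imp_cube\<close> factors p so
  that three pairwise coprime cubes appear in a linear relation, which is the smaller
  solution.\<close>

lemma sum_two_cubes_eq_even_cube_descent:
  fixes x y z :: int
  assumes eq: "x ^ 3 + y ^ 3 = z ^ 3" and cop: "coprime x y" and z: "even z" "z \<noteq> 0"
  shows "\<exists>x' y' z'. x' ^ 3 + y' ^ 3 = z' ^ 3 \<and> coprime x' y' \<and> even z' \<and> z' \<noteq> (0::int) \<and> \<bar>z'\<bar> < \<bar>z\<bar>"
proof -
  have "even (x ^ 3 + y ^ 3)" using z(1) unfolding eq by simp
  then have "even x \<longleftrightarrow> even y" by simp
  then have "odd x" "odd y" using cop by (auto dest: coprime_common_divisor)
  then obtain p q where xy: "x = p + q" "y = p - q"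
    by (metis (no_types, opaque_lifting) add_diff_cancel_left' diff_add_cancel even_diff evenE odd_even_add mult_2 add.commute diff_add_eq even_add add_diff_eq)
  have z3: "2 * p * (p\<^sup>2 + 3 * q\<^sup>2) = z ^ 3" unfolding eq[symmetric] xy
    by (simp add: power2_eq_square power3_eq_cube algebra_simps)
  have pq: "coprime p q"
  proof (rule coprimeI)
    fix g assume "g dvd p" "g dvd q"
    then have "g dvd x" "g dvd y" unfolding xy by auto
    then show "is_unit g" using cop by (meson coprime_common_divisor)
  qed
  have par: "odd (p + q)" using \<open>odd x\<close> xy by simp
  have odds: "odd (p\<^sup>2 + 3 * q\<^sup>2)" using par by auto
  have p0: "p \<noteq> 0" using z3 z by auto
  \<comment> \<open>Needed for strict descent. Equality could only occur for q = 0 and p = 1 or -1,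
    which makes \<open>z^3\<close> equal to 2 or -2.\<close>
  have big: "p\<^sup>2 + 3 * q\<^sup>2 > 1"
  proof (cases "q = 0")
    case True
    then have "p = 1 \<or> p = -1" using pq by auto
    then have "z ^ 3 = 2 \<or> z ^ 3 = - 2" using z3 True by auto
    moreover have "8 dvd z ^ 3" using z(1) by (auto elim!: evenE simp: power3_eq_cube)
    ultimately show ?thesis by auto
  next
    case False
    then have "q\<^sup>2 > 0" "p\<^sup>2 > 0" using p0 by auto
    then show ?thesis by linarith
  qed
  have par_uv: "odd (u + v)" if "odd (p + q)" "p + q = u ^ 3 - 9 * u * v\<^sup>2 + (3 * u\<^sup>2 * v - 3 * v ^ 3)" for u v :: int
  proof
    assume "even (u + v)"
    then obtain k where u: "u = 2 * k - v" by (metis evenE add_diff_cancel_right')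
    have "p + q = 2 * (4*k^3 - 12*k*v*v + 4*v^3)" using that(2) unfolding u
      by (simp add: power2_eq_square power3_eq_cube algebra_simps)
    then show False using that(1) by simp
  qed
  show ?thesis
  proof (cases "3 dvd p")
    case False
    then have p3: "coprime p 3" using prime_imp_coprime[of 3 p] by (simp add: coprime_commute)
    have "coprime p (p\<^sup>2 + 3 * q\<^sup>2)"
    proof -
      have "coprime p (3 * q\<^sup>2)" using p3 pq by simp
      then show ?thesis using coprime_add_multI[of p "3 * q\<^sup>2" p] by (simp add: power2_eq_square)
    \<comment> \<open>The coprime case: \<open>2 * p = 2 * u * (u - 3 * v) * (u + 3 * v)\<close>,
      and the relation is \<open>(u - 3 * v) + (u + 3 * v) = 2 * u\<close>.\<close>
    qed
    then have c2: "coprime (2 * p) (p\<^sup>2 + 3 * q\<^sup>2)" using odds by simp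
    obtain s where s: "p\<^sup>2 + 3 * q\<^sup>2 = s ^ 3"
      using coprime_mult_eq_cube[of "p\<^sup>2 + 3 * q\<^sup>2" "2 * p" z] c2 z3 by (metis coprime_commute mult.commute)
    obtain e where e: "2 * p = e ^ 3" using coprime_mult_eq_cube[OF c2 z3] by blast
    have "odd s" using odds s by simp
    from norm_cube_imp_cube[OF s pq this] obtain u v where
      uv: "p = u^3 - 9*u*v\<^sup>2" "q = 3*u\<^sup>2*v - 3*v^3" by blast
    have par': "odd (u + v)" using par_uv[OF par] uv by simp
    have copuv: "coprime u v"
    proof (rule coprimeI)
      fix g assume "g dvd u" "g dvd v"
      then have "g dvd p" "g dvd q" unfolding uv by (auto simp: power2_eq_square power3_eq_cube)
      then show "is_unit g" using pq by (meson coprime_common_divisor)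
    qed
    have "p = u * (u\<^sup>2 - 9 * v\<^sup>2)" unfolding uv by (simp add: expand)
    then have u3: "coprime u 3" using p3 by simp
    have cu: "coprime u (3 * v)" using u3 copuv by simp
    have co1: "coprime (2 * u) (u - 3 * v)" "coprime (2 * u) (u + 3 * v)"
    proof -
      have "coprime u (u - 3 * v)" "coprime u (u + 3 * v)" 
        using cu coprime_add_multI[of u "3 * v" 1] coprime_add_multI[of u "- (3 * v)" 1] by simp_all
      moreover have "odd (u - 3 * v)" "odd (u + 3 * v)" using par' by auto
      ultimately show "coprime (2 * u) (u - 3 * v)" "coprime (2 * u) (u + 3 * v)" by simp_all
    qed
    have co2: "coprime (u - 3 * v) (u + 3 * v)"
    proof (rule coprimeI)
      fix g assume g: "g dvd u - 3 * v" "g dvd u + 3 * v"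
      then have "g dvd (u - 3 * v) + (u + 3 * v)" by (rule dvd_add)
      then have "g dvd 2 * u" by simp
      then show "is_unit g" using g co1 by (meson coprime_common_divisor)
    qed
    have e': "2 * u * ((u - 3 * v) * (u + 3 * v)) = e ^ 3" unfolding e[symmetric] uv by (simp add: expand)
    have co3: "coprime (2 * u) ((u - 3 * v) * (u + 3 * v))" using co1 by simp
    obtain A where A: "2 * u = A ^ 3" using coprime_mult_eq_cube[OF co3 e'] by blast
    obtain E where E: "(u - 3 * v) * (u + 3 * v) = E ^ 3"
      using coprime_mult_eq_cube[of "(u - 3 * v) * (u + 3 * v)" "2 * u" e] co3 e' by (metis coprime_commute mult.commute)
    obtain B where B: "u - 3 * v = B ^ 3" using coprime_mult_eq_cube[OF co2 E] by blast
    obtain C where C: "u + 3 * v = C ^ 3"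
      using coprime_mult_eq_cube[of "u + 3 * v" "u - 3 * v" E] co2 E by (metis coprime_commute mult.commute)
    have "B ^ 3 + C ^ 3 = A ^ 3" unfolding A[symmetric] B[symmetric] C[symmetric] by simp
    moreover have "coprime B C" using co2 unfolding B C by simp
    moreover have "even A" using A by (metis dvd_triv_left even_power)
    moreover have "A \<noteq> 0" using A p0 uv by auto
    moreover have "\<bar>A\<bar> < \<bar>z\<bar>"
    proof (rule cube_dvd_lt[OF A[symmetric] _ z3 z(2)])
      have "2 * p = 2 * u * (u\<^sup>2 - 9 * v\<^sup>2)" unfolding uv by (simp add: expand)
      then show "2 * u dvd 2 * p" by simp
    qed (use big in auto)
    ultimately show ?thesis by blast
  next
    case True
    \<comment> \<open>Here q and r exchange roles: \<open>q^2 + 3 * r^2\<close> is the cube,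
      \<open>r = 3 * v * (u - v) * (u + v)\<close>, and the relation is
      \<open>(u + v) - (u - v) = 2 * v\<close>.\<close>
    then obtain r where r: "p = 3 * r" by (elim dvdE)
    have qr: "coprime q r" "coprime q 3" using pq unfolding r by (simp_all add: coprime_commute)
    have z3': "18 * r * (q\<^sup>2 + 3 * r\<^sup>2) = z ^ 3" unfolding z3[symmetric] r by (simp add: expand)
    have odds': "odd (q\<^sup>2 + 3 * r\<^sup>2)" using par unfolding r by auto
    have c2: "coprime (18 * r) (q\<^sup>2 + 3 * r\<^sup>2)"
    proof -
      have a: "coprime r (q\<^sup>2 + 3 * r\<^sup>2)" 
      proof -
        have "coprime r (q\<^sup>2)" using qr by (simp add: coprime_commute)
        then show ?thesis using coprime_add_multI[of r "q\<^sup>2" "3 * r"]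
          by (simp add: power2_eq_square add.commute mult.assoc)
      qed
      have b: "coprime 3 (q\<^sup>2 + 3 * r\<^sup>2)"
      proof -
        have "coprime 3 (q\<^sup>2)" using qr by (simp add: coprime_commute)
        then show ?thesis using coprime_add_multI[of 3 "q\<^sup>2" "r\<^sup>2"]
          by (simp add: add.commute mult.commute)
      qed
      have "coprime (2 * (3 * (3 * r))) (q\<^sup>2 + 3 * r\<^sup>2)" using a b odds' by (simp only: coprime_mult_left_iff coprime_left_2_iff_odd simp_thms)
      then show ?thesis by simp
    qed
    obtain s where s: "q\<^sup>2 + 3 * r\<^sup>2 = s ^ 3"
      using coprime_mult_eq_cube[of "q\<^sup>2 + 3 * r\<^sup>2" "18 * r" z] c2 z3' by (metis coprime_commute mult.commute)
    obtain e where e: "18 * r = e ^ 3" using coprime_mult_eq_cube[OF c2 z3'] by blast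
    have "odd s" using odds' s by simp
    from norm_cube_imp_cube[OF s qr(1) this] obtain u v where
      uv: "q = u^3 - 9*u*v\<^sup>2" "r = 3*u\<^sup>2*v - 3*v^3" by blast
    have par': "odd (u + v)"
    proof
      assume "even (u + v)"
      then obtain k where u: "u = 2 * k - v" by (metis evenE add_diff_cancel_right')
      have "q + r = 2 * (4*k^3 - 12*k*v*v + 4*v^3)" unfolding uv u
        by (simp add: power2_eq_square power3_eq_cube algebra_simps)
      then have "even (q + r)" by simp
      then show False using par r by auto
    qed
    have copuv: "coprime u v"
    proof (rule coprimeI)
      fix g assume "g dvd u" "g dvd v"
      then have "g dvd q" "g dvd r" unfolding uv by (auto simp: power2_eq_square power3_eq_cube)
      then show "is_unit g" using qr by (meson coprime_common_divisor)
    qed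
    have co1: "coprime (2 * v) (u - v)" "coprime (2 * v) (u + v)"
    proof -
      have "coprime v (u - v)" "coprime v (u + v)" 
        using copuv coprime_add_multI[of v u 1] coprime_add_multI[of v u "- 1"]
        by (simp_all add: coprime_commute algebra_simps)
      moreover have "odd (u - v)" "odd (u + v)" using par' by auto
      ultimately show "coprime (2 * v) (u - v)" "coprime (2 * v) (u + v)" by simp_all
    qed
    have co2: "coprime (u - v) (u + v)"
    proof (rule coprimeI)
      fix g assume g: "g dvd u - v" "g dvd u + v"
      then have "g dvd (u + v) - (u - v)" by (blast intro: dvd_diff)
      then have "g dvd 2 * v" by simp
      then show "is_unit g" using g co1 by (meson coprime_common_divisor)
    qed
    have e27: "27 * (2 * v * ((u - v) * (u + v))) = e ^ 3" unfolding e[symmetric] uv by (simp add: expand)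
    then have "3 dvd e ^ 3" by presburger
    then have "3 dvd e" using prime_dvd_power_int[of 3 e 3] by simp
    then obtain f where f: "e = 3 * f" by (elim dvdE)
    have e': "2 * v * ((u - v) * (u + v)) = f ^ 3" using e27 unfolding f by (simp add: power_mult_distrib)
    have co3: "coprime (2 * v) ((u - v) * (u + v))" using co1 by simp
    obtain A where A: "2 * v = A ^ 3" using coprime_mult_eq_cube[OF co3 e'] by blast
    obtain E where E: "(u - v) * (u + v) = E ^ 3"
      using coprime_mult_eq_cube[of "(u - v) * (u + v)" "2 * v" f] co3 e' by (metis coprime_commute mult.commute)
    obtain B where B: "u - v = B ^ 3" using coprime_mult_eq_cube[OF co2 E] by blast
    obtain C where C: "u + v = C ^ 3"
      using coprime_mult_eq_cube[of "u + v" "u - v" E] co2 E by (metis coprime_commute mult.commute)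
    have "C ^ 3 + (- B) ^ 3 = A ^ 3" unfolding A[symmetric] using B[symmetric] C[symmetric] by simp
    moreover have "coprime C (- B)" using co2 unfolding B C by (simp add: coprime_commute)
    moreover have "even A" using A by (metis dvd_triv_left even_power)
    moreover have "A \<noteq> 0" using A p0 uv r by auto
    moreover have "\<bar>A\<bar> < \<bar>z\<bar>"
    proof (rule cube_dvd_lt[OF A[symmetric] _ z3 z(2)])
      have "2 * p = 2 * v * (9 * (u\<^sup>2 - v\<^sup>2))" unfolding uv r by (simp add: expand)
      then show "2 * v dvd 2 * p" by simp
    qed (use big in auto)
    ultimately show ?thesis by blast
  qed
qed

lemma sum_two_cubes_neq_even_cube:
  fixes x y z :: int
  assumes "x ^ 3 + y ^ 3 = z ^ 3" "coprime x y" "even z" "z \<noteq> 0"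
  shows False
  using assms
proof (induction "nat \<bar>z\<bar>" arbitrary: x y z rule: less_induct)
  case less
  from sum_two_cubes_eq_even_cube_descent[OF less.prems] obtain x' y' z' where
    "x' ^ 3 + y' ^ 3 = z' ^ 3" "coprime x' y'" "even z'" "z' \<noteq> (0::int)" "\<bar>z'\<bar> < \<bar>z\<bar>" by blast
  then show False using less.hyps[of z' x' y'] less.prems(4) by (metis abs_ge_zero nat_less_eq_zless)
qed

text \<open>One of the three numbers is even; changing signs moves it to the right-hand side, where
  the descent applies.\<close>

lemma fermat_cubic_coprime:
  fixes x y z :: int
  assumes eq: "x ^ 3 + y ^ 3 = z ^ 3" and cop: "coprime x y"
  shows "x * y * z = 0"
proof (rule ccontr)
  assume nz: "x * y * z \<noteq> 0"
  have cxz: "coprime x z"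
  proof -
    have "coprime (x ^ 3) (y ^ 3)" using cop by (simp add: coprime_commute)
    then have "coprime (x ^ 3) (z ^ 3)" using eq by (metis coprime_iff_gcd_eq_1 gcd_add2 add.commute)
    then show ?thesis by simp
  qed
  have cyz: "coprime y z"
  proof -
    have "coprime (y ^ 3) (x ^ 3)" using cop by (simp add: coprime_commute)
    then have "coprime (y ^ 3) (z ^ 3)" using eq by (metis coprime_iff_gcd_eq_1 gcd_add2 add.commute)
    then show ?thesis by simp
  qed
  have "even z \<or> even x \<or> even y" using eq by (metis even_add even_power)
  then consider "even z" | "even x" | "even y" by blast
  then show False
  proof cases
    case 1 then show False using sum_two_cubes_neq_even_cube[OF eq cop] nz by simp
  next
    case 2
    then show False using sum_two_cubes_neq_even_cube[of z "-y" x] eq cyz nz by (simp add: coprime_commute)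
  next
    case 3
    then show False using sum_two_cubes_neq_even_cube[of z "-x" y] eq cxz nz by (simp add: coprime_commute)
  qed
qed

theorem fermat_cubic_int:
  fixes x y z :: int
  assumes eq: "x ^ 3 + y ^ 3 = z ^ 3"
  shows "x * y * z = 0"
proof (cases "x = 0")
  case False
  define g where "g = gcd x y"
  have g0: "g \<noteq> 0" using False by (simp add: g_def)
  obtain x' y' where xy: "x = g * x'" "y = g * y'" "coprime x' y'"
    using gcd_coprime_exists[of x y] False unfolding g_def by (metis gcd_eq_0_iff mult.commute)
  have "g ^ 3 * (x' ^ 3 + y' ^ 3) = z ^ 3" using eq unfolding xy by (simp add: power_mult_distrib algebra_simps)
  then have "g ^ 3 dvd z ^ 3" by (metis dvd_triv_left)
  then have "g dvd z" by simp
  then obtain z' where z: "z = g * z'" by (elim dvdE)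
  have "x' ^ 3 + y' ^ 3 = z' ^ 3" using \<open>g ^ 3 * _ = _\<close> g0 unfolding z by (simp add: power_mult_distrib)
  then have "x' * y' * z' = 0" using fermat_cubic_coprime xy(3) by blast
  then show ?thesis unfolding xy z by auto
qed simp

theorem fermat_cubic_rat:
  fixes x y z :: rat
  assumes eq: "x ^ 3 + y ^ 3 = z ^ 3"
  shows "x * y * z = 0"
proof -
  obtain a b where x: "x = of_int a / of_int b" "b \<noteq> 0" by (metis quotient_of_div quotient_of_denom_pos surj_pair less_irrefl)
  obtain c d where y: "y = of_int c / of_int d" "d \<noteq> 0" by (metis quotient_of_div quotient_of_denom_pos surj_pair less_irrefl)
  obtain e f where z: "z = of_int e / of_int f" "f \<noteq> 0" by (metis quotient_of_div quotient_of_denom_pos surj_pair less_irrefl)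
  let ?n = "of_int b * of_int d * of_int f :: rat"
  have "x * ?n = of_int (a * d * f)" "y * ?n = of_int (c * b * f)" "z * ?n = of_int (e * b * d)"
    using x y z by simp_all
  moreover have "(x * ?n) ^ 3 + (y * ?n) ^ 3 = (z * ?n) ^ 3"
    using eq by (simp add: power_mult_distrib flip: distrib_right)
  ultimately have "(of_int ((a * d * f) ^ 3 + (c * b * f) ^ 3) :: rat) = of_int ((e * b * d) ^ 3)"
    by (simp only: of_int_add of_int_power)
  then have "(a * d * f) ^ 3 + (c * b * f) ^ 3 = (e * b * d) ^ 3" by (simp only: of_int_eq_iff)
  then have "(a * d * f) * (c * b * f) * (e * b * d) = 0" by (rule fermat_cubic_int)
  then show ?thesis using x y z by auto
qed

section \<open>The field of third roots of unity\<close>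

definition \<omega> :: complex where "\<omega> = Complex (- 1 / 2) (sqrt 3 / 2)"

lemma omega_square: "\<omega>\<^sup>2 = - 1 - \<omega>"
  by (simp add: \<omega>_def complex_eq_iff power2_eq_square field_simps)

text \<open>The second equation catches products that \<open>algebra_simps\<close> nests to the
  right; together they reduce every polynomial in \<omega> to degree one.\<close>

lemma omega_mult: "\<omega> * \<omega> = - 1 - \<omega>" "\<omega> * (\<omega> * x) = - x - \<omega> * x"
proof -
  show *: "\<omega> * \<omega> = - 1 - \<omega>" using omega_square by (simp only: power2_eq_square)
  show "\<omega> * (\<omega> * x) = - x - \<omega> * x"
    unfolding mult.assoc[symmetric] * by (simp add: left_diff_distrib)
qed

lemma omega_cube: "\<omega> ^ 3 = 1"
  by (simp add: power3_eq_cube omega_mult left_diff_distrib)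

lemma cnj_omega: "cnj \<omega> = - 1 - \<omega>"
  by (simp add: \<omega>_def complex_eq_iff)

lemma cnj_of_rat [simp]: "cnj (of_rat r) = of_rat r"
  by (cases r) (simp add: of_rat_rat)

lemma omega_not_rat: "\<omega> \<noteq> of_rat r"
proof
  assume "\<omega> = of_rat r"
  then have "cnj \<omega> = \<omega>" by (metis cnj_of_rat)
  then show False by (simp add: \<omega>_def complex_eq_iff)
qed

lemma omega_neq [simp]: "\<omega> \<noteq> 0" "\<omega> \<noteq> 1" "\<omega> \<noteq> - 1" "\<omega>\<^sup>2 \<noteq> 1" "\<omega>\<^sup>2 \<noteq> \<omega>"
  by (auto simp: \<omega>_def complex_eq_iff power2_eq_square)

lemma complex_cube_eq_iff: "x ^ 3 = y ^ 3 \<longleftrightarrow> x = y \<or> x = \<omega> * y \<or> x = \<omega>\<^sup>2 * y"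
proof -
  have "x ^ 3 - y ^ 3 = (x - y) * (x - \<omega> * y) * (x - \<omega>\<^sup>2 * y)"
    by (simp add: expand omega_mult)
  then show ?thesis by (metis eq_iff_diff_eq_0 mult_eq_0_iff)
qed

lemma omega_lin_eq_iff:
  "of_rat x + of_rat y * \<omega> = of_rat x' + of_rat y' * \<omega> \<longleftrightarrow> x = x' \<and> y = y'"
proof
  assume e: "of_rat x + of_rat y * \<omega> = of_rat x' + of_rat y' * \<omega>"
  have "y = y'"
  proof (rule ccontr)
    assume n: "y \<noteq> y'"
    have "\<omega> * of_rat (y - y') = of_rat (x' - x)" using e by (simp add: of_rat_diff algebra_simps)
    then have "\<omega> = of_rat (x' - x) / of_rat (y - y')" using n by (simp only: nonzero_eq_divide_eq of_rat_eq_0_iff right_minus_eq simp_thms)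
    then have "\<omega> = of_rat ((x' - x) / (y - y'))" by (simp only: of_rat_divide)
    then show False using omega_not_rat by blast
  qed
  then show "x = x' \<and> y = y'" using e by simp
qed simp

section \<open>Subfields of the complex numbers\<close>

lemma subfieldI:
  assumes "1 \<in> K" "\<And>x y. x \<in> K \<Longrightarrow> y \<in> K \<Longrightarrow> x + y \<in> K"
    "\<And>x y. x \<in> K \<Longrightarrow> y \<in> K \<Longrightarrow> x * y \<in> K" "\<And>x. x \<in> K \<Longrightarrow> - x \<in> K"
    "\<And>x. x \<in> K \<Longrightarrow> x \<noteq> 0 \<Longrightarrow> inverse x \<in> K"
  shows "is_subfield K"
proof -
  have "0 \<in> K" using assms(1) assms(2)[of 1 "- 1"] assms(4)[of 1] by simp
  moreover have "inverse x \<in> K" if "x \<in> K" for x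
    using assms(5)[of x] that \<open>0 \<in> K\<close> by (cases "x = 0") auto
  ultimately show ?thesis unfolding is_subfield_def by (simp add: assms(1-4))
qed

context
  fixes K :: "complex set"
  assumes K: "is_subfield K"
begin

lemma subfield_0: "0 \<in> K" and subfield_1: "1 \<in> K"
  and subfield_add: "x \<in> K \<Longrightarrow> y \<in> K \<Longrightarrow> x + y \<in> K"
  and subfield_mult: "x \<in> K \<Longrightarrow> y \<in> K \<Longrightarrow> x * y \<in> K"
  and subfield_minus: "x \<in> K \<Longrightarrow> - x \<in> K"
  and subfield_inverse: "x \<in> K \<Longrightarrow> inverse x \<in> K"
  using K unfolding is_subfield_def by simp_all

lemma subfield_diff: "x \<in> K \<Longrightarrow> y \<in> K \<Longrightarrow> x - y \<in> K"
  using subfield_add[of x "- y"] subfield_minus[of y] by simp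

lemma subfield_divide: "x \<in> K \<Longrightarrow> y \<in> K \<Longrightarrow> x / y \<in> K"
  using subfield_mult[of x "inverse y"] subfield_inverse[of y] by (simp add: divide_inverse)

lemma subfield_power: "x \<in> K \<Longrightarrow> x ^ n \<in> K"
  by (induction n) (auto intro: subfield_1 subfield_mult)

lemma subfield_of_nat: "of_nat n \<in> K"
  by (induction n) (auto intro: subfield_0 subfield_1 subfield_add)

lemma subfield_of_int: "of_int n \<in> K"
proof (cases n)
  case (nonneg m) then show ?thesis using subfield_of_nat[of m] by simp
next
  case (neg m) then show ?thesis using subfield_minus[OF subfield_of_nat[of "Suc m"]] by (simp del: of_nat_Suc)
qed

lemma subfield_of_rat: "of_rat r \<in> K"
  by (cases r) (simp add: of_rat_rat subfield_divide subfield_of_int)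

lemma subfield_numeral: "numeral n \<in> K"
  using subfield_of_nat[of "numeral n"] by simp

lemmas subfield_closed = subfield_0 subfield_1 subfield_add subfield_mult subfield_minus
  subfield_inverse subfield_diff subfield_divide subfield_power subfield_of_rat subfield_numeral

end

lemma subfield_gen_field: "is_subfield (gen_field S)"
  by (rule subfieldI)
    (auto simp: gen_field_def intro: subfield_1 subfield_add subfield_mult subfield_minus subfield_inverse)

lemma subset_gen_field: "S \<subseteq> gen_field S"
  by (auto simp: gen_field_def)

lemma gen_field_least: "is_subfield K \<Longrightarrow> S \<subseteq> K \<Longrightarrow> gen_field S \<subseteq> K"
  by (auto simp: gen_field_def)

definition Qomega :: "complex set" where
  "Qomega = {of_rat x + of_rat y * \<omega> | x y. True}"

lemma subfield_Qomega: "is_subfield Qomega"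
proof (rule subfieldI)
  have "1 = of_rat 1 + of_rat 0 * \<omega>" by simp
  then show "1 \<in> Qomega" unfolding Qomega_def by blast
next
  fix s t assume "s \<in> Qomega" "t \<in> Qomega"
  then obtain x y x' y' where st: "s = of_rat x + of_rat y * \<omega>" "t = of_rat x' + of_rat y' * \<omega>"
    unfolding Qomega_def by blast
  have "s + t = of_rat (x + x') + of_rat (y + y') * \<omega>"
    by (simp add: st of_rat_add algebra_simps)
  then show "s + t \<in> Qomega" unfolding Qomega_def by blast
  have "s * t = of_rat (x * x' - y * y') + of_rat (x * y' + y * x' - y * y') * \<omega>"
    by (simp add: st of_rat_add of_rat_diff of_rat_mult expand omega_mult)
  then show "s * t \<in> Qomega" unfolding Qomega_def by blast
next
  fix s assume "s \<in> Qomega"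
  then obtain x y where s: "s = of_rat x + of_rat y * \<omega>" unfolding Qomega_def by blast
  have "- s = of_rat (- x) + of_rat (- y) * \<omega>" by (simp add: s of_rat_minus)
  then show "- s \<in> Qomega" unfolding Qomega_def by blast
  assume s0: "s \<noteq> 0"
  \<comment> \<open>The norm of s; the second factor below is the conjugate
    \<open>x + y * \<omega>^2\<close> rewritten in the basis 1, \<omega>.\<close>
  define n where "n = x\<^sup>2 - x * y + y\<^sup>2"
  have n0: "n \<noteq> 0"
  proof
    assume "n = 0"
    then have "(2 * x - y)\<^sup>2 + 3 * y\<^sup>2 = 0" unfolding n_def by (simp add: expand)
    then have "y = 0" "2 * x - y = 0"
      by (simp_all add: add_nonneg_eq_0_iff)
    then show False using s0 s by simp
  qed
  have "s * (of_rat (x - y) + of_rat (- y) * \<omega>) = of_rat n"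
    unfolding s n_def
    by (simp add: of_rat_diff of_rat_minus of_rat_add of_rat_mult of_rat_power expand omega_mult)
  then have "s * ((of_rat (x - y) + of_rat (- y) * \<omega>) / of_rat n) = 1" using n0 by simp
  then have "inverse s = (of_rat (x - y) + of_rat (- y) * \<omega>) / of_rat n" by (rule inverse_unique)
  also have "\<dots> = of_rat ((x - y) / n) + of_rat (- y / n) * \<omega>"
    by (simp only: of_rat_divide add_divide_distrib times_divide_eq_left)
  finally have "inverse s = of_rat ((x - y) / n) + of_rat (- y / n) * \<omega>" .
  then show "inverse s \<in> Qomega" unfolding Qomega_def by blast
qed

lemma omega_in_Qomega: "\<omega> \<in> Qomega"
proof -
  have "\<omega> = of_rat 0 + of_rat 1 * \<omega>" by simp
  then show ?thesis unfolding Qomega_def by blast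
qed

lemma cnj_Qomega: "u \<in> Qomega \<Longrightarrow> cnj u \<in> Qomega"
proof -
  assume "u \<in> Qomega"
  then obtain x y where "u = of_rat x + of_rat y * \<omega>" unfolding Qomega_def by blast
  then have "cnj u = of_rat (x - y) + of_rat (- y) * \<omega>"
    by (simp add: cnj_omega of_rat_diff of_rat_minus algebra_simps)
  then show ?thesis unfolding Qomega_def by blast
qed

lemma real_Qomega_is_rat:
  assumes "u \<in> Qomega" "cnj u = u"
  obtains r where "u = of_rat r"
proof -
  obtain x y where u: "u = of_rat x + of_rat y * \<omega>" using assms unfolding Qomega_def by blast
  then have "cnj u = of_rat (x - y) + of_rat (- y) * \<omega>"
    by (simp add: cnj_omega of_rat_diff of_rat_minus algebra_simps)
  then have "y = 0" using assms(2) u by (simp add: omega_lin_eq_iff)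
  then show thesis using u that by simp
qed

lemma norm_Qomega_is_rat:
  assumes "u \<in> Qomega"
  obtains r where "u * cnj u = of_rat r"
proof (rule real_Qomega_is_rat)
  show "u * cnj u \<in> Qomega" using assms by (intro subfield_mult[OF subfield_Qomega] cnj_Qomega)
  show "cnj (u * cnj u) = u * cnj u" by simp
qed

lemma Qomega_subset: "is_subfield K \<Longrightarrow> \<omega> \<in> K \<Longrightarrow> Qomega \<subseteq> K"
  by (auto simp: Qomega_def intro!: subfield_add subfield_mult subfield_of_rat)

section \<open>Pure cubic extensions\<close>

text \<open>K(a) for \<open>a^3\<close> in K, given by coordinates so that automorphisms can be
  defined by a formula.\<close>

definition adj :: "complex set \<Rightarrow> complex \<Rightarrow> complex set" where
  "adj K a = {x + y * a + z * a\<^sup>2 | x y z. x \<in> K \<and> y \<in> K \<and> z \<in> K}"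

lemma adjI: "x \<in> K \<Longrightarrow> y \<in> K \<Longrightarrow> z \<in> K \<Longrightarrow> x + y * a + z * a\<^sup>2 \<in> adj K a"
  unfolding adj_def by blast

lemma adjE:
  assumes "t \<in> adj K a"
  obtains x y z where "t = x + y * a + z * a\<^sup>2" "x \<in> K" "y \<in> K" "z \<in> K"
  using assms unfolding adj_def by auto

lemma cubic_mult:
  fixes e c :: "'a::comm_ring_1"
  assumes "e ^ 3 = c"
  shows "(x + y * e + z * e\<^sup>2) * (x' + y' * e + z' * e\<^sup>2) =
    (x * x' + c * (y * z' + z * y')) + (x * y' + y * x' + c * (z * z')) * e
      + (x * z' + y * y' + z * x') * e\<^sup>2"
  unfolding assms[symmetric] by (simp add: expand)

locale pure_cubic =
  fixes K :: "complex set" and a :: complex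
  assumes K: "is_subfield K" and cube_in: "a ^ 3 \<in> K" and not_cube: "\<And>u. u \<in> K \<Longrightarrow> u ^ 3 \<noteq> a ^ 3"
begin

lemmas closed = subfield_closed[OF K]

lemma not_in: "a \<notin> K"
  using not_cube by blast

lemma a_nz: "a \<noteq> 0"
  using not_in closed(1) by blast

text \<open>If z were nonzero, then \<open>a^2 = p * a + q\<close> and hence
  \<open>a^3 = (p^2 + q) * a + p * q\<close> with p and q in K. Either a can be solved for and lies
  in K, or \<open>q = - p^2\<close> and \<open>a^3\<close> is the cube of -p; both are
  excluded.\<close>

lemma independent:
  assumes xyz: "x \<in> K" "y \<in> K" "z \<in> K" and eq: "x + y * a + z * a\<^sup>2 = 0"
  shows "x = 0 \<and> y = 0 \<and> z = 0"
proof (cases "z = 0")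
  case True
  have "y = 0"
  proof (rule ccontr)
    assume "y \<noteq> 0"
    moreover have "a * y = - x" using eq True by (simp add: eq_neg_iff_add_eq_0 algebra_simps)
    ultimately have "a = - x / y" by (metis nonzero_eq_divide_eq)
    then show False using not_in xyz closed(5,8) by metis
  qed
  then show ?thesis using eq True by simp
next
  case False
  define p where "p = - y / z"
  define q where "q = - x / z"
  have pq: "p \<in> K" "q \<in> K" unfolding p_def q_def using xyz by (auto intro!: closed(5,8))
  have "z * p = - y" "z * q = - x" unfolding p_def q_def using False by simp_all
  then have "z * (p * a + q) = - y * a - x" by (simp add: distrib_left flip: mult.assoc)
  moreover have "z * a\<^sup>2 = - (x + y * a)" using eq by (metis add.commute eq_neg_iff_add_eq_0)
  ultimately have "z * a\<^sup>2 = z * (p * a + q)" by simp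
  then have a2: "a\<^sup>2 = p * a + q" using False by simp
  have "a ^ 3 = a\<^sup>2 * a" by (simp add: expand)
  also have "\<dots> = (p * a + q) * a" by (simp only: a2)
  also have "\<dots> = p * a\<^sup>2 + q * a" by (simp add: expand)
  also have "\<dots> = p * (p * a + q) + q * a" by (simp only: a2)
  also have "\<dots> = (p\<^sup>2 + q) * a + p * q" by (simp add: expand)
  finally have a3: "a ^ 3 = (p\<^sup>2 + q) * a + p * q" .
  have False
  proof (cases "p\<^sup>2 + q = 0")
    case True
    then have "q = - p\<^sup>2" by (simp add: eq_neg_iff_add_eq_0 add.commute)
    then have "a ^ 3 = (- p) ^ 3" using a3 by (simp add: expand)
    then show False using not_cube[OF closed(5)[OF pq(1)]] by simp
  next
    case False
    then have "a = (a ^ 3 - p * q) / (p\<^sup>2 + q)" using a3 by simp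
    moreover have "(c - p * q) / (p\<^sup>2 + q) \<in> K" if "c \<in> K" for c using that pq by (intro closed)
    ultimately show False using not_in cube_in by metis
  qed
  then show ?thesis ..
qed

lemma unique:
  assumes xyz: "x \<in> K" "y \<in> K" "z \<in> K" "x' \<in> K" "y' \<in> K" "z' \<in> K"
    and "x + y * a + z * a\<^sup>2 = x' + y' * a + z' * a\<^sup>2"
  shows "x = x' \<and> y = y' \<and> z = z'"
proof -
  have "(x - x') + (y - y') * a + (z - z') * a\<^sup>2 = 0" using assms(7) by (simp add: algebra_simps)
  moreover have "x - x' \<in> K" "y - y' \<in> K" "z - z' \<in> K" using xyz by (auto intro: closed(7))
  ultimately have "x - x' = 0 \<and> y - y' = 0 \<and> z - z' = 0" by (intro independent)
  then show ?thesis by simp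
qed

lemma subset_adj: "K \<subseteq> adj K a"
proof
  fix x assume "x \<in> K"
  then have "x + 0 * a + 0 * a\<^sup>2 \<in> adj K a" by (intro adjI closed)
  then show "x \<in> adj K a" by simp
qed

lemma in_adj: "a \<in> adj K a"
proof -
  have "0 + 1 * a + 0 * a\<^sup>2 \<in> adj K a" by (intro adjI closed)
  then show ?thesis by simp
qed

lemma subfield_adj: "is_subfield (adj K a)"
proof (rule subfieldI)
  show "1 \<in> adj K a" using subset_adj closed by blast
next
  fix s t assume "s \<in> adj K a" "t \<in> adj K a"
  then obtain x y z x' y' z' where st: "s = x + y * a + z * a\<^sup>2" "t = x' + y' * a + z' * a\<^sup>2"
    and K: "x \<in> K" "y \<in> K" "z \<in> K" "x' \<in> K" "y' \<in> K" "z' \<in> K" by (auto elim!: adjE)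
  have "s + t = (x + x') + (y + y') * a + (z + z') * a\<^sup>2" by (simp add: st algebra_simps)
  then show "s + t \<in> adj K a" using K by (auto intro!: adjI closed)
  define c where "c = a ^ 3"
  have c: "c \<in> K" using cube_in c_def by simp
  show "s * t \<in> adj K a" unfolding st cubic_mult[OF c_def[symmetric]] using K c
    by (intro adjI closed)
next
  fix s assume "s \<in> adj K a"
  then obtain x y z where s: "s = x + y * a + z * a\<^sup>2" and K: "x \<in> K" "y \<in> K" "z \<in> K"
    by (auto elim!: adjE)
  have "- s = (- x) + (- y) * a + (- z) * a\<^sup>2" by (simp add: s algebra_simps)
  then show "- s \<in> adj K a" using K adjI closed(5) by metis
  assume s0: "s \<noteq> 0"
  define c where "c = a ^ 3"
  have c: "c \<in> K" using cube_in c_def by simp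
  \<comment> \<open>t is the product of the other two conjugates
    \<open>x + y*\<omega>*a + z*\<omega>^2*a^2\<close> and
    \<open>x + y*\<omega>^2*a + z*\<omega>*a^2\<close> of s, and n is the norm. If t vanished, its
    coordinates would force \<open>x^3 = c * y^3\<close> and make c a cube.\<close>
  define t where "t = (x\<^sup>2 - c * y * z) + (c * z\<^sup>2 - x * y) * a + (y\<^sup>2 - x * z) * a\<^sup>2"
  define n where "n = x ^ 3 + c * y ^ 3 + c\<^sup>2 * z ^ 3 - 3 * c * x * y * z"
  have t: "t \<in> adj K a" unfolding t_def using K c by (intro adjI closed)
  have st: "s * t = n"
    unfolding s t_def cubic_mult[OF c_def[symmetric]] by (simp add: n_def expand)
  have "t \<noteq> 0"
  proof
    assume "t = 0"
    then have "x\<^sup>2 - c * y * z = 0 \<and> c * z\<^sup>2 - x * y = 0 \<and> y\<^sup>2 - x * z = 0"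
      unfolding t_def using K c by (intro independent closed)
    then have e: "x\<^sup>2 = c * y * z" "c * z\<^sup>2 = x * y" "y\<^sup>2 = x * z" by auto
    show False
    proof (cases "y = 0")
      case True
      then have "x = 0" "c * z\<^sup>2 = 0" using e by auto
      then show False using s0 s True a_nz c_def by auto
    next
      case False
      have "x ^ 3 = x\<^sup>2 * x" by (simp add: expand)
      also have "\<dots> = c * y * (x * z)" unfolding e(1) by (simp add: expand)
      also have "\<dots> = c * y ^ 3" unfolding e(3)[symmetric] by (simp add: expand)
      finally have "(x / y) ^ 3 = a ^ 3" using False by (simp add: power_divide c_def)
      then show False using not_cube[OF closed(8)] K by blast
    qed
  qed
  then have n0: "n \<noteq> 0" using st s0 by auto
  have "n \<in> K" unfolding n_def using K c by (intro closed)
  have "inverse s = inverse n * t" using st n0 s0 by (simp add: field_simps)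
  also have "\<dots> = inverse n * (x\<^sup>2 - c * y * z) + inverse n * (c * z\<^sup>2 - x * y) * a + inverse n * (y\<^sup>2 - x * z) * a\<^sup>2"
    unfolding t_def by (simp add: algebra_simps)
  also have "\<dots> \<in> adj K a" using K c \<open>n \<in> K\<close> by (intro adjI closed)
  finally show "inverse s \<in> adj K a" .
qed

lemma adj_subset: "is_subfield F \<Longrightarrow> K \<subseteq> F \<Longrightarrow> a \<in> F \<Longrightarrow> adj K a \<subseteq> F"
proof
  fix t assume F: "is_subfield F" "K \<subseteq> F" "a \<in> F" and "t \<in> adj K a"
  then obtain x y z where "t = x + y * a + z * a\<^sup>2" "x \<in> F" "y \<in> F" "z \<in> F" by (auto elim!: adjE)
  then show "t \<in> F" using F(3) by (simp add: subfield_closed[OF F(1)])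
qed

text \<open>The Kummer statement for one cubic step: the elements of K that become cubes in K(a)
  are, up to cubes of K, only 1, \<open>a^3\<close> and \<open>a^6\<close>. The coefficients of a
  and \<open>a^2\<close> in \<open>u^3\<close> vanish, and eliminating between them leaves
  \<open>z * (c * y^3 - x^3) = 0\<close>, whose second factor vanishes only for x = y = 0 because c
  is not a cube.\<close>

lemma cube_in_base:
  assumes "u \<in> adj K a" "u ^ 3 \<in> K"
  obtains y where "y \<in> K" "u = y \<or> u = y * a \<or> u = y * a\<^sup>2"
proof -
  obtain x y z where u: "u = x + y * a + z * a\<^sup>2" and K: "x \<in> K" "y \<in> K" "z \<in> K"
    using assms(1) by (elim adjE)
  define c where "c = a ^ 3"
  have c: "c \<in> K" using cube_in c_def by simp
  let ?X = "x ^ 3 + c * y ^ 3 + c\<^sup>2 * z ^ 3 + 6 * c * x * y * z"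
  let ?Y = "3 * (x\<^sup>2 * y + c * (x * z\<^sup>2 + y\<^sup>2 * z))"
  let ?Z = "3 * (x\<^sup>2 * z + x * y\<^sup>2 + c * y * z\<^sup>2)"
  have "u ^ 3 = ?X + ?Y * a + ?Z * a\<^sup>2"
    unfolding u c_def by (simp add: expand)
  moreover have "u ^ 3 = u ^ 3 + 0 * a + 0 * a\<^sup>2" by simp
  ultimately have "u ^ 3 + 0 * a + 0 * a\<^sup>2 = ?X + ?Y * a + ?Z * a\<^sup>2" by simp
  moreover have "?X \<in> K" using K c by (intro closed)
  moreover have "?Y \<in> K" using K c by (intro closed)
  moreover have "?Z \<in> K" using K c by (intro closed)
  ultimately have "u ^ 3 = ?X \<and> 0 = ?Y \<and> 0 = ?Z"
    using unique[of "u ^ 3" 0 0 ?X ?Y ?Z] assms(2) closed(1) by blast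
  then have e1: "x\<^sup>2 * y + c * (x * z\<^sup>2 + y\<^sup>2 * z) = 0" and e2: "x\<^sup>2 * z + x * y\<^sup>2 + c * y * z\<^sup>2 = 0"
    by (metis mult_eq_0_iff zero_neq_numeral)+
  have "z * (c * y ^ 3 - x ^ 3) = y * (x\<^sup>2 * y + c * (x * z\<^sup>2 + y\<^sup>2 * z)) - x * (x\<^sup>2 * z + x * y\<^sup>2 + c * y * z\<^sup>2)"
    by (simp add: expand)
  then have "z * (c * y ^ 3 - x ^ 3) = 0" unfolding e1 e2 by simp
  then consider "z = 0" | "c * y ^ 3 = x ^ 3" by auto
  then show thesis
  proof cases
    case 1
    then have "x = 0 \<or> y = 0" using e1 by simp
    then show thesis using 1 u K that by auto
  next
    case 2
    have "y = 0"
    proof (rule ccontr)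
      assume "y \<noteq> 0"
      then have "(x / y) ^ 3 = a ^ 3" using 2 by (simp add: power_divide c_def field_simps)
      then show False using not_cube[OF closed(8)] K by blast
    qed
    then show thesis using 2 u K that by auto
  qed
qed

end

section \<open>Galois groups\<close>

lemma Gal_one: "id \<in> carrier (Gal_group L)"
  by (simp add: Gal_group_def)

lemma Gal_comp: "s \<in> carrier (Gal_group L) \<Longrightarrow> t \<in> carrier (Gal_group L) \<Longrightarrow> s \<circ> t \<in> carrier (Gal_group L)"
  by (auto simp: Gal_group_def intro: bij_betw_trans dest: bij_betwE)

context
  fixes L :: "complex set" and s :: "complex \<Rightarrow> complex"
  assumes L: "is_subfield L" and s: "s \<in> carrier (Gal_group L)"
begin

lemma Gal_inj: "x \<in> L \<Longrightarrow> y \<in> L \<Longrightarrow> s x = s y \<Longrightarrow> x = y"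
  using s by (auto simp: Gal_group_def bij_betw_def inj_on_def)

lemma Gal_add: "x \<in> L \<Longrightarrow> y \<in> L \<Longrightarrow> s (x + y) = s x + s y"
  and Gal_mult: "x \<in> L \<Longrightarrow> y \<in> L \<Longrightarrow> s (x * y) = s x * s y"
  and Gal_of_rat: "s (of_rat r) = of_rat r"
  and Gal_outside: "x \<notin> L \<Longrightarrow> s x = x"
  using s by (auto simp: Gal_group_def)

lemma Gal_0: "s 0 = 0" and Gal_1: "s 1 = 1"
  using Gal_of_rat[of 0] Gal_of_rat[of 1] by simp_all

lemma Gal_minus: "x \<in> L \<Longrightarrow> s (- x) = - s x"
  using Gal_add[of x "- x"] Gal_0 subfield_minus[OF L] by (simp add: eq_neg_iff_add_eq_0 add.commute)

lemma Gal_inverse: "x \<in> L \<Longrightarrow> s (inverse x) = inverse (s x)"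
proof (cases "x = 0")
  case False
  assume "x \<in> L"
  then have "s x * s (inverse x) = 1"
    using False Gal_mult[of x "inverse x"] Gal_1 subfield_inverse[OF L] by simp
  then show ?thesis by (metis inverse_unique)
qed (simp add: Gal_0)

lemma Gal_power: "x \<in> L \<Longrightarrow> s (x ^ n) = s x ^ n"
  by (induction n) (simp_all add: Gal_1 Gal_mult subfield_power[OF L])

end

text \<open>The elements on which s and t agree form a subfield; off the field both are the identity
  by the convention of \<open>Gal_group\<close>.\<close>

lemma Gal_eqI:
  assumes s: "s \<in> carrier (Gal_group (gen_field S))" and t: "t \<in> carrier (Gal_group (gen_field S))"
    and eq: "\<And>x. x \<in> S \<Longrightarrow> s x = t x"
  shows "s = t"
proof
  fix x
  let ?L = "gen_field S"
  note L = subfield_gen_field[of S]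
  have "is_subfield {x \<in> ?L. s x = t x}"
    using Gal_1[OF L s] Gal_1[OF L t] Gal_add[OF L s] Gal_add[OF L t] Gal_mult[OF L s] Gal_mult[OF L t]
      Gal_minus[OF L s] Gal_minus[OF L t] Gal_inverse[OF L s] Gal_inverse[OF L t]
    by (intro subfieldI)
      (auto intro: subfield_1[OF L] subfield_add[OF L] subfield_mult[OF L] subfield_minus[OF L] subfield_inverse[OF L])
  then have "?L \<subseteq> {x \<in> ?L. s x = t x}"
    using eq subset_gen_field by (intro gen_field_least) auto
  then show "s x = t x" using Gal_outside[OF L s] Gal_outside[OF L t] by (cases "x \<in> ?L") auto
qed

text \<open>Substituting \<open>\<omega> * a\<close> for a in the coordinates is well defined by
  \<open>unique\<close>. It is multiplicative because a and \<open>\<omega> * a\<close> have the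
  same cube, so \<open>cubic_mult\<close> applies to both with the same c. The inverse is the square
  of the map.\<close>

lemma (in pure_cubic) rotation:
  assumes w: "\<omega> \<in> K"
  obtains \<rho> where "\<rho> \<in> carrier (Gal_group (adj K a))" "\<rho> a = \<omega> * a" "\<And>x. x \<in> K \<Longrightarrow> \<rho> x = x"
proof -
  define R where "R t r \<longleftrightarrow> (\<exists>x y z. x \<in> K \<and> y \<in> K \<and> z \<in> K \<and> t = x + y * a + z * a\<^sup>2 \<and>
    r = x + y * (\<omega> * a) + z * (\<omega> * a)\<^sup>2)" for t r
  define \<rho> where "\<rho> t = (if t \<in> adj K a then THE r. R t r else t)" for t
  have rho: "\<rho> (x + y * a + z * a\<^sup>2) = x + y * (\<omega> * a) + z * (\<omega> * a)\<^sup>2"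
    if "x \<in> K" "y \<in> K" "z \<in> K" for x y z
  proof -
    have "(THE r. R (x + y * a + z * a\<^sup>2) r) = x + y * (\<omega> * a) + z * (\<omega> * a)\<^sup>2"
    proof (rule the_equality)
      show "R (x + y * a + z * a\<^sup>2) (x + y * (\<omega> * a) + z * (\<omega> * a)\<^sup>2)"
        unfolding R_def using that by blast
      show "r = x + y * (\<omega> * a) + z * (\<omega> * a)\<^sup>2" if "R (x + y * a + z * a\<^sup>2) r" for r
        using that \<open>x \<in> K\<close> \<open>y \<in> K\<close> \<open>z \<in> K\<close> unfolding R_def by (auto dest: unique[rotated 6])
    qed
    then show ?thesis unfolding \<rho>_def using adjI[OF that] by simp
  qed
  have w3: "(\<omega> * a) ^ 3 = a ^ 3" by (simp add: power_mult_distrib omega_cube)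
  have fixK: "\<rho> x = x" if "x \<in> K" for x
    using rho[of x 0 0] that closed by simp
  have rhoa: "\<rho> a = \<omega> * a" using rho[of 0 1 0] closed by simp
  have add: "\<rho> (s + t) = \<rho> s + \<rho> t" and mult: "\<rho> (s * t) = \<rho> s * \<rho> t"
    if mem: "s \<in> adj K a" "t \<in> adj K a" for s t
  proof -
    obtain x y z where s: "s = x + y * a + z * a\<^sup>2" "x \<in> K" "y \<in> K" "z \<in> K"
      using mem(1) by (elim adjE)
    obtain x' y' z' where t: "t = x' + y' * a + z' * a\<^sup>2" "x' \<in> K" "y' \<in> K" "z' \<in> K"
      using mem(2) by (elim adjE)
    note st = s(1) t(1) and K = s(2-4) t(2-4)
    define c where "c = a ^ 3"
    have c: "c \<in> K" using cube_in c_def by simp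
    have "s + t = (x + x') + (y + y') * a + (z + z') * a\<^sup>2" by (simp add: st algebra_simps)
    then have "\<rho> (s + t) = (x + x') + (y + y') * (\<omega> * a) + (z + z') * (\<omega> * a)\<^sup>2"
      using K by (simp add: rho closed)
    also have "\<dots> = \<rho> s + \<rho> t" unfolding st using K by (simp only: rho) (simp add: algebra_simps)
    finally show "\<rho> (s + t) = \<rho> s + \<rho> t" .
    have "\<rho> (s * t) = (x * x' + c * (y * z' + z * y')) + (x * y' + y * x' + c * (z * z')) * (\<omega> * a)
      + (x * z' + y * y' + z * x') * (\<omega> * a)\<^sup>2"
      unfolding st cubic_mult[OF c_def[symmetric]] using K c by (intro rho closed)
    also have "\<dots> = (x + y * (\<omega> * a) + z * (\<omega> * a)\<^sup>2) * (x' + y' * (\<omega> * a) + z' * (\<omega> * a)\<^sup>2)"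
      by (rule cubic_mult[symmetric]) (simp add: w3 c_def)
    also have "\<dots> = \<rho> s * \<rho> t" unfolding st using K by (simp only: rho)
    finally show "\<rho> (s * t) = \<rho> s * \<rho> t" .
  qed
  have "bij_betw \<rho> (adj K a) (adj K a)"
  proof (rule bij_betwI[where g = "\<lambda>t. \<rho> (\<rho> t)"])
    have im: "\<rho> t \<in> adj K a" if "t \<in> adj K a" for t
    proof -
      obtain x y z where "t = x + y * a + z * a\<^sup>2" "x \<in> K" "y \<in> K" "z \<in> K" using \<open>t \<in> _\<close> by (elim adjE)
      then have "\<rho> t = x + (y * \<omega>) * a + (z * \<omega>\<^sup>2) * a\<^sup>2" by (simp add: rho power_mult_distrib)
      moreover have "x + (y * \<omega>) * a + (z * \<omega>\<^sup>2) * a\<^sup>2 \<in> adj K a"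
        using \<open>x \<in> K\<close> \<open>y \<in> K\<close> \<open>z \<in> K\<close> w by (intro adjI closed)
      ultimately show ?thesis by simp
    qed
    then show "\<rho> \<in> adj K a \<rightarrow> adj K a" "(\<lambda>t. \<rho> (\<rho> t)) \<in> adj K a \<rightarrow> adj K a" by auto
    fix t assume t: "t \<in> adj K a"
    then obtain x y z where t: "t = x + y * a + z * a\<^sup>2" "x \<in> K" "y \<in> K" "z \<in> K" by (elim adjE)
    have "\<rho> t = x + (y * \<omega>) * a + (z * \<omega>\<^sup>2) * a\<^sup>2" using t by (simp add: rho power_mult_distrib)
    moreover have "\<rho> (x + (y * \<omega>) * a + (z * \<omega>\<^sup>2) * a\<^sup>2) = x + (y * \<omega>) * (\<omega> * a) + (z * \<omega>\<^sup>2) * (\<omega> * a)\<^sup>2"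
      using t w by (intro rho closed)
    moreover have "\<dots> = x + (y * \<omega>\<^sup>2) * a + (z * \<omega>) * a\<^sup>2" by (simp add: expand omega_mult)
    moreover have "\<rho> (x + (y * \<omega>\<^sup>2) * a + (z * \<omega>) * a\<^sup>2) = x + (y * \<omega>\<^sup>2) * (\<omega> * a) + (z * \<omega>) * (\<omega> * a)\<^sup>2"
      using t w by (intro rho closed)
    moreover have "\<dots> = t" unfolding t(1) by (simp add: expand omega_mult)
    ultimately show "\<rho> (\<rho> (\<rho> t)) = t" "\<rho> (\<rho> (\<rho> t)) = t" by simp_all
  qed
  then have "\<rho> \<in> carrier (Gal_group (adj K a))"
    using add mult fixK[OF closed(10)] unfolding Gal_group_def by (simp add: \<rho>_def)
  then show thesis using that rhoa fixK by blast
qed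

section \<open>Conjugate pairs of pure cubic extensions\<close>

lemma atLeastAtMost_1_6: "i \<in> {1..6} \<longleftrightarrow> i = 1 \<or> i = 2 \<or> i = 3 \<or> i = 4 \<or> i = 5 \<or> i = (6::nat)"
  by auto

text \<open>\<open>cyc6\<close> is the element whose centralizer is the wreath product;
  \<open>rot6\<close> and \<open>swap6\<close> below are the two generators of C. Explicit values
  let permutation identities be checked case by case.\<close>

definition cyc6 :: "nat \<Rightarrow> nat" where
  "cyc6 i = (if i = 1 then 2 else if i = 2 then 3 else if i = 3 then 1
     else if i = 4 then 5 else if i = 5 then 6 else if i = 6 then 4 else i)"

definition rot6 :: "nat \<Rightarrow> nat" where
  "rot6 i = (if i = 1 then 2 else if i = 2 then 3 else if i = 3 then 1
     else if i = 4 then 6 else if i = 6 then 5 else if i = 5 then 4 else i)"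

definition swap6 :: "nat \<Rightarrow> nat" where
  "swap6 i = (if i = 1 then 6 else if i = 6 then 1 else if i = 2 then 4
     else if i = 4 then 2 else if i = 3 then 5 else if i = 5 then 3 else i)"

lemma cycles_eq:
  "cycle_of_list [1, 2, 3] \<circ> cycle_of_list [4, 5, 6] = cyc6"
  "cycle_of_list [1, 2, 3] \<circ> cycle_of_list [4, 6, 5] = rot6"
  "cycle_of_list [1, 6] \<circ> cycle_of_list [2, 4] \<circ> cycle_of_list [3, 5] = swap6"
  by (rule ext, simp add: cyc6_def rot6_def swap6_def transpose_def)+

lemma cyc6_in: "i \<in> {1..6} \<Longrightarrow> cyc6 i \<in> {1..6}"
  unfolding atLeastAtMost_1_6 by (auto simp: cyc6_def)

lemma rot6_rot6_rot6: "rot6 \<circ> rot6 \<circ> rot6 = id"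
  by (rule ext) (simp add: rot6_def)

lemma swap6_swap6: "swap6 \<circ> swap6 = id"
  by (rule ext) (simp add: swap6_def)

lemma rot6_permutes: "rot6 permutes {1..6}"
proof (rule bij_imp_permutes)
  show "bij_betw rot6 {1..6} {1..6}"
    using rot6_rot6_rot6 by (intro bij_betwI[where g = "rot6 \<circ> rot6"]) (auto simp: rot6_def fun_eq_iff)
qed (auto simp: rot6_def)

lemma swap6_permutes: "swap6 permutes {1..6}"
proof (rule bij_imp_permutes)
  show "bij_betw swap6 {1..6} {1..6}"
    using swap6_swap6 by (intro bij_betwI[where g = swap6]) (auto simp: swap6_def fun_eq_iff)
qed (auto simp: swap6_def)

lemma omega_power_mult:
  "\<omega>\<^sup>2 * \<omega> = 1" "\<omega> * \<omega>\<^sup>2 = 1" "\<omega>\<^sup>2 * (\<omega> * x) = x" "\<omega> * (\<omega>\<^sup>2 * x) = x"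
  "\<omega> * (\<omega> * x) = \<omega>\<^sup>2 * x" "\<omega>\<^sup>2 * (\<omega>\<^sup>2 * x) = \<omega> * x" "\<omega> * \<omega> = \<omega>\<^sup>2"
  by (simp_all add: power2_eq_square omega_mult algebra_simps)

lemma omega_powers: "\<omega> ^ 4 = \<omega>" "\<omega> ^ 6 = 1" "(\<omega>\<^sup>2)\<^sup>2 = \<omega>"
proof -
  have "\<omega> ^ 4 = \<omega> ^ 3 * \<omega>" "\<omega> ^ 6 = \<omega> ^ 3 * \<omega> ^ 3" by (simp_all flip: power_add power_Suc2)
  then show "\<omega> ^ 4 = \<omega>" "\<omega> ^ 6 = 1" "(\<omega>\<^sup>2)\<^sup>2 = \<omega>" by (simp_all add: omega_cube)
qed

text \<open>\<open>norm_not_cube\<close> excludes one of the two possible Kummer relations and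
  leaves the other open; \<open>not_real\<close> keeps the cube roots of \<open>a^3\<close> disjoint
  from those of its conjugate.\<close>

locale conj_cubic =
  fixes a :: complex
  assumes cube_in: "a ^ 3 \<in> Qomega"
    and norm_not_cube: "\<And>r. a ^ 3 * cnj a ^ 3 \<noteq> of_rat r ^ 3"
    and not_real: "cnj a ^ 3 \<noteq> a ^ 3"
begin

abbreviation b :: complex where "b \<equiv> cnj a"

lemma b_cube_in: "b ^ 3 \<in> Qomega"
  using cnj_Qomega[OF cube_in] by simp

text \<open>A cube root u of \<open>a^3\<close> in \<rat>(\<omega>) would make the rational number
  \<open>u * cnj u\<close> a cube root of the norm of \<open>a^3\<close>.\<close>

lemma pure_cubic_a: "pure_cubic Qomega a"
proof
  fix u assume u: "u \<in> Qomega"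
  obtain r where r: "u * cnj u = of_rat r" using u by (rule norm_Qomega_is_rat)
  show "u ^ 3 \<noteq> a ^ 3"
  proof
    assume e: "u ^ 3 = a ^ 3"
    then have "cnj u ^ 3 = b ^ 3" by (metis complex_cnj_power)
    then have "a ^ 3 * b ^ 3 = of_rat r ^ 3" using e r by (metis power_mult_distrib)
    then show False using norm_not_cube by blast
  qed
qed (rule subfield_Qomega cube_in)+

lemma conj_cubic_cnj: "conj_cubic b"
  by unfold_locales (use b_cube_in norm_not_cube not_real in \<open>auto simp: mult.commute\<close>)

lemma a_nz: "a \<noteq> 0"
  by (rule pure_cubic.a_nz[OF pure_cubic_a])

text \<open>By \<open>cube_in_base\<close>, a cube root of \<open>b^3\<close> in \<rat>(\<omega>, a)
  is y, \<open>y * a\<close> or \<open>y * a^2\<close> with y in \<rat>(\<omega>). The first makes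
  \<open>b^3\<close> a cube, the second is excluded by assumption, and the third makes the norm
  \<open>a^3 * b^3\<close> a cube in \<rat>(\<omega>).\<close>

lemma pure_cubic_b_over_a:
  assumes "\<And>u. u \<in> Qomega \<Longrightarrow> u ^ 3 \<noteq> b ^ 3 / a ^ 3"
  shows "pure_cubic (adj Qomega a) b"
proof
  interpret A: pure_cubic Qomega a by (rule pure_cubic_a)
  show "is_subfield (adj Qomega a)" by (rule A.subfield_adj)
  show "b ^ 3 \<in> adj Qomega a" using b_cube_in A.subset_adj by blast
  fix u assume u: "u \<in> adj Qomega a"
  show "u ^ 3 \<noteq> b ^ 3"
  proof
    assume e: "u ^ 3 = b ^ 3"
    then have "u ^ 3 \<in> Qomega" using b_cube_in by simp
    then obtain y where y: "y \<in> Qomega" "u = y \<or> u = y * a \<or> u = y * a\<^sup>2"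
      using A.cube_in_base[OF u] by blast
    from y(2) consider "u = y" | "u = y * a" | "u = y * a\<^sup>2" by blast
    then show False
    proof cases
      case 1
      then show False using e y(1) pure_cubic.not_cube[OF conj_cubic.pure_cubic_a[OF conj_cubic_cnj]] by blast
    next
      case 2
      then have "y ^ 3 = b ^ 3 / a ^ 3" using e a_nz by (simp add: power_mult_distrib field_simps)
      then show False using assms y(1) by blast
    next
      case 3
      \<comment> \<open>\<open>t^3\<close> is the rational norm m. Taking norms once more gives
        \<open>n^3 = m^2\<close>, so m is the cube of the rational \<open>m / n\<close>.\<close>
      define t where "t = y * a ^ 3"
      have t: "t \<in> Qomega" unfolding t_def using y(1) cube_in by (rule subfield_mult[OF subfield_Qomega])
      obtain n where n: "t * cnj t = of_rat n" using t by (rule norm_Qomega_is_rat)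
      obtain m where m: "a ^ 3 * cnj (a ^ 3) = of_rat m" using cube_in by (rule norm_Qomega_is_rat)
      have m0: "m \<noteq> 0" using m a_nz by auto
      have tm: "t ^ 3 = of_rat m"
      proof -
        have "t ^ 3 = a ^ 3 * u ^ 3"
          unfolding t_def 3 by (simp add: power_mult_distrib flip: power_mult power_add)
        then show ?thesis using e m by simp
      qed
      have "(of_rat n :: complex) ^ 3 = t ^ 3 * cnj (t ^ 3)" unfolding n[symmetric] by (simp add: power_mult_distrib)
      also have "\<dots> = of_rat m * of_rat m" unfolding tm by simp
      finally have "(of_rat (n ^ 3) :: complex) = of_rat (m * m)" by (simp add: of_rat_power of_rat_mult)
      then have nm: "n ^ 3 = m * m" by (simp only: of_rat_eq_iff)
      then have "(m / n) ^ 3 = m" using m0 by (simp add: power_divide nm) (simp add: power3_eq_cube)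
      then have "a ^ 3 * b ^ 3 = of_rat (m / n) ^ 3" using m by (simp flip: of_rat_power)
      then show False using norm_not_cube by blast
    qed
  qed
qed

section \<open>The compositum of the two conjugate cubic extensions\<close>

definition L :: "complex set" where "L = gen_field {\<omega>, a, b}"

lemma subfield_L: "is_subfield L"
  unfolding L_def by (rule subfield_gen_field)

lemma in_L: "\<omega> \<in> L" "a \<in> L" "b \<in> L"
  using subset_gen_field[of "{\<omega>, a, b}"] unfolding L_def by auto

lemma L_cnj: "conj_cubic.L b = L"
  unfolding L_def conj_cubic.L_def[OF conj_cubic_cnj] by (simp add: insert_commute)

lemma Qomega_subset_L: "Qomega \<subseteq> L"
  by (rule Qomega_subset[OF subfield_L in_L(1)])

lemma L_eq_adj_adj:
  assumes "\<And>u. u \<in> Qomega \<Longrightarrow> u ^ 3 \<noteq> b ^ 3 / a ^ 3"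
  shows "L = adj (adj Qomega a) b"
proof
  interpret A: pure_cubic Qomega a by (rule pure_cubic_a)
  interpret B: pure_cubic "adj Qomega a" b by (rule pure_cubic_b_over_a[OF assms])
  show "L \<subseteq> adj (adj Qomega a) b" unfolding L_def
  proof (rule gen_field_least[OF B.subfield_adj])
    show "{\<omega>, a, b} \<subseteq> adj (adj Qomega a) b"
      using omega_in_Qomega A.subset_adj A.in_adj B.subset_adj B.in_adj by auto
  qed
  show "adj (adj Qomega a) b \<subseteq> L"
    by (intro B.adj_subset A.adj_subset subfield_L Qomega_subset_L in_L)
qed

lemma L_eq_adj:
  assumes u: "u \<in> Qomega" "u ^ 3 = b ^ 3 / a ^ 3"
  shows "L = adj Qomega a" "b / a \<in> Qomega"
proof -
  interpret A: pure_cubic Qomega a by (rule pure_cubic_a)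
  have "(b / a) ^ 3 = u ^ 3" using u by (simp add: power_divide)
  then have "b / a = u \<or> b / a = \<omega> * u \<or> b / a = \<omega>\<^sup>2 * u" by (simp only: complex_cube_eq_iff)
  then show *: "b / a \<in> Qomega"
    using u(1) omega_in_Qomega A.closed(4) subfield_power[OF subfield_Qomega omega_in_Qomega, of 2] by metis
  have "b = (b / a) * a" using a_nz by simp
  then have "b \<in> adj Qomega a"
    using * A.subset_adj A.in_adj subfield_mult[OF A.subfield_adj] by (metis subsetD)
  then have "L \<subseteq> adj Qomega a" unfolding L_def
    using omega_in_Qomega A.subset_adj A.in_adj by (intro gen_field_least[OF A.subfield_adj]) auto
  moreover have "adj Qomega a \<subseteq> L" by (intro A.adj_subset subfield_L Qomega_subset_L in_L)
  ultimately show "L = adj Qomega a" by simp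
qed

text \<open>The numbering of the six cube roots of \<open>a\<^sup>3\<close> and \<open>b\<^sup>3\<close> is chosen so that complex conjugation
  acts as \<open>(1,6)(2,4)(3,5)\<close>.\<close>
definition Y :: "nat \<Rightarrow> complex" where
  "Y i = (if i = 1 then a else if i = 2 then \<omega> * a else if i = 3 then \<omega>\<^sup>2 * a
     else if i = 4 then \<omega>\<^sup>2 * b else if i = 5 then \<omega> * b else b)"

lemma Y_cube: "Y i ^ 3 = (if i \<in> {1, 2, 3} then a ^ 3 else b ^ 3)"
  by (auto simp: Y_def power_mult_distrib omega_cube omega_cube[unfolded power3_eq_cube] power2_eq_square mult.assoc)

lemma Y_in_L: "Y i \<in> L"
  unfolding Y_def using in_L by (auto intro: subfield_mult[OF subfield_L] subfield_power[OF subfield_L])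

lemma inj_on_Y: "inj_on Y {1..6}"
proof (rule inj_onI)
  fix i j :: nat assume ij: "i \<in> {1..6}" "j \<in> {1..6}" "Y i = Y j"
  then have "Y i ^ 3 = Y j ^ 3" by simp
  then have "i \<in> {1, 2, 3} \<longleftrightarrow> j \<in> {1, 2, 3}" using not_real by (auto simp: Y_cube split: if_splits)
  moreover have "\<omega> \<noteq> \<omega>\<^sup>2" "1 \<noteq> \<omega>\<^sup>2" "1 \<noteq> \<omega>" by (metis omega_neq)+
  ultimately show "i = j" using ij a_nz unfolding atLeastAtMost_1_6 by (auto simp: Y_def)
qed

lemma cube_root_a: "z ^ 3 = a ^ 3 \<Longrightarrow> \<exists>j\<in>{1, 2, 3}. z = Y j"
  unfolding complex_cube_eq_iff by (auto simp: Y_def)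

lemma cube_root_b: "z ^ 3 = b ^ 3 \<Longrightarrow> \<exists>j\<in>{4, 5, 6}. z = Y j"
  unfolding complex_cube_eq_iff by (auto simp: Y_def)

section \<open>The Galois action on the six cube roots\<close>

abbreviation G where "G \<equiv> carrier (Gal_group L)"

lemma Gal_omega: "s \<in> G \<Longrightarrow> s \<omega> = \<omega> \<or> s \<omega> = \<omega>\<^sup>2"
proof -
  assume s: "s \<in> G"
  note [simp] = Gal_1[OF subfield_L s]
  have "s \<omega> ^ 3 = s (\<omega> ^ 3)" using Gal_power[OF subfield_L s in_L(1)] by simp
  then have "s \<omega> ^ 3 = 1 ^ 3" by (simp add: omega_cube)
  moreover have "s \<omega> \<noteq> 1" using Gal_inj[OF subfield_L s in_L(1) subfield_1[OF subfield_L]] by auto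
  ultimately show ?thesis unfolding complex_cube_eq_iff by simp
qed

lemma Gal_Qomega:
  assumes s: "s \<in> G" and u: "u \<in> Qomega"
  shows "s \<omega> = \<omega> \<Longrightarrow> s u = u" "s \<omega> = \<omega>\<^sup>2 \<Longrightarrow> s u = cnj u"
proof -
  obtain x y where u: "u = of_rat x + of_rat y * \<omega>" using u unfolding Qomega_def by blast
  have "s u = of_rat x + of_rat y * s \<omega>" unfolding u
    using in_L(1) by (simp add: Gal_add[OF subfield_L s] Gal_mult[OF subfield_L s] Gal_of_rat[OF subfield_L s]
        subfield_of_rat[OF subfield_L] subfield_mult[OF subfield_L])
  then show "s \<omega> = \<omega> \<Longrightarrow> s u = u" "s \<omega> = \<omega>\<^sup>2 \<Longrightarrow> s u = cnj u"
    unfolding u by (simp_all add: cnj_omega omega_square)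
qed

text \<open>Extended by the identity outside the six indices, as \<open>permutes\<close>
  requires.\<close>

definition act :: "(complex \<Rightarrow> complex) \<Rightarrow> nat \<Rightarrow> nat" where
  "act s i = (if i \<in> {1..6} then inv_into {1..6} Y (s (Y i)) else i)"

text \<open>On \<rat>(\<omega>) an automorphism is the identity or conjugation, so it fixes or swaps
  \<open>a^3\<close> and \<open>b^3\<close>. The last clause records that the two triples of roots
  are swapped exactly when \<omega> is moved.\<close>

lemma Gal_Y:
  assumes s: "s \<in> G" and i: "i \<in> {1..6}"
  shows "\<exists>j\<in>{1..6}. s (Y i) = Y j \<and> (j \<in> {1,2,3} \<longleftrightarrow> (i \<in> {1,2,3} \<longleftrightarrow> s \<omega> = \<omega>))"
proof -
  have c: "s (Y i) ^ 3 = s (Y i ^ 3)" using Gal_power[OF subfield_L s Y_in_L] by simp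
  have "s (Y i) ^ 3 = (if i \<in> {1,2,3} \<longleftrightarrow> s \<omega> = \<omega> then a ^ 3 else b ^ 3)"
  proof (cases "s \<omega> = \<omega>")
    case True
    then show ?thesis
      unfolding c Y_cube using Gal_Qomega(1)[OF s cube_in] Gal_Qomega(1)[OF s b_cube_in] by simp
  next
    case False
    then have "s \<omega> = \<omega>\<^sup>2" using Gal_omega[OF s] by blast
    then have "s (a ^ 3) = b ^ 3" "s (b ^ 3) = a ^ 3"
      using Gal_Qomega(2)[OF s cube_in] Gal_Qomega(2)[OF s b_cube_in] by simp_all
    then show ?thesis unfolding c Y_cube using False by simp
  qed
  then consider "i \<in> {1,2,3} \<longleftrightarrow> s \<omega> = \<omega>" "s (Y i) ^ 3 = a ^ 3"
    | "\<not> (i \<in> {1,2,3} \<longleftrightarrow> s \<omega> = \<omega>)" "s (Y i) ^ 3 = b ^ 3" by presburger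
  then show ?thesis
  proof cases
    case 1
    from cube_root_a[OF 1(2)] obtain j where "j \<in> {1,2,3}" "s (Y i) = Y j" by blast
    then show ?thesis using 1(1) by (intro bexI[of _ j]) auto
  next
    case 2
    from cube_root_b[OF 2(2)] obtain j where "j \<in> {4,5,6}" "s (Y i) = Y j" by blast
    then show ?thesis using 2(1) by (intro bexI[of _ j]) auto
  qed
qed

lemma act_Y:
  assumes s: "s \<in> G" and i: "i \<in> {1..6}"
  shows "act s i \<in> {1..6}" "Y (act s i) = s (Y i)" "act s i \<in> {1,2,3} \<longleftrightarrow> (i \<in> {1,2,3} \<longleftrightarrow> s \<omega> = \<omega>)"
proof -
  obtain j where j: "j \<in> {1..6}" "s (Y i) = Y j" "j \<in> {1,2,3} \<longleftrightarrow> (i \<in> {1,2,3} \<longleftrightarrow> s \<omega> = \<omega>)"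
    using Gal_Y[OF s i] by blast
  have "act s i = j" using i j inj_on_Y by (simp add: act_def inv_into_f_f)
  then show "act s i \<in> {1..6}" "Y (act s i) = s (Y i)" "act s i \<in> {1,2,3} \<longleftrightarrow> (i \<in> {1,2,3} \<longleftrightarrow> s \<omega> = \<omega>)"
    using j by simp_all
qed

lemma act_outside: "i \<notin> {1..6} \<Longrightarrow> act s i = i"
  unfolding act_def by (rule if_not_P)

lemma act_eqI:
  assumes s: "s \<in> G" and g: "g permutes {1..6}" and eq: "\<And>i. i \<in> {1..6} \<Longrightarrow> s (Y i) = Y (g i)"
  shows "act s = g"
proof
  fix i show "act s i = g i"
  proof (cases "i \<in> {1..6}")
    case True
    then have "Y (act s i) = Y (g i)" using eq act_Y[OF s] by simp
    then show ?thesis using inj_on_Y act_Y(1)[OF s True] permutes_in_image[OF g] True by (metis inj_onD)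
  next
    case False
    then show ?thesis using g by (metis act_outside permutes_not_in)
  qed
qed

lemma act_permutes:
  assumes s: "s \<in> G" shows "act s permutes {1..6}"
proof (rule bij_imp_permutes)
  have inj: "inj_on (act s) {1..6}"
  proof (rule inj_onI)
    fix i j assume ij: "i \<in> {1..6}" "j \<in> {1..6}" "act s i = act s j"
    then have "s (Y i) = s (Y j)" by (metis act_Y(2)[OF s])
    then have "Y i = Y j" using Gal_inj[OF subfield_L s Y_in_L Y_in_L] by blast
    then show "i = j" using inj_on_Y ij by (meson inj_onD)
  qed
  have "act s ` {1..6} \<subseteq> {1..6}" using act_Y(1)[OF s] by blast
  then show "bij_betw (act s) {1..6} {1..6}"
    using inj by (simp add: bij_betw_def endo_inj_surj)
qed (rule act_outside)

lemma act_comp: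
  assumes s: "s \<in> G" and t: "t \<in> G"
  shows "act (s \<circ> t) = act s \<circ> act t"
proof (rule act_eqI[OF Gal_comp[OF s t]])
  show "act s \<circ> act t permutes {1..6}" by (intro permutes_compose act_permutes s t)
  show "(s \<circ> t) (Y i) = Y ((act s \<circ> act t) i)" if "i \<in> {1..6}" for i
    using act_Y[OF s] act_Y[OF t] that by simp
qed

text \<open>The permutation fixes the images of a and b, and also that of \<omega>, which is the
  quotient of the images of \<open>Y 2\<close> and \<open>Y 1\<close>.\<close>

lemma inj_on_act: "inj_on act G"
proof (rule inj_onI)
  fix s t assume s: "s \<in> G" and t: "t \<in> G" and eq: "act s = act t"
  have Y: "s (Y i) = t (Y i)" if "i \<in> {1..6}" for i
    using act_Y(2)[OF s that] act_Y(2)[OF t that] eq by simp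
  have a: "s a = t a" using Y[of 1] by (simp add: Y_def)
  have b: "s b = t b" using Y[of 6] by (simp add: Y_def)
  have "s \<omega> * s a = t \<omega> * t a"
    using Y[of 2] in_L by (simp add: Y_def Gal_mult[OF subfield_L s] Gal_mult[OF subfield_L t])
  moreover have "s a \<noteq> 0" using Gal_inj[OF subfield_L s in_L(2) subfield_0[OF subfield_L]] a_nz
    by (auto simp: Gal_0[OF subfield_L s])
  ultimately have "s \<omega> = t \<omega>" using a by simp
  then show "s = t" using Gal_eqI s t a b unfolding L_def by blast
qed

definition \<kappa> :: "complex \<Rightarrow> complex" where "\<kappa> x = (if x \<in> L then cnj x else x)"

lemma cnj_L: "x \<in> L \<Longrightarrow> cnj x \<in> L"
proof -
  have "is_subfield {x. cnj x \<in> L}"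
    by (rule subfieldI)
      (auto intro: subfield_1[OF subfield_L] subfield_add[OF subfield_L] subfield_mult[OF subfield_L]
        subfield_minus[OF subfield_L] subfield_inverse[OF subfield_L])
  moreover have "{\<omega>, a, b} \<subseteq> {x. cnj x \<in> L}"
    using in_L by (auto simp: cnj_omega intro!: subfield_diff[OF subfield_L] subfield_minus[OF subfield_L] subfield_1[OF subfield_L])
  ultimately have "L \<subseteq> {x. cnj x \<in> L}" unfolding L_def by (rule gen_field_least)
  then show "x \<in> L \<Longrightarrow> cnj x \<in> L" by blast
qed

lemma conj_in_G: "\<kappa> \<in> G"
proof -
  have "bij_betw \<kappa> L L" by (rule bij_betwI[where g = \<kappa>]) (auto simp: \<kappa>_def cnj_L)
  then show ?thesis
    by (simp add: Gal_group_def \<kappa>_def subfield_add[OF subfield_L] subfield_mult[OF subfield_L])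
qed

lemma conj_values: "\<kappa> \<omega> = \<omega>\<^sup>2" "\<kappa> a = b" "\<kappa> b = a"
  using in_L by (simp_all add: \<kappa>_def cnj_omega omega_square)

lemma Y_cyc: "i \<in> {1..6} \<Longrightarrow> Y (cyc6 i) = (if i \<in> {1,2,3} then \<omega> else \<omega>\<^sup>2) * Y i"
  unfolding cyc6_def atLeastAtMost_1_6
  by (auto simp: Y_def omega_power_mult omega_powers)

text \<open>\<open>cyc6\<close> multiplies by \<omega> on the first triple and by
  \<open>\<omega>^2\<close> on the second, and an automorphism swaps the triples exactly when it
  swaps these two multipliers. For the periodic points, \<open>cyc6\<close> is the inverse of the
  dynamical map, which is defined over \<rat>.\<close>

lemma act_commutes_cyc:
  assumes s: "s \<in> G" shows "act s \<circ> cyc6 = cyc6 \<circ> act s"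
proof
  fix i show "(act s \<circ> cyc6) i = (cyc6 \<circ> act s) i"
  proof (cases "i \<in> {1..6}")
    case True
    have "s (Y (cyc6 i)) = (if i \<in> {1,2,3} then s \<omega> else s \<omega> ^ 2) * s (Y i)"
      unfolding Y_cyc[OF True] using in_L(1) Y_in_L
      by (simp add: Gal_mult[OF subfield_L s] Gal_power[OF subfield_L s] subfield_power[OF subfield_L])
    also have "\<dots> = (if act s i \<in> {1,2,3} then \<omega> else \<omega>\<^sup>2) * s (Y i)"
      using Gal_omega[OF s] act_Y(3)[OF s True] by (auto simp: omega_powers)
    also have "\<dots> = Y (cyc6 (act s i))"
      using Y_cyc[OF act_Y(1)[OF s True]] act_Y(2)[OF s True] by simp
    finally have "Y (act s (cyc6 i)) = Y (cyc6 (act s i))" using act_Y(2)[OF s cyc6_in[OF True]] by simp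
    then have "act s (cyc6 i) = cyc6 (act s i)"
      using inj_on_Y act_Y(1)[OF s cyc6_in[OF True]] cyc6_in[OF act_Y(1)[OF s True]] by (meson inj_onD)
    then show ?thesis by simp
  next
    case False
    then have "cyc6 i = i" by (auto simp: cyc6_def)
    then show ?thesis by (simp only: act_outside[OF False] o_apply)
  qed
qed

text \<open>A permutation commuting with \<open>cyc6\<close> is determined by its values at 1 and 4,
  so it suffices to prescribe the images of a and b. Adjoining a and b in either order gives a
  rotation of one that fixes the other; these two and complex conjugation realize every admissible
  choice.\<close>

lemma wreath_in_act:
  assumes ncube: "\<And>u. u \<in> Qomega \<Longrightarrow> u ^ 3 \<noteq> b ^ 3 / a ^ 3"
    and g: "g permutes {1..6}" "g \<circ> cyc6 = cyc6 \<circ> g"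
  shows "g \<in> act ` G"
proof -
  have ncube': "u ^ 3 \<noteq> cnj b ^ 3 / b ^ 3" if "u \<in> Qomega" for u
  proof
    assume "u ^ 3 = cnj b ^ 3 / b ^ 3"
    then have "inverse u ^ 3 = b ^ 3 / a ^ 3" by (simp add: power_inverse)
    then show False using ncube subfield_inverse[OF subfield_Qomega that] by blast
  qed
  interpret A: pure_cubic Qomega a by (rule pure_cubic_a)
  interpret B: pure_cubic Qomega b by (rule conj_cubic.pure_cubic_a[OF conj_cubic_cnj])
  interpret BA: pure_cubic "adj Qomega a" b by (rule pure_cubic_b_over_a[OF ncube])
  interpret AB: pure_cubic "adj Qomega b" a
    using conj_cubic.pure_cubic_b_over_a[OF conj_cubic_cnj ncube'] by simp
  have L1: "adj (adj Qomega a) b = L" using L_eq_adj_adj[OF ncube] by simp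
  have L2: "adj (adj Qomega b) a = L"
    using conj_cubic.L_eq_adj_adj[OF conj_cubic_cnj ncube'] L_cnj by simp
  obtain \<rho>\<^sub>b where rb: "\<rho>\<^sub>b \<in> G" "\<rho>\<^sub>b b = \<omega> * b" "\<rho>\<^sub>b \<omega> = \<omega>" "\<rho>\<^sub>b a = a"
    using BA.rotation A.subset_adj omega_in_Qomega A.in_adj unfolding L1 by (metis subsetD)
  obtain \<rho>\<^sub>a where ra: "\<rho>\<^sub>a \<in> G" "\<rho>\<^sub>a a = \<omega> * a" "\<rho>\<^sub>a \<omega> = \<omega>" "\<rho>\<^sub>a b = b"
    using AB.rotation B.subset_adj omega_in_Qomega B.in_adj unfolding L2 by (metis subsetD)
  have mult: "\<rho> (x * y) = \<rho> x * \<rho> y" if "\<rho> \<in> G" "x \<in> L" "y \<in> L" for \<rho> x y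
    using Gal_mult[OF subfield_L] that by blast
  have ex: "\<exists>s\<in>G. s \<omega> = \<omega> \<and> s a = \<epsilon> \<and> s b = \<delta>"
    if "\<epsilon> ^ 3 = a ^ 3" "\<delta> ^ 3 = b ^ 3" for \<epsilon> \<delta>
  proof -
    have "\<exists>s\<in>G. s \<omega> = \<omega> \<and> s a = \<epsilon> \<and> s b = b"
    proof -
      have "\<rho>\<^sub>a \<circ> \<rho>\<^sub>a \<in> G" "(\<rho>\<^sub>a \<circ> \<rho>\<^sub>a) \<omega> = \<omega>" "(\<rho>\<^sub>a \<circ> \<rho>\<^sub>a) a = \<omega>\<^sup>2 * a" "(\<rho>\<^sub>a \<circ> \<rho>\<^sub>a) b = b"
        using ra mult[OF ra(1) in_L(1,2)] by (auto simp: Gal_comp power2_eq_square)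
      moreover have "id \<in> G" by (rule Gal_one)
      ultimately show ?thesis using ra that(1) unfolding complex_cube_eq_iff by (metis id_apply)
    qed
    then obtain s where s: "s \<in> G" "s \<omega> = \<omega>" "s a = \<epsilon>" "s b = b" by blast
    have "\<exists>t\<in>G. t \<omega> = \<omega> \<and> t a = a \<and> t b = \<delta>"
    proof -
      have "\<rho>\<^sub>b \<circ> \<rho>\<^sub>b \<in> G" "(\<rho>\<^sub>b \<circ> \<rho>\<^sub>b) \<omega> = \<omega>" "(\<rho>\<^sub>b \<circ> \<rho>\<^sub>b) b = \<omega>\<^sup>2 * b" "(\<rho>\<^sub>b \<circ> \<rho>\<^sub>b) a = a"
        using rb mult[OF rb(1) in_L(1,3)] by (auto simp: Gal_comp power2_eq_square)
      moreover have "id \<in> G" by (rule Gal_one)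
      ultimately show ?thesis using rb that(2) unfolding complex_cube_eq_iff by (metis id_apply)
    qed
    then obtain t where t: "t \<in> G" "t \<omega> = \<omega>" "t a = a" "t b = \<delta>" by blast
    have "s \<delta> = \<delta>"
    proof -
      have "\<delta> = b \<or> \<delta> = \<omega> * b \<or> \<delta> = \<omega>\<^sup>2 * b" using that(2) by (simp only: complex_cube_eq_iff)
      moreover have "s (\<omega> * b) = \<omega> * b" using s mult[OF s(1) in_L(1,3)] by simp
      moreover have "s (\<omega>\<^sup>2 * b) = \<omega>\<^sup>2 * b"
        using s mult[OF s(1) subfield_power[OF subfield_L in_L(1)] in_L(3)]
          Gal_power[OF subfield_L s(1) in_L(1)] by simp
      ultimately show ?thesis using s(4) by metis
    qed
    then have "(s \<circ> t) \<omega> = \<omega> \<and> (s \<circ> t) a = \<epsilon> \<and> (s \<circ> t) b = \<delta>" using s t by simp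
    then show ?thesis using Gal_comp s(1) t(1) by blast
  qed
  have ex': "\<exists>s\<in>G. s \<omega> = \<omega>\<^sup>2 \<and> s a = \<delta> \<and> s b = \<epsilon>"
    if \<epsilon>\<delta>: "\<epsilon> ^ 3 = a ^ 3" "\<delta> ^ 3 = b ^ 3" for \<epsilon> \<delta>
  proof -
    obtain s where s: "s \<in> G" "s \<omega> = \<omega>" "s a = \<epsilon>" "s b = \<delta>" using ex[OF \<epsilon>\<delta>] by blast
    then have "(s \<circ> \<kappa>) \<omega> = \<omega>\<^sup>2" "(s \<circ> \<kappa>) a = \<delta>" "(s \<circ> \<kappa>) b = \<epsilon>"
      using Gal_power[OF subfield_L s(1) in_L(1)] by (simp_all add: conj_values)
    then show ?thesis using Gal_comp[OF s(1) conj_in_G] by blast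
  qed
  have g2: "g 2 = cyc6 (g 1)" using fun_cong[OF g(2), of 1] by (simp add: cyc6_def)
  have g3: "g 3 = cyc6 (g 2)" using fun_cong[OF g(2), of 2] by (simp add: cyc6_def)
  have g5: "g 5 = cyc6 (g 4)" using fun_cong[OF g(2), of 4] by (simp add: cyc6_def)
  have g6: "g 6 = cyc6 (g 5)" using fun_cong[OF g(2), of 5] by (simp add: cyc6_def)
  have gin: "g i \<in> {1..6}" if "i \<in> {1..6}" for i using permutes_in_image[OF g(1)] that by blast
  note g14 = gin[of 1] gin[of 4]
  have ne: "g 1 \<noteq> g 4" "g 2 \<noteq> g 4" "g 3 \<noteq> g 4"
    using permutes_inj[OF g(1)] by (auto simp: inj_eq)
  \<comment> \<open>Otherwise \<open>g 4\<close> would lie in the \<open>cyc6\<close>-orbit of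
    \<open>g 1\<close>, which is already filled by \<open>g 1\<close>, \<open>g 2\<close> and
    \<open>g 3\<close>.\<close>
  have sep: "g 1 \<in> {1,2,3} \<longleftrightarrow> g 4 \<notin> {1,2,3}"
    using ne g14 unfolding g3 g2 cyc6_def atLeastAtMost_1_6 by auto
  \<comment> \<open>Since \<open>Y 4 = \<omega>^2 * b\<close>, one has
    \<open>b = \<omega> * Y 4\<close>, so the image of b must be
    \<open>s \<omega> * Y (g 4)\<close>.\<close>
  obtain s where s: "s \<in> G" "s a = Y (g 1)" "s b = \<omega> * Y (g 4) \<and> s \<omega> = \<omega> \<or> s b = \<omega>\<^sup>2 * Y (g 4) \<and> s \<omega> = \<omega>\<^sup>2"
    "g 1 \<in> {1,2,3} \<longleftrightarrow> s \<omega> = \<omega>"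
  proof (cases "g 1 \<in> {1,2,3}")
    case True
    have "Y (g 1) ^ 3 = a ^ 3" using True by (simp only: Y_cube if_True)
    moreover have "(\<omega> * Y (g 4)) ^ 3 = b ^ 3"
      using True sep by (simp add: power_mult_distrib omega_cube Y_cube)
    ultimately obtain s where "s \<in> G" "s \<omega> = \<omega>" "s a = Y (g 1)" "s b = \<omega> * Y (g 4)" using ex by blast
    then show thesis using that True by simp
  next
    case False
    have "Y (g 1) ^ 3 = b ^ 3" using False by (simp only: Y_cube if_False)
    moreover have "(\<omega>\<^sup>2 * Y (g 4)) ^ 3 = a ^ 3"
    proof -
      have "(\<omega>\<^sup>2) ^ 3 = 1" using omega_cube by (metis power_mult mult.commute power_one)
      then show ?thesis using False sep by (simp add: power_mult_distrib Y_cube)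
    qed
    ultimately obtain s where "s \<in> G" "s \<omega> = \<omega>\<^sup>2" "s a = Y (g 1)" "s b = \<omega>\<^sup>2 * Y (g 4)" using ex' by blast
    then show thesis using that False by simp
  qed
  have s1: "s (Y 1) = Y (g 1)" using s by (simp add: Y_def)
  have s4: "s (Y 4) = Y (g 4)"
  proof -
    have "s (Y 4) = (s \<omega>)\<^sup>2 * s b" unfolding Y_def
      using mult[OF s(1) subfield_power[OF subfield_L in_L(1)] in_L(3)] Gal_power[OF subfield_L s(1) in_L(1)] by simp
    then show ?thesis using s(3) by (auto simp: omega_power_mult omega_powers)
  qed
  have step: "s (Y (cyc6 i)) = Y (cyc6 (g i))" if i: "i \<in> {1..6}" "s (Y i) = Y (g i)" "g i \<in> {1,2,3} \<longleftrightarrow> (i \<in> {1,2,3} \<longleftrightarrow> s \<omega> = \<omega>)" for i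
  proof -
    have "s (Y (cyc6 i)) = (if i \<in> {1,2,3} then s \<omega> else s \<omega> ^ 2) * s (Y i)"
      unfolding Y_cyc[OF i(1)] using in_L(1) Y_in_L
      by (simp add: Gal_mult[OF subfield_L s(1)] Gal_power[OF subfield_L s(1)] subfield_power[OF subfield_L])
    also have "\<dots> = (if g i \<in> {1,2,3} then \<omega> else \<omega>\<^sup>2) * Y (g i)"
      using Gal_omega[OF s(1)] i(2,3) by (auto simp: omega_powers)
    also have "\<dots> = Y (cyc6 (g i))" using Y_cyc[OF gin[OF i(1)]] by simp
    finally show ?thesis .
  qed
  have cyc3: "cyc6 i \<in> {1,2,3} \<longleftrightarrow> i \<in> {1,2,3}" if "i \<in> {1..6}" for i
    using that by (auto simp: cyc6_def atLeastAtMost_1_6)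
  have c: "cyc6 1 = 2" "cyc6 2 = 3" "cyc6 4 = 5" "cyc6 5 = 6" by (simp_all add: cyc6_def)
  have m1: "g 1 \<in> {1,2,3} \<longleftrightarrow> s \<omega> = \<omega>" "g 4 \<in> {1,2,3} \<longleftrightarrow> s \<omega> \<noteq> \<omega>" using s(4) sep by blast+
  have s2: "s (Y 2) = Y (g 2)" using step[of 1] s1 m1 unfolding g2 c by simp
  have s5: "s (Y 5) = Y (g 5)" using step[of 4] s4 m1 unfolding g5 c by simp
  have m2: "g 2 \<in> {1,2,3} \<longleftrightarrow> s \<omega> = \<omega>" "g 5 \<in> {1,2,3} \<longleftrightarrow> s \<omega> \<noteq> \<omega>"
    using m1 cyc3[OF gin[of 1]] cyc3[OF gin[of 4]] unfolding g2 g5 by simp_all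
  have s3: "s (Y 3) = Y (g 3)" using step[of 2] s2 m2 unfolding g3 c by simp
  have s6: "s (Y 6) = Y (g 6)" using step[of 5] s5 m2 unfolding g6 c by simp
  have "act s = g"
    using s1 s2 s3 s4 s5 s6 by (intro act_eqI[OF s(1) g(1)]) (auto simp only: atLeastAtMost_1_6)
  then show ?thesis using s(1) by blast
qed

lemma act_iso:
  assumes "act ` G = carrier H" "\<And>x y. x \<otimes>\<^bsub>H\<^esub> y = x \<circ> y"
  shows "Gal_group L \<cong> H"
proof -
  have "x \<otimes>\<^bsub>Gal_group L\<^esub> y = x \<circ> y" for x y by (simp add: Gal_group_def)
  then have "act \<in> hom (Gal_group L) H"
    using assms act_comp by (auto intro!: homI)
  then have "act \<in> iso (Gal_group L) H"
    using assms(1) inj_on_act by (simp add: iso_def bij_betw_def)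
  then show ?thesis unfolding is_iso_def by blast
qed

theorem Gal_iso_wreath:
  assumes "\<And>u. u \<in> Qomega \<Longrightarrow> u ^ 3 \<noteq> b ^ 3 / a ^ 3"
  shows "Gal_group L \<cong> wreath_group"
proof -
  have "act ` G = carrier wreath_group"
    using wreath_in_act[OF assms] act_permutes act_commutes_cyc
    unfolding wreath_group_def cycles_eq by (auto simp: sym_group_carrier)
  moreover have "x \<otimes>\<^bsub>wreath_group\<^esub> y = x \<circ> y" for x y by (simp add: wreath_group_def sym_group_def)
  ultimately show ?thesis by (rule act_iso)
qed

text \<open>Now \<open>b / a\<close> lies in \<rat>(\<omega>), so an automorphism fixing \<omega>
  multiplies a and b by the same root of unity. On the numbering of \<open>Y\<close> the rotation
  therefore acts as \<open>rot6\<close>, and complex conjugation as \<open>swap6\<close>.\<close>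

theorem Gal_iso_C:
  assumes u: "u \<in> Qomega" "u ^ 3 = b ^ 3 / a ^ 3"
  shows "Gal_group L \<cong> C_group"
proof -
  interpret A: pure_cubic Qomega a by (rule pure_cubic_a)
  note L = L_eq_adj(1)[OF u] and ba = L_eq_adj(2)[OF u]
  have baL: "b / a \<in> L" using ba Qomega_subset_L by blast
  have w2L: "\<omega>\<^sup>2 \<in> L" using in_L subfield_power[OF subfield_L] by blast
  have act_r: "act s = rot6" if s: "s \<in> G" "s \<omega> = \<omega>" "s a = \<omega> * a" for s
  proof (rule act_eqI[OF s(1) rot6_permutes])
    have w2: "s (\<omega>\<^sup>2) = \<omega>\<^sup>2" using Gal_power[OF subfield_L s(1) in_L(1)] s by simp
    have sb: "s b = \<omega> * b"
    proof -
      have "s b = s (b / a) * s a" using Gal_mult[OF subfield_L s(1) baL in_L(2)] a_nz by simp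
      then show ?thesis using Gal_Qomega(1)[OF s(1) ba s(2)] s(3) a_nz by simp
    qed
    show "s (Y i) = Y (rot6 i)" if "i \<in> {1..6}" for i
      using that w2 sb s in_L w2L unfolding rot6_def atLeastAtMost_1_6
      by (auto simp: Y_def Gal_mult[OF subfield_L s(1)] omega_power_mult)
  qed
  have act_t: "act \<kappa> = swap6"
  proof (rule act_eqI[OF conj_in_G swap6_permutes])
    have w2: "\<kappa> (\<omega>\<^sup>2) = \<omega>" using Gal_power[OF subfield_L conj_in_G in_L(1)]
      by (simp add: conj_values omega_powers)
    show "\<kappa> (Y i) = Y (swap6 i)" if "i \<in> {1..6}" for i
      using that w2 conj_values in_L w2L unfolding swap6_def atLeastAtMost_1_6
      by (auto simp: Y_def Gal_mult[OF subfield_L conj_in_G])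
  qed
  obtain \<rho> where rho: "\<rho> \<in> G" "\<rho> a = \<omega> * a" "\<rho> \<omega> = \<omega>"
    using A.rotation[OF omega_in_Qomega] omega_in_Qomega unfolding L by metis
  have act_id: "act id = id"
    by (rule act_eqI[OF Gal_one permutes_id]) simp
  let ?S = "{swap6, rot6}"
  have t_gen: "swap6 \<in> generate (sym_group 6) ?S" and r_gen: "rot6 \<in> generate (sym_group 6) ?S"
    by (auto intro: generate.incl)
  have gen_comp: "g \<circ> h \<in> generate (sym_group 6) ?S"
    if "g \<in> generate (sym_group 6) ?S" "h \<in> generate (sym_group 6) ?S" for g h
    using generate.eng[OF that] by (simp add: sym_group_mult)
  have id_gen: "id \<in> generate (sym_group 6) ?S" using generate.one[of "sym_group 6" ?S] by (simp add: sym_group_one)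
  have fix_a: "s = id" if s: "s \<in> G" "s \<omega> = \<omega>" "s a = a" for s
  proof -
    have "s b = s (b / a) * s a" using Gal_mult[OF subfield_L s(1) baL in_L(2)] a_nz by simp
    then have "s b = b" using Gal_Qomega(1)[OF s(1) ba s(2)] s(3) a_nz by simp
    then show ?thesis using s Gal_eqI[of s "{\<omega>, a, b}" id] Gal_one unfolding L_def by auto
  qed
  have sub1: "act s \<in> generate (sym_group 6) ?S" if s: "s \<in> G" "s \<omega> = \<omega>" for s
  proof -
    have "s a ^ 3 = a ^ 3"
      using Gal_power[OF subfield_L s(1) in_L(2)] Gal_Qomega(1)[OF s(1) cube_in s(2)] by simp
    then consider "s a = a" | "s a = \<omega> * a" | "s a = \<omega>\<^sup>2 * a" unfolding complex_cube_eq_iff by blast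
    then show ?thesis
    proof cases
      case 1
      then show ?thesis using fix_a[OF s] act_id id_gen by simp
    next
      case 2
      then show ?thesis using act_r[OF s] r_gen by simp
    next
      case 3
      \<comment> \<open>Here s is the inverse of \<rho>, so its permutation is the square of
        \<open>rot6\<close>.\<close>
      have "(\<rho> \<circ> s) a = a"
        using 3 rho Gal_mult[OF subfield_L rho(1) w2L in_L(2)] Gal_power[OF subfield_L rho(1) in_L(1)]
        by (simp add: omega_power_mult)
      then have "\<rho> \<circ> s = id" using s rho(3) by (intro fix_a Gal_comp[OF rho(1)]) auto
      then have "rot6 \<circ> act s = id"
        using act_comp[OF rho(1) s(1)] act_r[OF rho(1,3,2)] act_id by simp
      then have "act s = rot6 \<circ> rot6"
        using rot6_rot6_rot6 by (metis comp_assoc comp_id id_comp)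
      then show ?thesis using gen_comp[OF r_gen r_gen] by simp
    qed
  qed
  have sub: "act s \<in> generate (sym_group 6) ?S" if s: "s \<in> G" for s
  proof (cases "s \<omega> = \<omega>")
    case False
    then have w: "s \<omega> = \<omega>\<^sup>2" using Gal_omega[OF s] by blast
    \<comment> \<open>Composition with complex conjugation reduces to the automorphisms fixing
      \<omega>.\<close>
    have "(s \<circ> \<kappa>) \<omega> = \<omega>" using w Gal_power[OF subfield_L s in_L(1)]
      by (simp add: conj_values omega_powers)
    then have *: "act (s \<circ> \<kappa>) \<in> generate (sym_group 6) ?S" using sub1[OF Gal_comp[OF s conj_in_G]] by blast
    have "act s = act (s \<circ> \<kappa>) \<circ> swap6"
      unfolding act_comp[OF s conj_in_G] act_t comp_assoc swap6_swap6 by simp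
    then show ?thesis using gen_comp[OF * t_gen] by simp
  qed (rule sub1[OF s])
  have img_comp: "g \<circ> h \<in> act ` G" if gh: "g \<in> act ` G" "h \<in> act ` G" for g h
  proof -
    obtain s t where "s \<in> G" "t \<in> G" "g = act s" "h = act t" using gh by blast
    then have "g \<circ> h = act (s \<circ> t)" "s \<circ> t \<in> G" by (simp_all add: act_comp Gal_comp)
    then show ?thesis by blast
  qed
  have img_r: "rot6 \<in> act ` G" using act_r[OF rho(1,3,2)] rho(1) by (metis imageI)
  have img_t: "swap6 \<in> act ` G" using act_t conj_in_G by (metis imageI)
  have "generate (sym_group 6) ?S \<subseteq> act ` G"
  proof
    fix g assume "g \<in> generate (sym_group 6) ?S"
    then show "g \<in> act ` G"
    proof induction
      case one
      then show ?case using act_id Gal_one by (metis imageI sym_group_one)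
    next
      case (incl h)
      then show ?case using img_r img_t by blast
    next
      case (inv h)
      have "inv\<^bsub>sym_group 6\<^esub> swap6 = swap6"
        using swap6_permutes inv_unique_comp[OF swap6_swap6 swap6_swap6] by (simp add: sym_group_carrier)
      moreover have "inv\<^bsub>sym_group 6\<^esub> rot6 = rot6 \<circ> rot6"
        using rot6_permutes inv_unique_comp[of rot6 "rot6 \<circ> rot6"] rot6_rot6_rot6
        by (simp add: sym_group_carrier comp_assoc)
      ultimately show ?case using inv img_t img_comp[OF img_r img_r] by (metis empty_iff insert_iff)
    next
      case (eng g h)
      then show ?case using img_comp by (simp only: sym_group_mult)
    qed
  qed
  then have "act ` G = carrier C_group" using sub unfolding C_group_def cycles_eq by auto
  moreover have "x \<otimes>\<^bsub>C_group\<^esub> y = x \<circ> y" for x y by (simp add: C_group_def sym_group_def)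
  ultimately show ?thesis by (rule act_iso)
qed

end

section \<open>The 3-periodic points of the normal form\<close>

lemma complex_cube_root_exists: "\<exists>\<theta>::complex. \<theta> ^ 3 = z"
proof
  show "rcis (root 3 (cmod z)) (Arg z / 3) ^ 3 = z"
    by (simp add: DeMoivre2 rcis_cmod_Arg)
qed

context
  fixes v :: rat and V :: complex
  assumes v0: "v \<noteq> 0" and V_def: "V = of_rat v"
begin

abbreviation (input) "phi \<equiv> rf_apply (cpoly (phi_v_num v)) (cpoly phi_v_den)"

lemma V_nz: "V \<noteq> 0"
  using v0 by (simp add: V_def)

lemma phi_None: "phi None = Some 0"
  and phi_Some: "phi (Some x) = (if x = 0 then None else Some (V * (x - 1) / x\<^sup>2))"
proof -
  have "cpoly (phi_v_num v) = [:- V, V:]" "cpoly phi_v_den = [:0, 0, 1:]"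
    by (simp_all add: cpoly_def phi_v_num_def phi_v_den_def map_poly_pCons V_def of_rat_minus)
  then show "phi None = Some 0" "phi (Some x) = (if x = 0 then None else Some (V * (x - 1) / x\<^sup>2))"
    using V_nz by (simp_all add: rf_apply_def power2_eq_square algebra_simps)
qed

text \<open>A general root w of \<open>w^2 + w + 1\<close> covers \<omega> and
  \<open>\<omega>^2\<close> at once. The factorization of \<open>1 - \<theta>^3\<close>, which is
  nonzero, shows that none of the three points of the cycle is at infinity.\<close>

lemma phi_theta:
  assumes w: "w\<^sup>2 = - 1 - w" "w \<noteq> - 2" and \<theta>: "\<theta> ^ 3 = 1 - 3 * (2 + w) / V"
  shows "phi (Some ((2 + w) / (1 - \<theta>))) = Some ((2 + w) / (1 - w\<^sup>2 * \<theta>))" "1 - \<theta> \<noteq> 0"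
proof -
  have w0: "2 + w \<noteq> 0" using w(2) by (metis add.commute eq_neg_iff_add_eq_0)
  have VT: "V * (1 - \<theta> ^ 3) = 3 * (2 + w)" using \<theta> V_nz by (simp add: field_simps)
  have fact: "(1 - \<theta>) * (1 - w * \<theta>) * (1 - w\<^sup>2 * \<theta>) = 1 - \<theta> ^ 3"
  proof -
    \<comment> \<open>The identity holds modulo \<open>w^2 + w + 1\<close>; the multiple is written
      out so that it becomes polynomial. The same device recurs below.\<close>
    have "(1 - \<theta>) * (1 - w * \<theta>) * (1 - w\<^sup>2 * \<theta>) - (1 - \<theta> ^ 3)
      = \<theta> * (w\<^sup>2 + w + 1) * (\<theta> * (1 + (w - 1) * (1 - \<theta>)) - 1) "
      by (simp add: expand)
    then show ?thesis using w(1) by simp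
  qed
  have nz: "1 - \<theta> \<noteq> 0" "1 - w\<^sup>2 * \<theta> \<noteq> 0"
    using fact VT w0 by (metis mult_eq_0_iff mult_zero_right zero_neq_numeral)+
  then show "1 - \<theta> \<noteq> 0" by blast
  have x1: "(2 + w) / (1 - \<theta>) - 1 = (1 + w + \<theta>) / (1 - \<theta>)" using nz by (simp add: field_simps)
  have "V * (1 + w + \<theta>) * (1 - \<theta>) * (1 - w\<^sup>2 * \<theta>) = (2 + w) ^ 3"
  proof -
    \<comment> \<open>The numerator of x - 1 supplies the missing factor
      \<open>1 - w * \<theta>\<close> of \<open>1 - \<theta>^3\<close>; the constants then match
      because \<open>(2 + w)^2 = 3 * (1 + w)\<close>.\<close>
    have "1 + w + \<theta> = (1 + w) * (1 - w * \<theta>) + \<theta> * (w\<^sup>2 + w + 1)" by (simp add: expand)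
    then have "1 + w + \<theta> = (1 + w) * (1 - w * \<theta>)" using w(1) by simp
    then have "V * (1 + w + \<theta>) * (1 - \<theta>) * (1 - w\<^sup>2 * \<theta>)
        = V * ((1 + w) * (1 - w * \<theta>)) * (1 - \<theta>) * (1 - w\<^sup>2 * \<theta>)" by simp
    also have "\<dots> = V * (1 + w) * ((1 - \<theta>) * (1 - w * \<theta>) * (1 - w\<^sup>2 * \<theta>))" by (simp only: mult_ac)
    also have "\<dots> = (1 + w) * (V * (1 - \<theta> ^ 3))" unfolding fact by (simp only: mult_ac)
    also have "\<dots> = 3 * (1 + w) * (2 + w)" unfolding VT by (simp only: mult_ac)
    also have "\<dots> = (2 + w) ^ 3 - (2 + w) * (w\<^sup>2 + w + 1)" by (simp add: expand)
    finally show ?thesis using w(1) by simp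
  qed
  then have "V * (1 + w + \<theta>) * (1 - \<theta>) * (1 - w\<^sup>2 * \<theta>) = (2 + w) * (2 + w)\<^sup>2" by (simp add: power3_eq_cube power2_eq_square mult.assoc)
  then have "V * (1 + w + \<theta>) * (1 - \<theta>) / (2 + w)\<^sup>2 = (2 + w) / (1 - w\<^sup>2 * \<theta>)"
    using nz w0 by (simp add: frac_eq_eq)
  moreover have "V * ((1 + w + \<theta>) / (1 - \<theta>)) / ((2 + w) / (1 - \<theta>))\<^sup>2 = V * (1 + w + \<theta>) * (1 - \<theta>) / (2 + w)\<^sup>2"
    using nz by (simp add: power_divide power2_eq_square)
  ultimately show "phi (Some ((2 + w) / (1 - \<theta>))) = Some ((2 + w) / (1 - w\<^sup>2 * \<theta>))"
    using nz w0 by (simp add: phi_Some x1)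
qed

text \<open>In the coordinate \<theta> the map is multiplication by \<open>w^2\<close>, so exact
  period 3 amounts to \<theta> being nonzero, which is what \<open>nz\<close> provides.\<close>

lemma periodic_theta:
  assumes w: "w\<^sup>2 = - 1 - w" "w \<noteq> - 2" "w \<noteq> 1" "w \<noteq> - 1" and nz: "V \<noteq> 3 * (2 + w)"
    and \<theta>: "\<theta> ^ 3 = 1 - 3 * (2 + w) / V"
  shows "periodic_pt (cpoly (phi_v_num v)) (cpoly phi_v_den) 3 (Some ((2 + w) / (1 - \<theta>)))"
proof -
  have w0: "2 + w \<noteq> 0" using w(2) by (metis add.commute eq_neg_iff_add_eq_0)
  have w3: "w ^ 3 = 1"
  proof -
    have "w ^ 3 = w * w\<^sup>2" by (simp add: expand)
    also have "\<dots> = 1 - (w\<^sup>2 + w + 1)" unfolding w(1) by (simp add: expand) (simp add: w(1)[unfolded power2_eq_square])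
    finally show ?thesis using w(1) by simp
  qed
  have t0: "\<theta> \<noteq> 0" using \<theta> nz V_nz by (auto simp: field_simps)
  have w23: "(w\<^sup>2) ^ 3 = 1" using w3 by (metis mult.commute power_mult power_one)
  have cub: "(w\<^sup>2 * \<theta>) ^ 3 = 1 - 3 * (2 + w) / V" "(w\<^sup>2 * (w\<^sup>2 * \<theta>)) ^ 3 = 1 - 3 * (2 + w) / V"
    using \<theta> by (simp_all only: power_mult_distrib w23 mult_1)
  have w4: "w\<^sup>2 * (w\<^sup>2 * \<theta>) = w * \<theta>"
  proof -
    have "w\<^sup>2 * (w\<^sup>2 * \<theta>) = w ^ 3 * w * \<theta>" by (simp add: expand)
    then show ?thesis using w3 by simp
  qed
  have w5: "w\<^sup>2 * (w * \<theta>) = \<theta>"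
  proof -
    have "w\<^sup>2 * (w * \<theta>) = w ^ 3 * \<theta>" by (simp add: expand)
    then show ?thesis using w3 by simp
  qed
  note p0 = phi_theta[OF w(1,2) \<theta>] and p1 = phi_theta[OF w(1,2) cub(1)] and p2 = phi_theta[OF w(1,2) cub(2)]
  have w21: "w\<^sup>2 \<noteq> 1" using w(3,4) by (simp add: power2_eq_1_iff)
  note p1 = p1[unfolded w4] and p2 = p2[unfolded w4 w5]
  have "(phi ^^ 3) (Some ((2 + w) / (1 - \<theta>))) = Some ((2 + w) / (1 - \<theta>))"
    using p0 p1 p2 by (simp add: numeral_3_eq_3)
  moreover have "(phi ^^ m) (Some ((2 + w) / (1 - \<theta>))) \<noteq> Some ((2 + w) / (1 - \<theta>))" if "0 < m" "m < 3" for m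
  proof -
    have "m = 1 \<or> m = 2" using that by auto
    then show ?thesis
    proof
      assume m: "m = 1"
      have "w\<^sup>2 * \<theta> \<noteq> \<theta>" using w21 t0 by simp
      then have "1 - w\<^sup>2 * \<theta> \<noteq> 1 - \<theta>" by simp
      then show ?thesis using m p0 p1 w0 by (simp add: frac_eq_eq)
    next
      assume m: "m = 2"
      have "w * \<theta> \<noteq> \<theta>" using w(3) t0 by simp
      then have "1 - w * \<theta> \<noteq> 1 - \<theta>" by simp
      then show ?thesis using m p0 p1 p2 w0 by (simp add: numeral_2_eq_2 frac_eq_eq)
    qed
  qed
  ultimately show ?thesis unfolding periodic_pt_def by simp
qed

text \<open>Up to the factor \<open>3 * (2 + w)\<close> and modulo \<open>w^2 + w + 1\<close>, this
  is the equation \<open>\<theta>^3 = 1 - 3 * (2 + w) / V\<close> for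
  \<open>\<theta> = 1 - (2 + w) / x\<close>, cleared of denominators.\<close>

definition "cub w x = x ^ 3 - V * x\<^sup>2 + (2 + w) * V * x - (1 + w) * V"

lemma cub_theta:
  assumes w: "w\<^sup>2 = - 1 - w" "w \<noteq> - 2" and x: "x \<noteq> 0" "cub w x = 0"
  shows "(1 - (2 + w) / x) ^ 3 = 1 - 3 * (2 + w) / V" "x = (2 + w) / (1 - (1 - (2 + w) / x))"
proof -
  have w0: "2 + w \<noteq> 0" using w(2) by (metis add.commute eq_neg_iff_add_eq_0)
  then show "x = (2 + w) / (1 - (1 - (2 + w) / x))" using x by simp
  have e: "V * (x - (2 + w)) ^ 3 - (V - 3 * (2 + w)) * x ^ 3
      = 3 * (2 + w) * cub w x - V * (2 + w) * (w\<^sup>2 + w + 1)"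
    by (simp add: cub_def expand)
  have "V * (x - (2 + w)) ^ 3 = (V - 3 * (2 + w)) * x ^ 3"
    using e x(2) w(1) by simp
  then have "(x - (2 + w)) ^ 3 / x ^ 3 = (V - 3 * (2 + w)) / V" using V_nz x(1) by (simp add: frac_eq_eq mult.commute)
  moreover have "(1 - (2 + w) / x) = (x - (2 + w)) / x" using x(1) by (simp add: field_simps)
  ultimately have "(1 - (2 + w) / x) ^ 3 = (V - 3 * (2 + w)) / V" by (simp only: power_divide)
  also have "\<dots> = 1 - 3 * (2 + w) / V" using V_nz by (simp add: diff_divide_distrib)
  finally show "(1 - (2 + w) / x) ^ 3 = 1 - 3 * (2 + w) / V" .
qed

definition "sextic x = x ^ 6 - 2 * V * x ^ 5 + (V\<^sup>2 + 3 * V) * x ^ 4 - (V + 3 * V\<^sup>2) * x ^ 3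
  + 4 * V\<^sup>2 * x\<^sup>2 - 3 * V\<^sup>2 * x + V\<^sup>2"

lemma cub_cub: "cub \<omega> x * cub (\<omega>\<^sup>2) x = sextic x"
  unfolding cub_def sextic_def omega_square
  by (simp add: numeral_eq_Suc algebra_simps omega_mult)

text \<open>The 2-cycle of 0 and infinity and the preimage 1 of 0 do not return after three steps,
  so the orbit stays in the affine chart away from 0. Clearing denominators in the cycle equations
  and dividing out the fixed points leaves the dynatomic polynomial.\<close>

lemma periodic_imp_sextic:
  assumes "periodic_pt (cpoly (phi_v_num v)) (cpoly phi_v_den) 3 P"
  obtains x where "P = Some x" "x \<noteq> 0" "sextic x = 0"
proof -
  have per: "phi (phi (phi P)) = P" and nfix: "phi P \<noteq> P"
  proof -
    show "phi (phi (phi P)) = P" using assms unfolding periodic_pt_def by (simp add: numeral_3_eq_3)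
    have "\<forall>m. 0 < m \<and> m < 3 \<longrightarrow> (phi ^^ m) P \<noteq> P"
      using assms unfolding periodic_pt_def by (elim conjE)
    from this[rule_format, of 1] show "phi P \<noteq> P" by simp
  qed
  obtain x where P: "P = Some x" using per by (cases P) (auto simp: phi_None phi_Some)
  have x0: "x \<noteq> 0" using per P by (auto simp: phi_None phi_Some)
  define y where "y = V * (x - 1) / x\<^sup>2"
  have y: "phi (Some x) = Some y" using x0 by (simp add: phi_Some y_def)
  have y0: "y \<noteq> 0" using per y P x0 by (auto simp: phi_None phi_Some y_def)
  define z where "z = V * (y - 1) / y\<^sup>2"
  have z: "phi (Some y) = Some z" using y0 by (simp add: phi_Some z_def)
  have z0: "z \<noteq> 0" using per y z P x0 by (auto simp: phi_None phi_Some)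
  have xz: "x = V * (z - 1) / z\<^sup>2" using per y z P z0 by (simp add: phi_Some)
  have xy: "x \<noteq> y" using nfix P y by auto
  \<comment> \<open>\<open>N / D\<close> is the second iterate of the map as a rational function of
    x.\<close>
  define D where "D = V * (x - 1)\<^sup>2"
  define N where "N = x\<^sup>2 * (V * (x - 1) - x\<^sup>2)"
  have E1: "y * x\<^sup>2 = V * (x - 1)" using x0 by (simp add: y_def)
  have E2: "z * y\<^sup>2 = V * (y - 1)" using y0 by (simp add: z_def)
  have E3: "x * z\<^sup>2 = V * (z - 1)" using xz z0 by (simp add: field_simps)
  have "V * (z * D) = z * (V * (x - 1))\<^sup>2" by (simp add: D_def expand)
  also have "\<dots> = (z * y\<^sup>2) * (x\<^sup>2)\<^sup>2" unfolding E1[symmetric] by (simp add: expand)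
  also have "\<dots> = V * (y * x\<^sup>2 - x\<^sup>2) * x\<^sup>2" unfolding E2 by (simp add: expand)
  also have "\<dots> = V * N" unfolding E1 N_def by (simp add: expand)
  finally have zD: "z * D = N" using V_nz by simp
  have "x * N\<^sup>2 = (x * z\<^sup>2) * D\<^sup>2" unfolding zD[symmetric] by (simp add: expand)
  also have "\<dots> = V * (z * D - D) * D" unfolding E3 by (simp add: expand)
  also have "\<dots> = V * (N - D) * D" unfolding zD ..
  finally have eq: "x * N\<^sup>2 - V * (N - D) * D = 0" by simp
  \<comment> \<open>The degree-9 equation for the third iterate splits into the fixed-point cubic
    and the dynatomic sextic.\<close>
  have "x * N\<^sup>2 - V * (N - D) * D = (x ^ 3 - V * x + V) * sextic x"
    unfolding N_def D_def sextic_def by (simp add: numeral_eq_Suc algebra_simps)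
  then have "(x ^ 3 - V * x + V) * sextic x = 0" using eq by simp
  moreover have "x ^ 3 - V * x + V \<noteq> 0"
  proof
    assume "x ^ 3 - V * x + V = 0"
    then have "V * (x - 1) = x * x\<^sup>2" by (simp add: expand)
    then have "y = x" unfolding y_def using x0 by simp
    then show False using xy by simp
  qed
  ultimately have "sextic x = 0" by simp
  then show thesis using that P x0 by blast
qed

lemma sextic_algebraic:
  assumes "sextic x = 0" shows "algebraic x"
proof (rule algebraicI')
  let ?p = "[:V\<^sup>2, - 3 * V\<^sup>2, 4 * V\<^sup>2, - (V + 3 * V\<^sup>2), V\<^sup>2 + 3 * V, - 2 * V, 1:]"
  show "?p \<noteq> 0" by simp
  show "poly ?p x = 0" using assms unfolding sextic_def by (simp add: numeral_eq_Suc algebra_simps)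
  have [simp]: "V \<in> \<rat>" by (simp add: V_def)
  show "coeff ?p i \<in> \<rat>" for i
    by (auto simp: coeff_pCons split: nat.split)
qed

lemma omega_distinct: "\<omega> \<noteq> - 2" "\<omega>\<^sup>2 \<noteq> - 2" "\<omega>\<^sup>2 \<noteq> - 1" "(\<omega>\<^sup>2)\<^sup>2 = - 1 - \<omega>\<^sup>2"
  "V \<noteq> 3 * (2 + \<omega>)" "V \<noteq> 3 * (2 + \<omega>\<^sup>2)" 
proof -
  have [simp]: "Im V = 0" unfolding V_def by (cases v) (simp add: of_rat_rat)
  show "(\<omega>\<^sup>2)\<^sup>2 = - 1 - \<omega>\<^sup>2" by (simp only: omega_powers) (simp add: omega_square)
  show "\<omega> \<noteq> - 2" "\<omega>\<^sup>2 \<noteq> - 2" "\<omega>\<^sup>2 \<noteq> - 1" "V \<noteq> 3 * (2 + \<omega>)" "V \<noteq> 3 * (2 + \<omega>\<^sup>2)"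
    unfolding omega_square by (auto simp: \<omega>_def complex_eq_iff)
qed

end

section \<open>Generators and Kummer data of the dynatomic field\<close>

context
  fixes v :: rat and V :: complex and \<theta> :: complex
  assumes v0: "v \<noteq> 0" and V_def: "V = of_rat v"
    and \<theta>: "\<theta> ^ 3 = 1 - 3 * (2 + \<omega>) / V"
begin

lemmas V0 = V_nz[OF v0 V_def]

lemma cnj_theta_cube: "cnj \<theta> ^ 3 = 1 - 3 * (2 + \<omega>\<^sup>2) / V"
proof -
  have "cnj \<theta> ^ 3 = cnj (\<theta> ^ 3)" by simp
  then show ?thesis unfolding \<theta> by (simp add: cnj_omega omega_square V_def)
qed

lemmas dist = omega_distinct[OF v0 V_def]

lemma periodic_omega:
  assumes "\<tau> ^ 3 = \<theta> ^ 3"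
  shows "periodic_pt (cpoly (phi_v_num v)) (cpoly phi_v_den) 3 (Some ((2 + \<omega>) / (1 - \<tau>)))" "1 - \<tau> \<noteq> 0"
proof -
  have t: "\<tau> ^ 3 = 1 - 3 * (2 + \<omega>) / V" using assms \<theta> by simp
  show "periodic_pt (cpoly (phi_v_num v)) (cpoly phi_v_den) 3 (Some ((2 + \<omega>) / (1 - \<tau>)))"
    by (rule periodic_theta[OF v0 V_def omega_square dist(1) _ _ dist(5) t]) simp_all
  show "1 - \<tau> \<noteq> 0" by (rule phi_theta(2)[OF v0 V_def omega_square dist(1) t])
qed

lemma periodic_omega2:
  assumes "\<tau> ^ 3 = cnj \<theta> ^ 3"
  shows "periodic_pt (cpoly (phi_v_num v)) (cpoly phi_v_den) 3 (Some ((2 + \<omega>\<^sup>2) / (1 - \<tau>)))" "1 - \<tau> \<noteq> 0"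
proof -
  have t: "\<tau> ^ 3 = 1 - 3 * (2 + \<omega>\<^sup>2) / V" using assms cnj_theta_cube by simp
  show "periodic_pt (cpoly (phi_v_num v)) (cpoly phi_v_den) 3 (Some ((2 + \<omega>\<^sup>2) / (1 - \<tau>)))"
    by (rule periodic_theta[OF v0 V_def dist(4) dist(2) _ dist(3) dist(6) t]) simp
  show "1 - \<tau> \<noteq> 0" by (rule phi_theta(2)[OF v0 V_def dist(4) dist(2) t])
qed

lemma periodic_algebraic:
  "periodic_pt (cpoly (phi_v_num v)) (cpoly phi_v_den) 3 (Some x) \<Longrightarrow> algebraic x"
  by (erule periodic_imp_sextic[OF v0 V_def]) (auto dest: sextic_algebraic[OF v0 V_def])

lemma dynatomic_field3_eq:
  "dynatomic_field3 (cpoly (phi_v_num v)) (cpoly phi_v_den) = gen_field {\<omega>, \<theta>, cnj \<theta>}"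
proof -
  define S where "S = {x. algebraic x \<and> periodic_pt (cpoly (phi_v_num v)) (cpoly phi_v_den) 3 (Some x)}"
  let ?L = "gen_field {\<omega>, \<theta>, cnj \<theta>}" and ?K = "gen_field S"
  note L = subfield_gen_field[of "{\<omega>, \<theta>, cnj \<theta>}"] and K = subfield_gen_field[of S]
  have inL: "\<omega> \<in> ?L" "\<theta> \<in> ?L" "cnj \<theta> \<in> ?L" using subset_gen_field[of "{\<omega>, \<theta>, cnj \<theta>}"] by auto
  have roots: "\<tau> \<in> ?L" if "\<tau> ^ 3 = \<sigma> ^ 3" "\<sigma> \<in> ?L" for \<tau> \<sigma>
    using that inL subfield_mult[OF L] subfield_power[OF L] unfolding complex_cube_eq_iff by metis
  have quot: "(2 + s) / (1 - \<tau>) \<in> ?L" if "s \<in> ?L" "\<tau> \<in> ?L" for s \<tau>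
    using that by (intro subfield_divide[OF L] subfield_diff[OF L] subfield_add[OF L] subfield_1[OF L] subfield_numeral[OF L])
  have "S \<subseteq> ?L"
  proof
    fix x assume "x \<in> S"
    then have x: "x \<noteq> 0" "sextic V x = 0"
      using periodic_imp_sextic[OF v0 V_def, of "Some x"] unfolding S_def by auto
    then consider "cub V \<omega> x = 0" | "cub V (\<omega>\<^sup>2) x = 0"
      using cub_cub[OF v0 V_def, of x] by auto
    then show "x \<in> ?L"
    proof cases
      case 1
      note c = cub_theta[OF v0 V_def omega_square dist(1) x(1) 1]
      have "(1 - (2 + \<omega>) / x) \<in> ?L" using roots[OF _ inL(2)] c(1) \<theta> by simp
      from quot[OF inL(1) this] show ?thesis by (simp only: c(2)[symmetric])
    next
      case 2
      note c = cub_theta[OF v0 V_def dist(4) dist(2) x(1) 2]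
      have "(1 - (2 + \<omega>\<^sup>2) / x) \<in> ?L" using roots[OF _ inL(3)] c(1) cnj_theta_cube by simp
      from quot[OF subfield_power[OF L inL(1), of 2] this] show ?thesis by (simp only: c(2)[symmetric])
    qed
  qed
  then have KL: "?K \<subseteq> ?L" using gen_field_least[OF L] by blast
  have mem: "(2 + \<omega>) / (1 - \<tau>) \<in> ?K" if "\<tau> ^ 3 = \<theta> ^ 3" for \<tau>
  proof (rule subsetD[OF subset_gen_field])
    note P = periodic_omega(1)[OF that]
    then show "(2 + \<omega>) / (1 - \<tau>) \<in> S" using periodic_algebraic[OF P] unfolding S_def by simp
  qed
  have mem2: "(2 + \<omega>\<^sup>2) / (1 - \<tau>) \<in> ?K" if "\<tau> ^ 3 = cnj \<theta> ^ 3" for \<tau>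
  proof (rule subsetD[OF subset_gen_field])
    note P = periodic_omega2(1)[OF that]
    then show "(2 + \<omega>\<^sup>2) / (1 - \<tau>) \<in> S" using periodic_algebraic[OF P] unfolding S_def by simp
  qed
  have nz: "2 + \<omega> \<noteq> 0" "2 + \<omega>\<^sup>2 \<noteq> 0"
    using dist(1,2) by (metis add.commute eq_neg_iff_add_eq_0)+
  have cb: "(\<omega> * \<theta>) ^ 3 = \<theta> ^ 3" "(\<omega>\<^sup>2 * \<theta>) ^ 3 = \<theta> ^ 3"
    unfolding complex_cube_eq_iff by auto
  \<comment> \<open>Summing 1/x over one 3-cycle cancels \<theta>, since 1, \<omega> and
    \<open>\<omega>^2\<close> add up to 0, and leaves \<open>3 / (2 + \<omega>)\<close>. This
    recovers \<omega>, and then \<theta> from a single periodic point.\<close>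
  have "inverse ((2 + \<omega>) / (1 - \<theta>)) + inverse ((2 + \<omega>) / (1 - \<omega> * \<theta>)) + inverse ((2 + \<omega>) / (1 - \<omega>\<^sup>2 * \<theta>)) \<in> ?K"
    by (intro subfield_add[OF K] subfield_inverse[OF K] mem cb refl)
  also have "inverse ((2 + \<omega>) / (1 - \<theta>)) + inverse ((2 + \<omega>) / (1 - \<omega> * \<theta>)) + inverse ((2 + \<omega>) / (1 - \<omega>\<^sup>2 * \<theta>))
     = ((1 - \<theta>) + (1 - \<omega> * \<theta>) + (1 - \<omega>\<^sup>2 * \<theta>)) / (2 + \<omega>)"
    unfolding inverse_divide by (simp only: add_divide_distrib)
  also have "(1 - \<theta>) + (1 - \<omega> * \<theta>) + (1 - \<omega>\<^sup>2 * \<theta>) = 3"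
    unfolding omega_square by (simp add: algebra_simps)
  finally have "3 / (2 + \<omega>) \<in> ?K" .
  moreover have "3 / z - 2 \<in> ?K" if "z \<in> ?K" for z
    using that by (intro subfield_diff[OF K] subfield_divide[OF K] subfield_numeral[OF K])
  ultimately have "3 / (3 / (2 + \<omega>)) - 2 \<in> ?K" by blast
  moreover have "3 / (3 / (2 + \<omega>)) - 2 = \<omega>" using nz by (simp add: field_simps)
  ultimately have w: "\<omega> \<in> ?K" by simp
  have inv: "1 - (2 + s) / z \<in> ?K" if "s \<in> ?K" "z \<in> ?K" for s z
    using that by (intro subfield_diff[OF K] subfield_divide[OF K] subfield_add[OF K] subfield_numeral[OF K] subfield_1[OF K])
  have t: "\<theta> \<in> ?K" using inv[OF w mem[OF refl]] nz periodic_omega(2)[OF refl] by simp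
  have ct: "cnj \<theta> \<in> ?K"
    using inv[OF subfield_power[OF K w, of 2] mem2[OF refl]] nz periodic_omega2(2)[OF refl] by simp
  have "?L \<subseteq> ?K" using w t ct by (intro gen_field_least[OF K]) auto
  then have "?K = ?L" using KL by (rule subset_antisym[rotated])
  then show ?thesis unfolding dynatomic_field3_def S_def .
qed

lemma theta_cube_mult: "V * \<theta> ^ 3 = V - 3 * (2 + \<omega>)" "V * cnj \<theta> ^ 3 = V - 3 * (2 + \<omega>\<^sup>2)"
  unfolding \<theta> cnj_theta_cube using V0 by (simp_all add: right_diff_distrib)

lemma theta_nz: "\<theta> \<noteq> 0"
  using theta_cube_mult(1) dist(5) by auto

lemma conj_cubic_theta:
  assumes v3: "v \<noteq> 3"
  shows "conj_cubic \<theta>"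
proof
  show "\<theta> ^ 3 \<in> Qomega" unfolding \<theta> V_def
    using omega_in_Qomega by (intro subfield_closed[OF subfield_Qomega])
  show "cnj \<theta> ^ 3 \<noteq> \<theta> ^ 3"
  proof
    assume "cnj \<theta> ^ 3 = \<theta> ^ 3"
    then have "V - 3 * (2 + \<omega>) = V - 3 * (2 + \<omega>\<^sup>2)" using theta_cube_mult by metis
    then show False by (simp add: omega_neq(5)[symmetric])
  qed
  fix r :: rat
  show "\<theta> ^ 3 * cnj \<theta> ^ 3 \<noteq> of_rat r ^ 3"
  proof
    assume e: "\<theta> ^ 3 * cnj \<theta> ^ 3 = of_rat r ^ 3"
    have "(V * \<theta> ^ 3) * (V * cnj \<theta> ^ 3) = V\<^sup>2 * of_rat r ^ 3"
      unfolding e[symmetric] by (simp add: power2_eq_square)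
    moreover have "(V - 3 * (2 + \<omega>)) * (V - 3 * (2 + \<omega>\<^sup>2)) = V\<^sup>2 - 9 * V + 27"
      unfolding omega_square by (simp add: expand omega_mult)
    ultimately have "V\<^sup>2 - 9 * V + 27 = V\<^sup>2 * of_rat r ^ 3" unfolding theta_cube_mult by simp
    then have "(of_rat (v\<^sup>2 - 9 * v + 27) :: complex) = of_rat (v\<^sup>2 * r ^ 3)"
      unfolding V_def by (simp add: of_rat_add of_rat_diff of_rat_mult of_rat_power)
    then have e: "v\<^sup>2 - 9 * v + 27 = v\<^sup>2 * r ^ 3" by (simp only: of_rat_eq_iff)
    \<comment> \<open>Shifting v by 3 completes the cube, so a cube norm becomes a solution of
      Fermat's equation. The only solution left for v different from 0 and 3 has r = 0, and then
      \<open>v^2 - 9 * v + 27\<close> would vanish although its discriminant is negative.\<close>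
    have "(v - 3) ^ 3 + 3 ^ 3 = v * (v\<^sup>2 - 9 * v + 27)" by (simp add: expand)
    also have "\<dots> = (r * v) ^ 3" unfolding e by (simp add: expand)
    finally have "(v - 3) * 3 * (r * v) = 0" by (rule fermat_cubic_rat)
    then have "r = 0" using v0 v3 by simp
    then have "(2 * v - 9)\<^sup>2 + 27 = 0" using e by (simp add: expand)
    then show False using zero_le_power2[of "2 * v - 9"] by linarith
  qed
qed

text \<open>With \<open>u = (t + \<omega>) / (t + \<omega>\<^sup>2)\<close> the equation \<open>\<eta>(t) = v\<close> becomes \<open>u\<^sup>3 = cnj (\<theta>\<^sup>3) / \<theta>\<^sup>3\<close>.\<close>
lemma Im_eta_iff: "v \<in> Im_eta \<longleftrightarrow> (\<exists>u\<in>Qomega. u ^ 3 = cnj \<theta> ^ 3 / \<theta> ^ 3)"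
proof -
  have ratio: "cnj \<theta> ^ 3 / \<theta> ^ 3 = (V - 3 * (2 + \<omega>\<^sup>2)) / (V - 3 * (2 + \<omega>))"
    unfolding theta_cube_mult[symmetric] using V0 by simp
  have nz: "V - 3 * (2 + \<omega>) \<noteq> 0" "V - 3 * (2 + \<omega>\<^sup>2) \<noteq> 0" using dist by auto
  define c q where "c T = T ^ 3 + 3 * T\<^sup>2 - 6 * T + 1" and "q T = T * (T - 1)" for T :: complex
  \<comment> \<open>\<open>(T + \<omega>^2)^3\<close> and its conjugate expressed by the numerator c
    and the denominator q of \<eta>; replacing \<open>c T\<close> by \<open>V * q T\<close> turns
    them into multiples of the numerators of \<open>\<theta>^3\<close> and its conjugate.\<close>
  have cq: "c T - 3 * (2 + \<omega>) * q T = (T + \<omega>\<^sup>2) ^ 3" "c T - 3 * (2 + \<omega>\<^sup>2) * q T = (T + \<omega>) ^ 3" for T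
    unfolding omega_square c_def q_def by (simp_all add: expand omega_mult)
  show ?thesis
  proof
    assume "v \<in> Im_eta"
    then obtain t where t: "v = eta t" "t \<noteq> 0" "t \<noteq> 1" unfolding Im_eta_def by blast
    define T :: complex where "T = of_rat t"
    have q0: "q T \<noteq> 0" using t by (simp add: q_def T_def)
    have "t ^ 3 + 3 * t\<^sup>2 - 6 * t + 1 = v * (t * (t - 1))" unfolding t(1) eta_def using t by simp
    then have "(of_rat (t ^ 3 + 3 * t\<^sup>2 - 6 * t + 1) :: complex) = of_rat (v * (t * (t - 1)))" by simp
    then have cT: "c T = V * q T" unfolding c_def q_def T_def V_def
      by (simp add: of_rat_add of_rat_diff of_rat_mult of_rat_power)
    have e: "(V - 3 * (2 + \<omega>)) * q T = (T + \<omega>\<^sup>2) ^ 3" "(V - 3 * (2 + \<omega>\<^sup>2)) * q T = (T + \<omega>) ^ 3"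
      unfolding cq[symmetric] cT by (simp_all add: left_diff_distrib)
    have "((T + \<omega>) / (T + \<omega>\<^sup>2)) ^ 3 = cnj \<theta> ^ 3 / \<theta> ^ 3"
      unfolding ratio power_divide e[symmetric] using q0 by simp
    moreover have "(T + \<omega>) / (T + \<omega>\<^sup>2) \<in> Qomega" unfolding T_def
      using omega_in_Qomega by (intro subfield_closed[OF subfield_Qomega])
    ultimately show "\<exists>u\<in>Qomega. u ^ 3 = cnj \<theta> ^ 3 / \<theta> ^ 3" by blast
  next
    assume "\<exists>u\<in>Qomega. u ^ 3 = cnj \<theta> ^ 3 / \<theta> ^ 3"
    then obtain u where u: "u \<in> Qomega" "u ^ 3 = cnj \<theta> ^ 3 / \<theta> ^ 3" by blast
    obtain r where r: "u * cnj u = of_rat r" using u(1) by (rule norm_Qomega_is_rat)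
    have "cnj u ^ 3 = \<theta> ^ 3 / cnj \<theta> ^ 3"
      using arg_cong[OF u(2), of cnj] by simp
    \<comment> \<open>The norm of u is a rational cube root of 1, hence 1. This makes the parameter
      T below real.\<close>
    then have "(u * cnj u) ^ 3 = 1" using u(2) theta_nz by (simp add: power_mult_distrib)
    then have "(of_rat (r ^ 3) :: complex) = of_rat 1" unfolding r by (simp add: of_rat_power)
    then have "r ^ 3 = 1" by (simp only: of_rat_eq_iff)
    moreover have "r ^ 3 - 1 = (r - 1) * (r\<^sup>2 + r + 1)" by (simp add: expand)
    moreover have "r\<^sup>2 + r + 1 \<noteq> 0"
    proof
      assume "r\<^sup>2 + r + 1 = 0"
      then have "(2 * r + 1)\<^sup>2 + 3 = 0" by (simp add: expand)
      then show False using zero_le_power2[of "2 * r + 1"] by linarith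
    qed
    ultimately have "r = 1" by simp
    then have uu: "u * cnj u = 1" using r by simp
    have u1: "u \<noteq> 1"
    proof
      assume "u = 1"
      then have "V - 3 * (2 + \<omega>\<^sup>2) = V - 3 * (2 + \<omega>)" using u(2) nz unfolding ratio by simp
      then show False by (simp add: omega_neq(5))
    qed
    have u0: "u \<noteq> 0" using uu by auto
    \<comment> \<open>The solution of \<open>u = (T + \<omega>) / (T + \<omega>^2)\<close> for T. As
      \<open>cnj u = 1 / u\<close>, it is invariant under conjugation and therefore
      rational.\<close>
    define T where "T = (\<omega> - u * \<omega>\<^sup>2) / (u - 1)"
    have TQ: "T \<in> Qomega" unfolding T_def
      using u(1) omega_in_Qomega by (intro subfield_closed[OF subfield_Qomega])
    have cu: "cnj u = 1 / u" using uu u0 by (simp add: field_simps)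
    have "cnj T = (\<omega>\<^sup>2 - \<omega> / u) / (1 / u - 1)"
      unfolding T_def using cu omega_powers(3) by (simp add: cnj_omega flip: omega_square)
    also have "\<dots> = (u * (\<omega>\<^sup>2 - \<omega> / u)) / (u * (1 / u - 1))" using u0 by simp
    also have "u * (\<omega>\<^sup>2 - \<omega> / u) = - (\<omega> - u * \<omega>\<^sup>2)" using u0 by (simp add: right_diff_distrib)
    also have "u * (1 / u - 1) = - (u - 1)" using u0 by (simp add: right_diff_distrib)
    finally have "cnj T = T" unfolding T_def by (simp only: minus_divide_divide)
    then obtain t where t: "T = of_rat t" using TQ real_Qomega_is_rat by blast
    have "T * (u - 1) = \<omega> - u * \<omega>\<^sup>2" unfolding T_def using u1 by simp
    then have "u * (T + \<omega>\<^sup>2) = T + \<omega>" by (simp add: algebra_simps)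
    then have "u ^ 3 * (T + \<omega>\<^sup>2) ^ 3 = (T + \<omega>) ^ 3" by (metis power_mult_distrib)
    then have "(V - 3 * (2 + \<omega>\<^sup>2)) * (c T - 3 * (2 + \<omega>) * q T) = (V - 3 * (2 + \<omega>)) * (c T - 3 * (2 + \<omega>\<^sup>2) * q T)"
      unfolding cq u(2) ratio using nz by (simp add: field_simps)
    then have "3 * (\<omega> - \<omega>\<^sup>2) * (c T - V * q T) = 0" by (simp add: algebra_simps)
    then have "c T = V * q T" using omega_neq(5)[symmetric] by simp
    then have "(of_rat (t ^ 3 + 3 * t\<^sup>2 - 6 * t + 1) :: complex) = of_rat (v * (t * (t - 1)))"
      unfolding c_def q_def t V_def by (simp add: of_rat_add of_rat_diff of_rat_mult of_rat_power)
    then have e: "t ^ 3 + 3 * t\<^sup>2 - 6 * t + 1 = v * (t * (t - 1))" by (simp only: of_rat_eq_iff)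
    \<comment> \<open>The numerator of \<eta> takes the values 1 and -1 there, while the right-hand
      side is 0.\<close>
    then have "t \<noteq> 0" "t \<noteq> 1" by auto
    then have "v = eta t" unfolding eta_def e by simp
    then show "v \<in> Im_eta" unfolding Im_eta_def using \<open>t \<noteq> 0\<close> \<open>t \<noteq> 1\<close> by blast
  qed
qed

end

theorem Gal_normal_form:
  assumes "v \<noteq> 0" "v \<noteq> 3"
  shows "v \<in> Im_eta \<Longrightarrow> Gal_group (dynatomic_field3 (cpoly (phi_v_num v)) (cpoly phi_v_den)) \<cong> C_group"
    and "v \<notin> Im_eta \<Longrightarrow> Gal_group (dynatomic_field3 (cpoly (phi_v_num v)) (cpoly phi_v_den)) \<cong> wreath_group"
proof -
  obtain \<theta> where \<theta>: "\<theta> ^ 3 = 1 - 3 * (2 + \<omega>) / of_rat v" using complex_cube_root_exists by blast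
  interpret conj_cubic \<theta> by (rule conj_cubic_theta[OF assms(1) refl \<theta> assms(2)])
  have L: "dynatomic_field3 (cpoly (phi_v_num v)) (cpoly phi_v_den) = L"
    unfolding L_def by (rule dynatomic_field3_eq[OF assms(1) refl \<theta>])
  note iff = Im_eta_iff[OF assms(1) refl \<theta>]
  show "v \<in> Im_eta \<Longrightarrow> Gal_group (dynatomic_field3 (cpoly (phi_v_num v)) (cpoly phi_v_den)) \<cong> C_group"
    unfolding L iff using Gal_iso_C by blast
  show "v \<notin> Im_eta \<Longrightarrow> Gal_group (dynatomic_field3 (cpoly (phi_v_num v)) (cpoly phi_v_den)) \<cong> wreath_group"
    unfolding L iff using Gal_iso_wreath by blast
qed

section \<open>Homogeneous coordinates\<close>

text \<open>The point [X : Y]. The meaningless pair (0, 0) is also sent to infinity, hence the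
  nonvanishing hypotheses throughout.\<close>

definition proj :: "complex \<Rightarrow> complex \<Rightarrow> complex option" where
  "proj X Y = (if Y = 0 then None else Some (X / Y))"

lemma proj_cases:
  obtains X Y where "P = proj X Y" "(X, Y) \<noteq> (0, 0)"
proof (cases P)
  case None
  then show thesis using that[of 1 0] by (simp add: proj_def)
next
  case (Some x)
  then show thesis using that[of x 1] by (simp add: proj_def)
qed

lemma proj_eq_iff:
  "(X, Y) \<noteq> (0, 0) \<Longrightarrow> (X', Y') \<noteq> (0, 0) \<Longrightarrow> proj X Y = proj X' Y' \<longleftrightarrow> X * Y' = X' * Y"
  by (auto simp: proj_def frac_eq_eq)

lemma proj_scale: "k \<noteq> 0 \<Longrightarrow> proj (k * X) (k * Y) = proj X Y"
  by (simp add: proj_def)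

lemma proj_eqE:
  assumes "proj X Y = proj X' Y'" "(X, Y) \<noteq> (0, 0)" "(X', Y') \<noteq> (0, 0)"
  obtains k where "k \<noteq> 0" "X = k * X'" "Y = k * Y'"
proof (cases "Y' = 0")
  case True
  then have "Y = 0" using assms by (auto simp: proj_def split: if_splits)
  then show thesis using that[of "X / X'"] True assms by auto
next
  case False
  then have "Y \<noteq> 0" "X / Y = X' / Y'" using assms by (auto simp: proj_def split: if_splits)
  then show thesis using that[of "Y / Y'"] False by (simp add: field_simps)
qed

lemma mobius_proj:
  assumes "a * d - b * c \<noteq> 0" "(X, Y) \<noteq> (0, 0)"
  shows "mobius a b c d (proj X Y) = proj (a * X + b * Y) (c * X + d * Y)"
proof (cases "Y = 0")
  case True
  then have "X \<noteq> 0" using assms by simp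
  then show ?thesis using True assms by (auto simp: mobius_def rf_apply_def proj_def)
next
  case False
  have "d + X * c / Y = (c * X + d * Y) / Y" "b + X * a / Y = (a * X + b * Y) / Y"
    using False by (simp_all add: add_divide_distrib mult.commute)
  then show ?thesis using False by (simp add: mobius_def rf_apply_def proj_def)
qed

lemma mobius_nz:
  assumes "a * d - b * c \<noteq> (0::complex)" "(X, Y) \<noteq> (0, 0)"
  shows "(a * X + b * Y, c * X + d * Y) \<noteq> (0, 0)"
proof
  assume "(a * X + b * Y, c * X + d * Y) = (0, 0)"
  then have e: "a * X + b * Y = 0" "c * X + d * Y = 0" by auto
  have "(a * d - b * c) * X = d * (a * X + b * Y) - b * (c * X + d * Y)"
    "(a * d - b * c) * Y = a * (c * X + d * Y) - c * (a * X + b * Y)" by (simp_all add: algebra_simps)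
  then have "X = 0" "Y = 0" unfolding e using assms(1) by auto
  then show False using assms(2) by simp
qed

lemma mobius_comp:
  assumes "a * d - b * c \<noteq> 0" "a' * d' - b' * c' \<noteq> 0"
  shows "mobius a b c d (mobius a' b' c' d' P)
    = mobius (a * a' + b * c') (a * b' + b * d') (c * a' + d * c') (c * b' + d * d') P"
proof -
  obtain X Y where P: "P = proj X Y" "(X, Y) \<noteq> (0, 0)" by (rule proj_cases)
  have "(a * a' + b * c') * (c * b' + d * d') - (a * b' + b * d') * (c * a' + d * c')
      = (a * d - b * c) * (a' * d' - b' * c')" by (simp add: algebra_simps)
  then have d: "(a * a' + b * c') * (c * b' + d * d') - (a * b' + b * d') * (c * a' + d * c') \<noteq> 0"
    using assms by simp
  show ?thesis unfolding P(1) mobius_proj[OF assms(2) P(2)]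
      mobius_proj[OF assms(1) mobius_nz[OF assms(2) P(2)]] mobius_proj[OF d P(2)]
    by (simp add: algebra_simps)
qed

lemma mobius_scalar: "k \<noteq> 0 \<Longrightarrow> mobius k 0 0 k P = P"
proof -
  assume k: "k \<noteq> 0"
  obtain X Y where P: "P = proj X Y" "(X, Y) \<noteq> (0, 0)" by (rule proj_cases)
  show ?thesis unfolding P(1) using k P(2) by (subst mobius_proj) (auto simp: proj_scale)
qed

lemma mobius_inverse:
  assumes "a * d - b * c \<noteq> 0"
  shows "mobius d (- b) (- c) a (mobius a b c d P) = P" "mobius a b c d (mobius d (- b) (- c) a P) = P"
proof -
  have d: "d * a - (- b) * (- c) \<noteq> 0" using assms by (simp add: algebra_simps)
  have *: "mobius d (- b) (- c) a (mobius a b c d P) = mobius (a * d - b * c) 0 0 (a * d - b * c) P"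
    "mobius a b c d (mobius d (- b) (- c) a P) = mobius (a * d - b * c) 0 0 (a * d - b * c) P"
    unfolding mobius_comp[OF d assms] mobius_comp[OF assms d] by (simp_all add: algebra_simps)
  show "mobius d (- b) (- c) a (mobius a b c d P) = P" "mobius a b c d (mobius d (- b) (- c) a P) = P"
    unfolding * using assms by (rule mobius_scalar)+
qed

lemma bij_mobius: "a * d - b * c \<noteq> 0 \<Longrightarrow> bij (mobius a b c d)"
  by (rule o_bij[of "mobius d (- b) (- c) a"]) (auto simp: mobius_inverse)

lemma conj_iff:
  assumes "a * d - b * c \<noteq> 0"
  shows "Hilbert_Choice.inv (mobius a b c d) \<circ> f \<circ> mobius a b c d = g
    \<longleftrightarrow> (\<forall>P. f (mobius a b c d P) = mobius a b c d (g P))"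
proof -
  let ?m = "mobius a b c d"
  have m: "inj ?m" "surj ?m" using bij_mobius[OF assms] by (simp_all add: bij_def)
  show ?thesis
  proof
    assume "Hilbert_Choice.inv ?m \<circ> f \<circ> ?m = g"
    then show "\<forall>P. f (?m P) = ?m (g P)" using m(2) by (auto simp: surj_f_inv_f)
  next
    assume "\<forall>P. f (?m P) = ?m (g P)"
    then show "Hilbert_Choice.inv ?m \<circ> f \<circ> ?m = g" using m(1) by (auto simp: fun_eq_iff)
  qed
qed

section \<open>The dynatomic field under rational changes of coordinate\<close>

lemma algebraic_affine:
  fixes x r s :: complex
  assumes x: "algebraic x" and rs: "r \<in> \<rat>" "s \<in> \<rat>"
  shows "algebraic (r * x + s)"
proof (cases "r = 0")
  case True
  then show ?thesis using rs by (simp add: rat_imp_algebraic)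
next
  case False
  obtain p where p: "\<And>i. coeff p i \<in> \<rat>" "p \<noteq> 0" "poly p x = 0"
    using x unfolding algebraic_altdef by blast
  \<comment> \<open>The inverse affine map; substituting it into p moves the root from x to
    \<open>r * x + s\<close>.\<close>
  let ?q = "[:- s / r, 1 / r:]"
  have q: "coeff ?q i \<in> \<rat>" for i using rs by (auto simp: coeff_pCons split: nat.split)
  have mult: "coeff (f * g) i \<in> \<rat>" if "\<And>i. coeff f i \<in> \<rat>" "\<And>i. coeff g i \<in> \<rat>" for f g :: "complex poly" and i
    unfolding coeff_mult using that by (intro Rats_sum Rats_mult)
  have "coeff (pcompose p ?q) i \<in> \<rat>" for i using p(1)
  proof (induction p arbitrary: i)
    case (pCons c p)
    have "c \<in> \<rat>" "\<And>i. coeff p i \<in> \<rat>" using pCons.prems[of 0] pCons.prems[of "Suc _"] by simp_all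
    then have "coeff (?q * pcompose p ?q) i \<in> \<rat>" using pCons.IH q mult by blast
    then show ?case using \<open>c \<in> \<rat>\<close> by (auto simp: pcompose_pCons coeff_pCons split: nat.split)
  qed simp
  moreover have "pcompose p ?q \<noteq> 0" using p(2) False pcompose_eq_0[of p ?q] by auto
  moreover have "poly (pcompose p ?q) (r * x + s) = 0"
    using p(3) False by (simp add: poly_pcompose field_simps)
  ultimately show ?thesis by (rule algebraicI')
qed

lemma algebraic_mobius:
  assumes x: "algebraic x" and Q: "a \<in> \<rat>" "b \<in> \<rat>" "c \<in> \<rat>" "d \<in> \<rat>" and y: "mobius a b c d (Some x) = Some y"
  shows "algebraic y"
proof -
  have nz: "c * x + d \<noteq> 0" and y: "y = (a * x + b) / (c * x + d)"
    using y by (auto simp: mobius_def rf_apply_def algebra_simps split: if_splits)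
  show ?thesis
  proof (cases "c = 0")
    case True
    then have "y = (a / d) * x + b / d" using y by (simp add: add_divide_distrib)
    then show ?thesis using algebraic_affine[OF x, of "a / d" "b / d"] Q by simp
  next
    case False
    have "algebraic (inverse (c * x + d))" using algebraic_affine[OF x Q(3,4)] by blast
    \<comment> \<open>Splitting off the constant a/c leaves only affine maps and one
      inversion.\<close>
    then have "algebraic ((b - a * d / c) * inverse (c * x + d) + a / c)"
      using Q by (intro algebraic_affine) auto
    also have "(b - a * d / c) * inverse (c * x + d) + a / c = y"
      unfolding y using False nz by (simp add: divide_simps) (simp add: algebra_simps)
    finally show ?thesis .
  qed
qed

lemma Rats_subset_subfield: "is_subfield K \<Longrightarrow> r \<in> \<rat> \<Longrightarrow> r \<in> K"
  by (auto elim!: Rats_cases intro: subfield_of_rat)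

lemma mobius_in_subfield:
  assumes K: "is_subfield K" and Q: "a \<in> \<rat>" "b \<in> \<rat>" "c \<in> \<rat>" "d \<in> \<rat>"
    and det: "a * d - b * c \<noteq> 0"
    and P: "P = None \<or> (\<exists>x\<in>K. P = Some x)" and y: "mobius a b c d P = Some y"
  shows "y \<in> K"
proof -
  note QK = Q[THEN Rats_subset_subfield[OF K]]
  show ?thesis
  proof (cases P)
    case None
    have "a / c \<in> K" using QK by (intro subfield_divide[OF K])
    moreover have "Some y = proj a c" using y None mobius_proj[OF det, of 1 0] by (simp add: proj_def)
    ultimately show ?thesis by (simp add: proj_def split: if_splits)
  next
    case (Some x)
    then have "x \<in> K" using P by auto
    then have "(b + x * a) / (d + x * c) \<in> K"
      using QK by (intro subfield_divide[OF K] subfield_add[OF K] subfield_mult[OF K])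
    moreover have "y = (b + x * a) / (d + x * c)"
      using y Some by (simp add: mobius_def rf_apply_def split: if_splits)
    ultimately show ?thesis by simp
  qed
qed

lemma periodic_conj_iff:
  assumes m: "inj m" and conj: "\<And>P. rf_apply p q (m P) = m (rf_apply p' q' P)"
  shows "periodic_pt p q n (m P) \<longleftrightarrow> periodic_pt p' q' n P"
proof -
  have "(rf_apply p q ^^ k) (m P) = m ((rf_apply p' q' ^^ k) P)" for k
    by (induction k) (simp_all add: conj)
  then show ?thesis unfolding periodic_pt_def using m by (simp add: inj_eq)
qed

text \<open>A rational Mobius map matches the 3-periodic points and keeps the field generated by
  them. A periodic point of the first map may be infinity and give no generator; its partner is then
  the rational preimage of infinity and lies in every subfield.\<close>

lemma dynatomic_field3_conj:
  assumes det: "a * d - b * c \<noteq> 0" and Q: "a \<in> \<rat>" "b \<in> \<rat>" "c \<in> \<rat>" "d \<in> \<rat>"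
    and conj: "\<And>P. rf_apply p q (mobius a b c d P) = mobius a b c d (rf_apply p' q' P)"
    and alg: "\<And>x. periodic_pt p' q' 3 (Some x) \<Longrightarrow> algebraic x"
    and inf: "\<not> periodic_pt p' q' 3 None"
  shows "dynatomic_field3 p q = dynatomic_field3 p' q'"
proof
  let ?m = "mobius a b c d" and ?n = "mobius d (- b) (- c) a"
  have per: "periodic_pt p q 3 (?m P) \<longleftrightarrow> periodic_pt p' q' 3 P" for P
    using bij_mobius[OF det] conj by (intro periodic_conj_iff) (auto simp: bij_def)
  note inv = mobius_inverse[OF det]
  have Q': "- b \<in> \<rat>" "- c \<in> \<rat>" using Q by auto
  have det': "d * a - (- b) * (- c) \<noteq> 0" using det by (simp add: algebra_simps)
  let ?S = "{x. algebraic x \<and> periodic_pt p q 3 (Some x)}" and ?S' = "{x. algebraic x \<and> periodic_pt p' q' 3 (Some x)}"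
  show "dynatomic_field3 p q \<subseteq> dynatomic_field3 p' q'"
    unfolding dynatomic_field3_def
  proof (rule gen_field_least[OF subfield_gen_field], rule subsetI)
    fix x assume "x \<in> ?S"
    then have p': "periodic_pt p' q' 3 (?n (Some x))" using per[of "?n (Some x)"] by (simp add: inv)
    then obtain x' where x': "?n (Some x) = Some x'" using inf by (cases "?n (Some x)") auto
    then have "x' \<in> ?S'" using p' alg by simp
    then have "x' \<in> gen_field ?S'" by (rule subsetD[OF subset_gen_field])
    then have "Some x' = None \<or> (\<exists>y\<in>gen_field ?S'. Some x' = Some y)" by simp
    moreover have "?m (Some x') = Some x" using x' inv(2)[of "Some x"] by simp
    ultimately show "x \<in> gen_field ?S'"
      by (rule mobius_in_subfield[OF subfield_gen_field Q det])
  qed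
  show "dynatomic_field3 p' q' \<subseteq> dynatomic_field3 p q"
    unfolding dynatomic_field3_def
  proof (rule gen_field_least[OF subfield_gen_field], rule subsetI)
    fix x assume x: "x \<in> ?S'"
    have "?m (Some x) = None \<or> (\<exists>y\<in>gen_field ?S. ?m (Some x) = Some y)"
    proof (cases "?m (Some x)")
      case (Some y)
      have "algebraic x" using x by simp
      then have "algebraic y" using Q Some by (rule algebraic_mobius)
      moreover have "periodic_pt p q 3 (Some y)" using per[of "Some x"] Some x by simp
      ultimately have "y \<in> ?S" by simp
      then have "y \<in> gen_field ?S" by (rule subsetD[OF subset_gen_field])
      then show ?thesis using Some by simp
    qed simp
    then show "x \<in> gen_field ?S"
      by (rule mobius_in_subfield[OF subfield_gen_field Q(4) Q' Q(1) det']) (rule inv(1))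
  qed
qed

section \<open>Quadratic maps over the rationals\<close>

definition qform :: "complex \<Rightarrow> complex \<Rightarrow> complex \<Rightarrow> complex \<Rightarrow> complex \<Rightarrow> complex" where
  "qform c0 c1 c2 X Y = c0 * Y\<^sup>2 + c1 * X * Y + c2 * X\<^sup>2"

text \<open>The homogenized Wronskian \<open>p' q - p q'\<close> of the two quadratics, whose zeros
  are the critical points.\<close>

definition jac :: "complex \<Rightarrow> complex \<Rightarrow> complex \<Rightarrow> complex \<Rightarrow> complex \<Rightarrow> complex \<Rightarrow> complex \<Rightarrow> complex \<Rightarrow> complex" where
  "jac p0 p1 p2 q0 q1 q2 X Y = qform (p1 * q0 - p0 * q1) (2 * (p2 * q0 - p0 * q2)) (p2 * q1 - p1 * q2) X Y"

lemma complex_quadratic_root: "a \<noteq> 0 \<Longrightarrow> \<exists>x. qform c b a x 1 = 0"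
proof
  assume a: "a \<noteq> 0"
  define s where "s = csqrt (b\<^sup>2 - 4 * a * c)"
  have s: "s\<^sup>2 = b\<^sup>2 - 4 * a * c" by (simp add: s_def)
  have "4 * a * qform c b a ((s - b) / (2 * a)) 1 = 4 * a * c - b\<^sup>2 + s\<^sup>2"
    using a by (simp add: qform_def power2_eq_square field_simps)
  then show "qform c b a ((s - b) / (2 * a)) 1 = 0" unfolding s using a by simp
qed

lemma qform_add:
  "qform c0 c1 c2 (A * X + B * Y) (C * X + D * Y) =
     qform c0 c1 c2 A C * X\<^sup>2 + (2 * c2 * A * B + c1 * (A * D + C * B) + 2 * c0 * C * D) * (X * Y)
     + qform c0 c1 c2 B D * Y\<^sup>2"
  by (simp add: qform_def expand)

lemma rat_scalar:
  assumes "(A, C) \<noteq> (0, 0)" "A \<in> \<rat>" "C \<in> \<rat>" "k * A \<in> \<rat>" "k * C \<in> \<rat>"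
  shows "(k::complex) \<in> \<rat>"
proof (cases "A = 0")
  case True
  then have "k = (k * C) / C" using assms by simp
  then show ?thesis using assms by (metis Rats_divide)
next
  case False
  then have "k = (k * A) / A" by simp
  then show ?thesis using assms by (metis Rats_divide)
qed

text \<open>The map f is abstract so that a conjugate by a translation, which is given as a
  composition, is again an instance.\<close>

locale quad_map =
  fixes f :: "complex option \<Rightarrow> complex option" and p0 p1 p2 q0 q1 q2 :: complex
  assumes rat: "p0 \<in> \<rat>" "p1 \<in> \<rat>" "p2 \<in> \<rat>" "q0 \<in> \<rat>" "q1 \<in> \<rat>" "q2 \<in> \<rat>"
    and nz: "(X, Y) \<noteq> (0, 0) \<Longrightarrow> (qform p0 p1 p2 X Y, qform q0 q1 q2 X Y) \<noteq> (0, 0)"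
    and f_proj: "(X, Y) \<noteq> (0, 0) \<Longrightarrow> f (proj X Y) = proj (qform p0 p1 p2 X Y) (qform q0 q1 q2 X Y)"
begin

abbreviation "Fp \<equiv> qform p0 p1 p2"
abbreviation "Fq \<equiv> qform q0 q1 q2"
abbreviation "W \<equiv> jac p0 p1 p2 q0 q1 q2"

lemma qform_rat: "X \<in> \<rat> \<Longrightarrow> Y \<in> \<rat> \<Longrightarrow> Fp X Y \<in> \<rat>" "X \<in> \<rat> \<Longrightarrow> Y \<in> \<rat> \<Longrightarrow> Fq X Y \<in> \<rat>"
  using rat by (auto simp: qform_def)

text \<open>If all minors vanish, the two forms are proportional, and a root of one over the complex
  numbers is a common zero.\<close>

lemma minors: "\<not> (p1 * q0 = p0 * q1 \<and> p2 * q0 = p0 * q2 \<and> p2 * q1 = p1 * q2)"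
proof
  assume m: "p1 * q0 = p0 * q1 \<and> p2 * q0 = p0 * q2 \<and> p2 * q1 = p1 * q2"
  show False
  proof (cases "q2 = 0")
    case True
    then have "p2 \<noteq> 0" using nz[of 1 0] by (auto simp: qform_def)
    moreover from this have "q0 = 0" "q1 = 0" using m True by auto
    moreover obtain x where "Fp x 1 = 0" using complex_quadratic_root \<open>p2 \<noteq> 0\<close> by blast
    ultimately show False using nz[of x 1] True by (simp add: qform_def)
  next
    case False
    obtain x where x: "Fq x 1 = 0" using complex_quadratic_root False by blast
    have "q2 * Fp x 1 = (q2 * p0) + (q2 * p1) * x + p2 * (q2 * x\<^sup>2)" by (simp add: qform_def expand)
    also have "\<dots> = p2 * Fq x 1"
      using m by (simp add: qform_def algebra_simps)
    finally show False using nz[of x 1] x False by simp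
  qed
qed

text \<open>The columns of the matrix are \<open>(A, C)\<close>, the image of \<open>(B, D)\<close>
  under the forms, and \<open>(B, D)\<close> itself, so 0 goes to the critical point and infinity to
  its image. Periodicity makes the coefficient of \<open>X^2\<close> a multiple of
  \<open>(B, D)\<close>, and criticality makes that of \<open>X * Y\<close> a multiple of
  \<open>(A, C)\<close>.\<close>

lemma normal_form_at_rational:
  assumes BD: "B \<in> \<rat>" "D \<in> \<rat>" "(B, D) \<noteq> (0, 0)" and crit: "W B D = 0"
    and per: "f (f (proj B D)) = proj B D" "f (proj B D) \<noteq> proj B D"
  obtains A C l \<mu> where "A \<in> \<rat>" "C \<in> \<rat>" "A * D - B * C \<noteq> 0" "l \<in> \<rat>" "\<mu> \<in> \<rat>" "\<mu> \<noteq> 0"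
    "\<And>X Y. (X, Y) \<noteq> (0, 0) \<Longrightarrow> f (mobius A B C D (proj X Y)) = mobius A B C D (proj (l * X * Y + Y\<^sup>2) (\<mu> * X\<^sup>2))"
proof -
  define A where "A = Fp B D"
  define C where "C = Fq B D"
  have AC: "A \<in> \<rat>" "C \<in> \<rat>" "(A, C) \<noteq> (0, 0)" unfolding A_def C_def using qform_rat BD nz[OF BD(3)] by auto
  have f1: "f (proj B D) = proj A C" unfolding A_def C_def by (rule f_proj[OF BD(3)])
  have det: "A * D - B * C \<noteq> 0"
    using per(2) unfolding f1 using proj_eq_iff[OF AC(3) BD(3)] by simp
  have "proj (Fp A C) (Fq A C) = proj B D" using per(1) unfolding f1 f_proj[OF AC(3)] .
  then obtain \<mu> where l: "\<mu> \<noteq> 0" "Fp A C = \<mu> * B" "Fq A C = \<mu> * D"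
    using proj_eqE nz[OF AC(3)] BD(3) by blast
  have "\<mu> \<in> \<rat>" using rat_scalar[OF BD(3,1,2)] qform_rat AC l by metis
  define Lp where "Lp = 2 * p2 * A * B + p1 * (A * D + C * B) + 2 * p0 * C * D"
  define Lq where "Lq = 2 * q2 * A * B + q1 * (A * D + C * B) + 2 * q0 * C * D"
  have L: "Lp \<in> \<rat>" "Lq \<in> \<rat>" unfolding Lp_def Lq_def using rat AC BD by auto
  \<comment> \<open>The Wronskian at the point measures the failure of \<open>(Lp, Lq)\<close> to be
    parallel to \<open>(A, C)\<close>.\<close>
  have "Fp B D * Lq - Fq B D * Lp = - W B D * (A * D - B * C)"
    unfolding Lp_def Lq_def qform_def jac_def by (simp add: expand)
  then have ALq: "A * Lq = C * Lp" unfolding crit A_def[symmetric] C_def[symmetric] by simp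
  have "\<exists>k. Lp = k * A \<and> Lq = k * C"
  proof (cases "A = 0")
    case True
    then have "C \<noteq> 0" "Lp = 0" using AC ALq by auto
    then show ?thesis using True by (intro exI[of _ "Lq / C"]) simp
  next
    case False
    then show ?thesis using ALq by (intro exI[of _ "Lp / A"]) (simp add: field_simps)
  qed
  then obtain k where k: "Lp = k * A" "Lq = k * C" by blast
  have "k \<in> \<rat>" using rat_scalar[OF AC(3,1,2)] L k by metis
  have "f (mobius A B C D (proj X Y)) = mobius A B C D (proj (k * X * Y + Y\<^sup>2) (\<mu> * X\<^sup>2))"
    if XY: "(X, Y) \<noteq> (0, 0)" for X Y
  proof -
    have nz2: "(k * X * Y + Y\<^sup>2, \<mu> * X\<^sup>2) \<noteq> (0, 0)" using XY l(1) by auto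
    have "Fp (A * X + B * Y) (C * X + D * Y) = A * (k * X * Y + Y\<^sup>2) + B * (\<mu> * X\<^sup>2)"
      unfolding qform_add Lp_def[symmetric] k l A_def[symmetric] by (simp add: algebra_simps)
    moreover have "Fq (A * X + B * Y) (C * X + D * Y) = C * (k * X * Y + Y\<^sup>2) + D * (\<mu> * X\<^sup>2)"
      unfolding qform_add Lq_def[symmetric] k l C_def[symmetric] by (simp add: algebra_simps)
    ultimately show ?thesis
      unfolding mobius_proj[OF det XY] mobius_proj[OF det nz2] f_proj[OF mobius_nz[OF det XY]] by simp
  qed
  then show thesis using that AC(1,2) det \<open>k \<in> \<rat>\<close> \<open>\<mu> \<in> \<rat>\<close> l(1) by blast
qed

lemma translate:
  assumes r: "r \<in> \<rat>"
  shows "quad_map (\<lambda>P. mobius 1 (- r) 0 1 (f (mobius 1 r 0 1 P)))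
    (Fp r 1 - r * Fq r 1) (p1 + 2 * r * p2 - r * (q1 + 2 * r * q2)) (p2 - r * q2)
    (Fq r 1) (q1 + 2 * r * q2) q2"
proof
  have e: "qform (Fp r 1 - r * Fq r 1) (p1 + 2 * r * p2 - r * (q1 + 2 * r * q2)) (p2 - r * q2) X Y
      = Fp (X + r * Y) Y - r * Fq (X + r * Y) Y"
    "qform (Fq r 1) (q1 + 2 * r * q2) q2 X Y = Fq (X + r * Y) Y" for X Y
    by (simp_all add: qform_def expand)
  fix X Y :: complex assume XY: "(X, Y) \<noteq> (0, 0)"
  then have XY': "(X + r * Y, Y) \<noteq> (0, 0)" by auto
  show "(qform (Fp r 1 - r * Fq r 1) (p1 + 2 * r * p2 - r * (q1 + 2 * r * q2)) (p2 - r * q2) X Y,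
      qform (Fq r 1) (q1 + 2 * r * q2) q2 X Y) \<noteq> (0, 0)"
    unfolding e using nz[OF XY'] by auto
  show "mobius 1 (- r) 0 1 (f (mobius 1 r 0 1 (proj X Y))) =
    proj (qform (Fp r 1 - r * Fq r 1) (p1 + 2 * r * p2 - r * (q1 + 2 * r * q2)) (p2 - r * q2) X Y)
      (qform (Fq r 1) (q1 + 2 * r * q2) q2 X Y)"
    unfolding e using mobius_proj[of 1 1 r 0, OF _ XY] f_proj[OF XY'] mobius_proj[of 1 1 "- r" 0, OF _ nz[OF XY']]
    by simp
qed (use rat r qform_rat in auto)

lemma jac_translate:
  "jac (Fp r 1 - r * Fq r 1) (p1 + 2 * r * p2 - r * (q1 + 2 * r * q2)) (p2 - r * q2)
    (Fq r 1) (q1 + 2 * r * q2) q2 X Y = W (X + r * Y) Y"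
  by (simp add: qform_def jac_def expand)

text \<open>All equations live in \<rat>(s) and split into two rational ones by
  \<open>indep\<close>. The image of s is \<open>y = e + g * s\<close>; returning to s after two
  steps leaves only e = 0 and g = -1, so s is swapped with its conjugate -s, and the coefficients
  follow.\<close>

lemma irrational_critical_form:
  assumes s: "s\<^sup>2 = d" "d \<in> \<rat>" "s \<notin> \<rat>" and crit: "W s 1 = 0"
    and per: "f (f (proj s 1)) = proj s 1" "f (proj s 1) \<noteq> proj s 1"
  shows "p0 = d * p2" "q0 = d * q2" "p1 = - 2 * d * q2" "q1 = - 2 * p2"
proof -
  have indep: "x = 0 \<and> y = 0" if "x + y * s = 0" "x \<in> \<rat>" "y \<in> \<rat>" for x y
  proof -
    have "y = 0"
    proof (rule ccontr)
      assume "y \<noteq> 0"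
      moreover have "s * y = - x" using that(1) by (simp add: eq_neg_iff_add_eq_0 algebra_simps)
      ultimately have "s = - x / y" by (metis nonzero_eq_divide_eq)
      then show False using s(3) that(2,3) by auto
    qed
    then show ?thesis using that(1) by simp
  qed
  have "((p1 * q0 - p0 * q1) + (p2 * q1 - p1 * q2) * d) + (2 * (p2 * q0 - p0 * q2)) * s = 0"
    using crit unfolding jac_def qform_def s(1) by (simp add: algebra_simps)
  then have w: "(p1 * q0 - p0 * q1) + (p2 * q1 - p1 * q2) * d = 0 \<and> 2 * (p2 * q0 - p0 * q2) = 0"
    by (rule indep) (use rat s(2) in auto)
  \<comment> \<open>If u or u' were nonzero, the relations \<open>uu\<close> would make the two
    forms proportional. Their vanishing makes -s critical as well.\<close>
  define u where "u = p0 - d * p2"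
  define u' where "u' = q0 - d * q2"
  have uu: "p0 * u' = q0 * u" "p1 * u' = q1 * u" "p2 * u' = q2 * u"
    using w unfolding u_def u'_def by (simp_all add: algebra_simps)
  have "u = 0 \<and> u' = 0"
  proof (rule ccontr)
    assume "\<not> (u = 0 \<and> u' = 0)"
    then consider "u' \<noteq> 0" | "u \<noteq> 0" by blast
    then show False
    proof cases
      case 1
      then have "p0 = q0 * (u / u')" "p1 = q1 * (u / u')" "p2 = q2 * (u / u')"
        using uu by (simp_all add: nonzero_eq_divide_eq)
      then have "p1 * q0 = p0 * q1 \<and> p2 * q0 = p0 * q2 \<and> p2 * q1 = p1 * q2" by simp
      then show False using minors by blast
    next
      case 2
      then have "q0 = p0 * (u' / u)" "q1 = p1 * (u' / u)" "q2 = p2 * (u' / u)"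
        using uu by (simp_all add: nonzero_eq_divide_eq)
      then have "p1 * q0 = p0 * q1 \<and> p2 * q0 = p0 * q2 \<and> p2 * q1 = p1 * q2" by simp
      then show False using minors by blast
    qed
  qed
  then show p0: "p0 = d * p2" and q0: "q0 = d * q2" unfolding u_def u'_def by auto
  define \<alpha> where "\<alpha> = p2"
  define \<beta> where "\<beta> = p1 / 2"
  define \<gamma> where "\<gamma> = q2"
  define \<delta> where "\<delta> = q1 / 2"
  have R: "\<alpha> \<in> \<rat>" "\<beta> \<in> \<rat>" "\<gamma> \<in> \<rat>" "\<delta> \<in> \<rat>" unfolding \<alpha>_def \<beta>_def \<gamma>_def \<delta>_def using rat by auto
  have Fp_eq: "Fp X Y = \<alpha> * (X\<^sup>2 + d * Y\<^sup>2) + 2 * \<beta> * (X * Y)"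
    and Fq_eq: "Fq X Y = \<gamma> * (X\<^sup>2 + d * Y\<^sup>2) + 2 * \<delta> * (X * Y)" for X Y
    unfolding qform_def p0 q0 \<alpha>_def \<beta>_def \<gamma>_def \<delta>_def by (simp_all add: algebra_simps)
  have gd: "\<not> (\<gamma> = 0 \<and> \<delta> = 0)"
    using minors unfolding \<gamma>_def \<delta>_def p0 q0 by auto
  have den: "\<delta> + \<gamma> * s \<noteq> 0" using indep[of \<delta> \<gamma>] R gd by blast
  have den': "\<delta> + (- \<gamma>) * s \<noteq> 0" using indep[of \<delta> "- \<gamma>"] R gd by auto
  define n where "n = \<delta>\<^sup>2 - \<gamma>\<^sup>2 * d"
  have n: "(\<delta> + \<gamma> * s) * (\<delta> + (- \<gamma>) * s) = n" unfolding n_def s(1)[symmetric] by (simp add: expand)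
  then have n0: "n \<noteq> 0" using den den' by auto
  \<comment> \<open>The rational coordinates of
    \<open>y = (\<beta> + \<alpha> * s) / (\<delta> + \<gamma> * s)\<close>, obtained by multiplying
    with the conjugate of the denominator.\<close>
  define e where "e = (\<beta> * \<delta> - \<alpha> * \<gamma> * d) / n"
  define g where "g = (\<alpha> * \<delta> - \<beta> * \<gamma>) / n"
  have eg: "e \<in> \<rat>" "g \<in> \<rat>" "n \<in> \<rat>" unfolding e_def g_def n_def using R s(2) by auto
  define y where "y = e + g * s"
  have yden: "y * (\<delta> + \<gamma> * s) = \<beta> + \<alpha> * s"
  proof -
    have "n * y = (\<beta> + \<alpha> * s) * (\<delta> + (- \<gamma>) * s)"
      unfolding y_def e_def g_def using n0 by (simp add: distrib_left) (simp add: expand flip: s(1))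
    then have "n * y * (\<delta> + \<gamma> * s) = (\<beta> + \<alpha> * s) * n" unfolding n[symmetric] by (simp only: mult_ac)
    then show ?thesis using n0 by simp
  qed
  have s0: "s \<noteq> 0" using s by auto
  have fs: "f (proj s 1) = proj y 1"
  proof -
    have "Fp s 1 = (2 * s) * (\<beta> + \<alpha> * s)" "Fq s 1 = (2 * s) * (\<delta> + \<gamma> * s)"
      unfolding Fp_eq Fq_eq s(1)[symmetric] by (simp_all add: expand)
    then have "f (proj s 1) = proj (\<beta> + \<alpha> * s) (\<delta> + \<gamma> * s)"
      using f_proj[of s 1] s0 by (simp add: proj_scale)
    also have "\<dots> = proj y 1"
      unfolding yden[symmetric] using proj_scale[OF den, of y 1] by (simp add: mult.commute)
    finally show ?thesis .
  qed
  have y1: "y \<noteq> s" using per(2) fs by auto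
  have "proj (Fp y 1) (Fq y 1) = proj s 1" using per(1) fs f_proj[of y 1] by simp
  then have ys: "Fp y 1 = s * Fq y 1" using proj_eq_iff[OF nz[of y 1], of s 1] by simp
  \<comment> \<open>A rational y could not be mapped to the irrational s.\<close>
  have g0: "g \<noteq> 0"
  proof
    assume "g = 0"
    then have yr: "y \<in> \<rat>" using eg y_def by simp
    have "Fp y 1 + (- Fq y 1) * s = 0" using ys by (simp add: mult.commute)
    then have "Fp y 1 = 0 \<and> - Fq y 1 = 0" by (rule indep) (use qform_rat yr in auto)
    then show False using nz[of y 1] by simp
  qed
  have b: "\<beta> = e * \<delta> + g * \<gamma> * d" and a: "\<alpha> = e * \<gamma> + g * \<delta>"
  proof -
    have "(e * \<delta> + g * \<gamma> * d - \<beta>) + (e * \<gamma> + g * \<delta> - \<alpha>) * s = 0"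
      using yden unfolding y_def s(1)[symmetric] by (simp add: expand)
    then have "e * \<delta> + g * \<gamma> * d - \<beta> = 0 \<and> e * \<gamma> + g * \<delta> - \<alpha> = 0"
      by (rule indep) (use R eg s(2) in auto)
    then show "\<beta> = e * \<delta> + g * \<gamma> * d" "\<alpha> = e * \<gamma> + g * \<delta>" by simp_all
  qed
  define U where "U = e\<^sup>2 + g\<^sup>2 * d + d"
  have "(\<alpha> * U + 2 * \<beta> * e - \<gamma> * (2 * e * g) * d - 2 * \<delta> * g * d)
      + (\<alpha> * (2 * e * g) + 2 * \<beta> * g - \<gamma> * U - 2 * \<delta> * e) * s = 0"
    using ys unfolding Fp_eq Fq_eq y_def U_def s(1)[symmetric] by (simp add: expand)
  then have "\<alpha> * U + 2 * \<beta> * e - \<gamma> * (2 * e * g) * d - 2 * \<delta> * g * d = 0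
      \<and> \<alpha> * (2 * e * g) + 2 * \<beta> * g - \<gamma> * U - 2 * \<delta> * e = 0"
    by (rule indep) (use R eg s(2) in \<open>auto simp: U_def\<close>)
  then have E1: "\<gamma> * (e * U) + \<delta> * (g * U + 2 * e\<^sup>2 - 2 * g * d) = 0"
    and E2: "\<gamma> * (2 * e\<^sup>2 * g + 2 * g\<^sup>2 * d - U) + \<delta> * (2 * e * (g\<^sup>2 + g - 1)) = 0"
    unfolding a b by (simp_all add: expand)
  \<comment> \<open>E1 and E2 are linear and homogeneous in \<open>(\<gamma>, \<delta>)\<close>,
    which is nonzero, so their determinant vanishes. It factors as shown below, and the two
    nontrivial factors correspond to y = s and y = -s, because d is not a rational square.\<close>
  have "(g * U + 2 * e\<^sup>2 - 2 * g * d) * (2 * e\<^sup>2 * g + 2 * g\<^sup>2 * d - U) - (e * U) * (2 * e * (g\<^sup>2 + g - 1)) = 0"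
    using E1 E2 gd by algebra
  moreover have "(g * U + 2 * e\<^sup>2 - 2 * g * d) * (2 * e\<^sup>2 * g + 2 * g\<^sup>2 * d - U) - (e * U) * (2 * e * (g\<^sup>2 + g - 1))
      = g * (e\<^sup>2 - (g - 1)\<^sup>2 * d) * (e\<^sup>2 - (g + 1)\<^sup>2 * d)"
    unfolding U_def by algebra
  ultimately have "e\<^sup>2 = (g - 1)\<^sup>2 * d \<or> e\<^sup>2 = (g + 1)\<^sup>2 * d" using g0 by auto
  moreover have sq: "e = 0 \<and> k = 0" if "e\<^sup>2 = k\<^sup>2 * d" "k \<in> \<rat>" for k
  proof -
    have "k = 0"
    proof (rule ccontr)
      assume k: "k \<noteq> 0"
      have "e\<^sup>2 = (k * s)\<^sup>2" using that(1) s(1) by (simp add: power_mult_distrib)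
      then have "e = k * s \<or> e = - (k * s)" by (simp only: power2_eq_iff)
      then have "s = e / k \<or> s = - e / k" using k by auto
      then show False using s(3) eg(1) that(2) by auto
    qed
    then show ?thesis using that(1) by simp
  qed
  ultimately have "e = 0 \<and> (g = 1 \<or> g = - 1)"
    using sq[of "g - 1"] sq[of "g + 1"] eg(2) by (auto simp: eq_neg_iff_add_eq_0)
  moreover have "\<not> (e = 0 \<and> g = 1)" using y1 unfolding y_def by auto
  ultimately have "e = 0" "g = - 1" by auto
  then have "\<beta> = - \<gamma> * d" "\<alpha> = - \<delta>" using a b by auto
  then show "p1 = - 2 * d * q2" "q1 = - 2 * p2" unfolding \<alpha>_def \<beta>_def \<gamma>_def \<delta>_def by (simp_all add: field_simps)
qed

end

section \<open>From rational functions and ramification to quadratic forms\<close>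

lemma coprime_no_common_root:
  assumes q: "q \<noteq> 0" and cop: "coprime p q" and root: "poly (cpoly p) x = 0" "poly (cpoly q) x = 0"
  shows False
proof -
  have hom: "cpoly (g + h) = cpoly g + cpoly h" "cpoly (g * h) = cpoly g * cpoly h" for g h
    by (rule poly_eqI, simp add: cpoly_def coeff_map_poly coeff_mult of_rat_add of_rat_mult of_rat_sum)+
  \<comment> \<open>f plays the part of the minimal polynomial of x over \<rat>: least degree makes
    it divide every rational polynomial vanishing at x, so coprimality turns it into a
    constant.\<close>
  obtain f where f: "f \<noteq> 0" "poly (cpoly f) x = 0"
    and least: "\<And>g. g \<noteq> 0 \<Longrightarrow> poly (cpoly g) x = 0 \<Longrightarrow> degree f \<le> degree g"
    using ex_has_least_nat[of "\<lambda>f. f \<noteq> 0 \<and> poly (cpoly f) x = 0" q degree] q root(2) by blast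
  have dvd: "f dvd h" if "poly (cpoly h) x = 0" for h
  proof -
    have "cpoly h = cpoly (h div f) * cpoly f + cpoly (h mod f)"
      by (simp flip: hom)
    then have "poly (cpoly (h mod f)) x = 0" using that f(2) by simp
    then have "h mod f = 0" using least[of "h mod f"] degree_mod_less[OF f(1), of h] by force
    then show ?thesis by (simp add: mod_eq_0_iff_dvd)
  qed
  have "is_unit f" using dvd[OF root(1)] dvd[OF root(2)] cop by (meson coprime_common_divisor)
  then obtain c where "f = [:c:]" by (auto simp: is_unit_poly_iff)
  then show False using f by (simp add: cpoly_def map_poly_pCons)
qed

lemma degree_le_2_eq:
  fixes h :: "'a::zero poly"
  assumes "degree h \<le> 2" shows "h = [:coeff h 0, coeff h 1, coeff h 2:]"
proof (rule poly_eqI)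
  fix i
  have "i = 0 \<or> i = 1 \<or> i = 2 \<or> degree h < i" using assms by auto
  then show "coeff h i = coeff [:coeff h 0, coeff h 1, coeff h 2:] i"
    by (auto simp: coeff_pCons coeff_eq_0 numeral_2_eq_2 split: nat.split)
qed

lemma rf_apply_proj:
  assumes "(p2, q2) \<noteq> (0, 0)" "(X, Y) \<noteq> (0, 0)"
  shows "rf_apply [:p0, p1, p2:] [:q0, q1, q2:] (proj X Y) = proj (qform p0 p1 p2 X Y) (qform q0 q1 q2 X Y)"
proof (cases "Y = 0")
  case True
  then have "X \<noteq> 0" using assms by simp
  then show ?thesis using True assms(1) by (auto simp: rf_apply_def proj_def qform_def)
next
  case False
  have "poly [:c0, c1, c2:] (X / Y) = qform c0 c1 c2 X Y / Y\<^sup>2" for c0 c1 c2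
    using False by (simp add: qform_def power2_eq_square field_simps)
  then show ?thesis using False by (simp add: rf_apply_def proj_def del: poly_pCons)
qed

lemma order_gt_1_imp:
  assumes "Polynomial.order x h > 1"
  shows "poly h x = 0" "poly (pderiv h) x = 0"
proof -
  have "[:- x, 1:] ^ 2 dvd h"
    using dvd_trans[OF le_imp_power_dvd order_1[of x h], of 2] assms by simp
  then obtain k where h: "h = [:- x, 1:] ^ 2 * k" by (elim dvdE)
  define u where "u = [:- x, 1:]"
  have "poly u x = 0" "h = u * u * k" unfolding u_def h by (simp_all only: power2_eq_square) simp
  then show "poly h x = 0" "poly (pderiv h) x = 0" by (simp_all add: pderiv_mult)
qed

text \<open>Ramification at x means that p - c q has a double zero, so p = c q and p' = c q' there
  and the Wronskian vanishes; at a pole q and q' vanish. At infinity it means that p - c q, or q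
  when the value is infinite, drops to degree 0.\<close>

lemma critical_imp_jac:
  assumes crit: "critical_point [:p0, p1, p2:] [:q0, q1, q2:] P" and "(p2, q2) \<noteq> (0, 0)"
  shows "case P of Some x \<Rightarrow> jac p0 p1 p2 q0 q1 q2 x 1 = 0 | None \<Rightarrow> jac p0 p1 p2 q0 q1 q2 1 0 = 0"
proof (cases P)
  case (Some x)
  have jac: "jac p0 p1 p2 q0 q1 q2 x 1 = (p1 + 2 * p2 * x) * (q0 + q1 * x + q2 * x\<^sup>2)
      - (p0 + p1 * x + p2 * x\<^sup>2) * (q1 + 2 * q2 * x)"
    by (simp add: jac_def qform_def expand)
  show ?thesis
  proof (cases "poly [:q0, q1, q2:] x = 0")
    case True
    then have "Polynomial.order x [:q0, q1, q2:] > 1"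
      using crit Some by (simp add: critical_point_def ram_index_def rf_apply_def)
    note o = order_gt_1_imp[OF this]
    then have "q0 + q1 * x + q2 * x\<^sup>2 = 0" "q1 + 2 * q2 * x = 0"
      by (simp_all add: pderiv_pCons expand)
    then show ?thesis using Some jac by simp
  next
    case False
    define c where "c = poly [:p0, p1, p2:] x / poly [:q0, q1, q2:] x"
    have "Polynomial.order x ([:p0, p1, p2:] - smult c [:q0, q1, q2:]) > 1"
      using crit Some False by (simp add: critical_point_def ram_index_def rf_apply_def c_def)
    note o = order_gt_1_imp[OF this]
    then have "p0 + p1 * x + p2 * x\<^sup>2 = c * (q0 + q1 * x + q2 * x\<^sup>2)" "p1 + 2 * p2 * x = c * (q1 + 2 * q2 * x)"
      by (simp_all add: pderiv_pCons expand)
    then show ?thesis using Some jac by simp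
  qed
next
  case None
  let ?p = "[:p0, p1, p2:]" and ?q = "[:q0, q1, q2:]"
  have deg: "rf_degree ?p ?q = 2" "degree ?p \<le> 2" using assms(2) by (auto simp: rf_degree_def)
  have jac: "jac p0 p1 p2 q0 q1 q2 1 0 = p2 * q1 - p1 * q2" by (simp add: jac_def qform_def)
  show ?thesis
  proof (cases "rf_apply ?p ?q None")
    case None
    then have "degree ?p - degree ?q > 1"
      using crit \<open>P = None\<close> by (simp add: critical_point_def ram_index_def)
    then have "degree ?q = 0" using deg by linarith
    then have "q1 = 0" "q2 = 0" by (auto split: if_splits)
    then show ?thesis using \<open>P = None\<close> jac by simp
  next
    case (Some c)
    then have "2 - degree (?p - smult c ?q) > 1"
      using crit \<open>P = None\<close> deg(1) by (simp add: critical_point_def ram_index_def)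
    then have d: "degree (?p - smult c ?q) = 0" by linarith
    then have "p1 = c * q1" "p2 = c * q2" by (simp_all split: if_splits)
    then show ?thesis using \<open>P = None\<close> jac by simp
  qed
qed

text \<open>The automorphisms needed have entries that are \<rat>-linear in 1 and a single algebraic
  number t. Such entries stay in this span under multiplication by rational matrices, and
  \<open>algebraic_affine\<close> shows that they are algebraic.\<close>

definition rat_span :: "complex \<Rightarrow> complex set" where
  "rat_span t = {x + y * t | x y. x \<in> \<rat> \<and> y \<in> \<rat>}"

lemma rat_spanI: "x \<in> \<rat> \<Longrightarrow> y \<in> \<rat> \<Longrightarrow> x + y * t \<in> rat_span t"
  unfolding rat_span_def by blast

lemma rat_spanE:
  assumes "z \<in> rat_span t"
  obtains x y where "x \<in> \<rat>" "y \<in> \<rat>" "z = x + y * t"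
  using assms unfolding rat_span_def by auto

lemma rat_span_simps: "r \<in> \<rat> \<Longrightarrow> r \<in> rat_span t" "r \<in> \<rat> \<Longrightarrow> r * t \<in> rat_span t" "t \<in> rat_span t"
  using rat_spanI[of r 0 t] rat_spanI[of 0 r t] rat_spanI[of 0 1 t] by simp_all

lemma rat_span_add:
  assumes "z \<in> rat_span t" "z' \<in> rat_span t" shows "z + z' \<in> rat_span t"
proof -
  obtain x y where z: "x \<in> \<rat>" "y \<in> \<rat>" "z = x + y * t" using assms(1) by (rule rat_spanE)
  obtain x' y' where z': "x' \<in> \<rat>" "y' \<in> \<rat>" "z' = x' + y' * t" using assms(2) by (rule rat_spanE)
  have "z + z' = (x + x') + (y + y') * t" using z z' by (simp add: algebra_simps)
  moreover have "(x + x') + (y + y') * t \<in> rat_span t" using z z' by (intro rat_spanI Rats_add)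
  ultimately show ?thesis by simp
qed

lemma rat_span_mult:
  assumes "r \<in> \<rat>" "z \<in> rat_span t" shows "r * z \<in> rat_span t" "z * r \<in> rat_span t"
proof -
  obtain x y where z: "x \<in> \<rat>" "y \<in> \<rat>" "z = x + y * t" using assms(2) by (rule rat_spanE)
  have "r * z = r * x + (r * y) * t" using z by (simp add: algebra_simps)
  moreover have "r * x + (r * y) * t \<in> rat_span t" using z assms(1) by (intro rat_spanI Rats_mult)
  ultimately show "r * z \<in> rat_span t" by simp
  then show "z * r \<in> rat_span t" by (simp add: mult.commute)
qed

lemma rat_span_algebraic:
  assumes "algebraic t" "z \<in> rat_span t" shows "algebraic z"
proof -
  obtain x y where z: "x \<in> \<rat>" "y \<in> \<rat>" "z = x + y * t" using assms(2) by (rule rat_spanE)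
  then show ?thesis using algebraic_affine[OF assms(1), of y x] by (simp add: add.commute)
qed

text \<open>If M conjugates the map to g and N commutes with g, then M N M^-1 is an automorphism of
  the original map. The adjugate serves as the inverse of M, so no division disturbs the span of the
  entries.\<close>

lemma Aut_set_nontrivial:
  assumes M: "a \<in> \<rat>" "b \<in> \<rat>" "c \<in> \<rat>" "d \<in> \<rat>" "a * d - b * c \<noteq> 0"
    and conj: "\<And>P. rf_apply p q (mobius a b c d P) = mobius a b c d (g P)"
    and t: "algebraic t" and E: "a' \<in> rat_span t" "b' \<in> rat_span t" "c' \<in> rat_span t" "d' \<in> rat_span t"
    and N: "a' * d' - b' * c' \<noteq> 0"
    and comm: "\<And>P. g (mobius a' b' c' d' P) = mobius a' b' c' d' (g P)"
    and nontriv: "mobius a' b' c' d' R \<noteq> R"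
  shows "Aut_set p q \<noteq> {id}"
proof -
  let ?m = "mobius a b c d" and ?n = "mobius d (- b) (- c) a" and ?N = "mobius a' b' c' d'"
  define A B C D where "A = a * a' + b * c'" and "B = a * b' + b * d'" and "C = c * a' + d * c'" and "D = c * b' + d * d'"
  have inE: "A \<in> rat_span t" "B \<in> rat_span t" "C \<in> rat_span t" "D \<in> rat_span t"
    unfolding A_def B_def C_def D_def using E M(1-4) by (simp_all add: rat_span_add rat_span_mult)
  have nM: "- b \<in> \<rat>" "- c \<in> \<rat>" using M(2,3) by simp_all
  define A' B' C' D' where "A' = A * d + B * - c" and "B' = A * - b + B * a"
    and "C' = C * d + D * - c" and "D' = C * - b + D * a"
  have inE': "A' \<in> rat_span t" "B' \<in> rat_span t" "C' \<in> rat_span t" "D' \<in> rat_span t"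
    unfolding A'_def B'_def C'_def D'_def using inE M(1-4) nM
    by (simp_all only: rat_span_add rat_span_mult)
  have detn: "d * a - (- b) * (- c) \<noteq> 0" using M(5) by (simp add: algebra_simps)
  have "A * D - B * C = (a * d - b * c) * (a' * d' - b' * c')"
    unfolding A_def B_def C_def D_def by (simp add: algebra_simps)
  then have det1: "A * D - B * C \<noteq> 0" using M(5) N by simp
  have "A' * D' - B' * C' = (A * D - B * C) * (a * d - b * c)"
    unfolding A'_def B'_def C'_def D'_def by (simp add: algebra_simps)
  then have det2: "A' * D' - B' * C' \<noteq> 0" using M(5) det1 by simp
  have \<sigma>: "mobius A' B' C' D' P = ?m (?N (?n P))" for P
    unfolding mobius_comp[OF M(5) N] A_def[symmetric] B_def[symmetric] C_def[symmetric] D_def[symmetric]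
      mobius_comp[OF det1 detn] A'_def B'_def C'_def D'_def ..
  note inv = mobius_inverse[OF M(5)]
  have "rf_apply p q (mobius A' B' C' D' P) = mobius A' B' C' D' (rf_apply p q P)" for P
  proof -
    have "?n (rf_apply p q P) = g (?n P)" using conj[of "?n P"] inv by metis
    then show ?thesis unfolding \<sigma> conj comm by simp
  qed
  then have "mobius A' B' C' D' \<in> Aut_set p q"
    unfolding Aut_set_def using conj_iff[OF det2] det2 inE'[THEN rat_span_algebraic[OF t]] by blast
  moreover have "mobius A' B' C' D' (?m R) \<noteq> ?m R"
    unfolding \<sigma> inv using nontriv inv(1) by metis
  ultimately show ?thesis by (metis id_apply singletonD)
qed

section \<open>Reduction to the normal form\<close>

lemma phi_v_proj:
  assumes "v \<noteq> 0" "(X, Y) \<noteq> (0, 0)"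
  shows "rf_apply (cpoly (phi_v_num v)) (cpoly phi_v_den) (proj X Y) = proj (of_rat v * (X * Y - Y\<^sup>2)) (X\<^sup>2)"
proof -
  have "cpoly (phi_v_num v) = [:- of_rat v, of_rat v, 0:]" "cpoly phi_v_den = [:0, 0, 1:]"
    by (simp_all add: cpoly_def phi_v_num_def phi_v_den_def map_poly_pCons of_rat_minus)
  then show ?thesis using rf_apply_proj[OF _ assms(2), of 0 1 "- of_rat v" "of_rat v" 0 0]
    by (simp add: qform_def algebra_simps)
qed

context quad_map
begin

lemma rational_critical_conj:
  assumes f: "f = rf_apply p q" and aut: "Aut_set p q = {id}"
    and BD: "B \<in> \<rat>" "D \<in> \<rat>" "(B, D) \<noteq> (0, 0)" and crit: "W B D = 0"
    and per: "f (f (proj B D)) = proj B D" "f (proj B D) \<noteq> proj B D"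
  shows "\<exists>v::rat. v \<noteq> 0 \<and> lin_conj_over \<rat> p q (cpoly (phi_v_num v)) (cpoly phi_v_den)"
proof -
  obtain A C l \<mu> where AC: "A \<in> \<rat>" "C \<in> \<rat>" "A * D - B * C \<noteq> 0" "l \<in> \<rat>" "\<mu> \<in> \<rat>" "\<mu> \<noteq> 0"
    and nf: "\<And>X Y. (X, Y) \<noteq> (0, 0) \<Longrightarrow> f (mobius A B C D (proj X Y)) = mobius A B C D (proj (l * X * Y + Y\<^sup>2) (\<mu> * X\<^sup>2))"
    by (rule normal_form_at_rational[OF BD crit per]) (rule that; assumption)
  have l0: "l \<noteq> 0"
  proof
    \<comment> \<open>The map is then \<open>1 / (\<mu> * z^2)\<close>, which commutes with
      multiplication by \<omega>.\<close>
    assume l: "l = 0"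
    let ?m = "mobius A B C D" and ?n = "mobius D (- B) (- C) A"
    define g where "g P = ?n (f (?m P))" for P
    have g: "g (proj X Y) = proj (Y\<^sup>2) (\<mu> * X\<^sup>2)" if "(X, Y) \<noteq> (0, 0)" for X Y
      unfolding g_def nf[OF that] using l by (simp add: mobius_inverse[OF AC(3)])
    have "Aut_set p q \<noteq> {id}"
    proof (rule Aut_set_nontrivial[where g = g and t = \<omega> and a' = \<omega> and b' = 0 and c' = 0 and d' = 1 and R = "proj 1 1"])
      show "A \<in> \<rat>" "B \<in> \<rat>" "C \<in> \<rat>" "D \<in> \<rat>" "A * D - B * C \<noteq> 0" by fact+
      show "rf_apply p q (?m P) = ?m (g P)" for P
        unfolding g_def f by (simp add: mobius_inverse[OF AC(3)])
      show "algebraic \<omega>"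
      proof (rule algebraicI)
        show "coeff [:1, 1, 1 :: complex:] i \<in> \<int>" for i by (auto simp: coeff_pCons split: nat.split)
        show "poly [:1, 1, 1:] \<omega> = 0" using omega_mult(1) by (simp add: algebra_simps)
      qed simp
      show "\<omega> \<in> rat_span \<omega>" "0 \<in> rat_span \<omega>" "0 \<in> rat_span \<omega>" "1 \<in> rat_span \<omega>"
        by (simp_all add: rat_span_simps)
      show "\<omega> * 1 - 0 * 0 \<noteq> 0" by simp
      fix P
      obtain X Y where P: "P = proj X Y" "(X, Y) \<noteq> (0, 0)" by (rule proj_cases)
      have nz1: "(\<omega> * X, Y) \<noteq> (0, 0)" "(Y\<^sup>2, \<mu> * X\<^sup>2) \<noteq> (0, 0)" using P(2) AC(6) by auto
      have m: "mobius \<omega> 0 0 1 (proj X Y) = proj (\<omega> * X) Y" if "(X, Y) \<noteq> (0, 0)" for X Y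
        using mobius_proj[of \<omega> 1 0 0, OF _ that] by simp
      have "proj (Y\<^sup>2) (\<mu> * (\<omega> * X)\<^sup>2) = proj (\<omega> * Y\<^sup>2) (\<omega> * (\<mu> * (\<omega> * X)\<^sup>2))"
        by (rule proj_scale[symmetric]) simp
      also have "\<omega> * (\<mu> * (\<omega> * X)\<^sup>2) = \<omega> ^ 3 * (\<mu> * X\<^sup>2)" by (simp add: expand)
      finally show "g (mobius \<omega> 0 0 1 P) = mobius \<omega> 0 0 1 (g P)"
        unfolding P(1) m[OF P(2)] g[OF P(2)] g[OF nz1(1)] m[OF nz1(2)] by (simp add: omega_cube)
    next
      show "mobius \<omega> 0 0 1 (proj 1 1) \<noteq> proj 1 1"
        using mobius_proj[of \<omega> 1 0 0 1 1] by (simp add: proj_def)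
    qed
    then show False using aut by blast
  qed
  \<comment> \<open>Substituting z = s x with s = -1/l in \<open>(l * z + 1) / (\<mu> * z^2)\<close>
    gives \<open>v * (x - 1) / x^2\<close> with \<open>v = l^3 / \<mu>\<close>.\<close>
  define s where "s = - 1 / l"
  have s: "s \<in> \<rat>" "s \<noteq> 0" unfolding s_def using l0 AC(4) by auto
  have "l ^ 3 / \<mu> \<in> \<rat>" using AC by auto
  then obtain v :: rat where v: "l ^ 3 / \<mu> = of_rat v" by (elim Rats_cases)
  have v0: "v \<noteq> 0" using v l0 AC(6) by auto
  have det: "(s * A) * D - B * (s * C) \<noteq> 0"
  proof -
    have "(s * A) * D - B * (s * C) = s * (A * D - B * C)" by (simp add: algebra_simps)
    then show ?thesis using s AC(3) by simp
  qed
  have "rf_apply p q (mobius (s * A) B (s * C) D P)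
      = mobius (s * A) B (s * C) D (rf_apply (cpoly (phi_v_num v)) (cpoly phi_v_den) P)" for P
  proof -
    obtain X Y where P: "P = proj X Y" "(X, Y) \<noteq> (0, 0)" by (rule proj_cases)
    have m: "mobius (s * A) B (s * C) D (proj X Y) = mobius A B C D (proj (s * X) Y)" if "(X, Y) \<noteq> (0, 0)" for X Y
      using mobius_proj[OF det that] mobius_proj[OF AC(3), of "s * X" Y] that s(2) by (auto simp: algebra_simps)
    have nz1: "(s * X, Y) \<noteq> (0, 0)" "(of_rat v * (X * Y - Y\<^sup>2), X\<^sup>2) \<noteq> (0, 0)"
      using P(2) s(2) v0 by (auto simp: power2_eq_square)
    have "l * s = - 1" unfolding s_def using l0 by simp
    then have "l * (s * X) * Y + Y\<^sup>2 = - (X * Y) + Y\<^sup>2" by (simp flip: mult.assoc)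
    moreover have "s * (of_rat v * (X * Y - Y\<^sup>2)) = (l\<^sup>2 / \<mu>) * (- (X * Y) + Y\<^sup>2)"
      unfolding v[symmetric] s_def using l0 AC(6) by (simp add: power2_eq_square power3_eq_cube field_simps)
    moreover have "X\<^sup>2 = (l\<^sup>2 / \<mu>) * (\<mu> * (s * X)\<^sup>2)"
      unfolding s_def using l0 AC(6) by (simp add: power2_eq_square field_simps)
    ultimately have "proj (l * (s * X) * Y + Y\<^sup>2) (\<mu> * (s * X)\<^sup>2) = proj (s * (of_rat v * (X * Y - Y\<^sup>2))) (X\<^sup>2)"
      using proj_scale[of "l\<^sup>2 / \<mu>"] l0 AC(6) by (metis divide_eq_0_iff power_not_zero)
    then show ?thesis
      unfolding P(1) phi_v_proj[OF v0 P(2)] m[OF P(2)] m[OF nz1(2)] using nf[OF nz1(1)] f by simp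
  qed
  then have "lin_conj_over \<rat> p q (cpoly (phi_v_num v)) (cpoly phi_v_den)"
    unfolding lin_conj_over_def using conj_iff[OF det] det AC s BD by (meson Rats_mult)
  then show ?thesis using v0 by blast
qed

text \<open>The critical point is a root of the rational quadratic W, so a rational translation
  turns it into a square root s of a rational d, where \<open>irrational_critical_form\<close>
  applies.\<close>

lemma irrational_critical_Aut:
  assumes f: "f = rf_apply p q" and x: "x \<notin> \<rat>" and crit: "W x 1 = 0"
    and per: "f (f (Some x)) = Some x" "f (Some x) \<noteq> Some x"
  shows "Aut_set p q \<noteq> {id}"
proof -
  define w0 w1 w2 where "w0 = p1 * q0 - p0 * q1" and "w1 = 2 * (p2 * q0 - p0 * q2)" and "w2 = p2 * q1 - p1 * q2"
  have w: "w0 \<in> \<rat>" "w1 \<in> \<rat>" "w2 \<in> \<rat>" unfolding w0_def w1_def w2_def using rat by auto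
  have wx: "w0 + w1 * x + w2 * x\<^sup>2 = 0"
    using crit unfolding jac_def qform_def w0_def w1_def w2_def by (simp add: algebra_simps)
  have w2: "w2 \<noteq> 0"
  proof
    assume "w2 = 0"
    then have e: "x * w1 = - w0" using wx by (simp add: eq_neg_iff_add_eq_0 algebra_simps)
    show False
    proof (cases "w1 = 0")
      case True
      then show False using minors e \<open>w2 = 0\<close> unfolding w0_def w1_def w2_def by auto
    next
      case False
      then have "x = - w0 / w1" using e by (metis nonzero_eq_divide_eq)
      then show False using x w by auto
    qed
  qed
  \<comment> \<open>The midpoint of the two critical points; translating by it completes the
    square.\<close>
  define r where "r = - w1 / (2 * w2)"
  define s where "s = x - r"
  define d where "d = r\<^sup>2 - w0 / w2"
  have rd: "r \<in> \<rat>" "d \<in> \<rat>" unfolding r_def d_def using w by auto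
  have s: "s \<notin> \<rat>" unfolding s_def using x rd(1) by (metis Rats_add diff_add_cancel)
  have "w2 * s\<^sup>2 = w2 * d + (w0 + w1 * x + w2 * x\<^sup>2)"
    unfolding s_def d_def r_def using w2 by (simp add: power2_eq_square field_simps)
  then have sd: "s\<^sup>2 = d" using wx w2 by simp
  have d0: "d \<noteq> 0" using sd s by auto
  define g where "g P = mobius 1 (- r) 0 1 (f (mobius 1 r 0 1 P))" for P
  interpret T: quad_map g "Fp r 1 - r * Fq r 1" "p1 + 2 * r * p2 - r * (q1 + 2 * r * q2)" "p2 - r * q2"
    "Fq r 1" "q1 + 2 * r * q2" q2
    unfolding g_def by (rule translate[OF rd(1)])
  have inv: "mobius 1 r 0 1 (mobius 1 (- r) 0 1 P) = P" "mobius 1 (- r) 0 1 (mobius 1 r 0 1 P) = P" for P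
    using mobius_inverse[of 1 1 r 0 P] by simp_all
  have Ts: "mobius 1 r 0 1 (proj s 1) = Some x"
    using mobius_proj[of 1 1 r 0 s 1] by (simp add: proj_def s_def)
  have sT: "mobius 1 (- r) 0 1 (Some x) = proj s 1" unfolding Ts[symmetric] inv ..
  have crit': "T.W s 1 = 0" unfolding jac_translate using crit by (simp add: s_def)
  have per': "g (g (proj s 1)) = proj s 1" "g (proj s 1) \<noteq> proj s 1"
    unfolding g_def inv Ts per(1) sT using per(2) inv(1) sT Ts by metis+
  define \<alpha> where "\<alpha> = p2 - r * q2"
  note form = T.irrational_critical_form[OF sd rd(2) s crit' per', folded \<alpha>_def]
  have Fp: "T.Fp X Y = \<alpha> * (X\<^sup>2 + d * Y\<^sup>2) - 2 * d * q2 * (X * Y)" for X Y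
    unfolding form(1,3) \<alpha>_def[symmetric] by (simp add: qform_def algebra_simps)
  have Fq: "T.Fq X Y = q2 * (X\<^sup>2 + d * Y\<^sup>2) - 2 * \<alpha> * (X * Y)" for X Y
    unfolding form(2,4) by (simp add: qform_def algebra_simps)
  \<comment> \<open>Chosen so that \<open>s * B\<close> is a square root of -3. The matrix with rows
    (1, d B) and (B, 1) fixes s and -s with eigenvalues 1 + s B and 1 - s B, whose ratio is a
    primitive third root of unity.\<close>
  define B where "B = csqrt (- 3 / d)"
  have B: "B\<^sup>2 * d = - 3" unfolding B_def using d0 by simp
  have B0: "B \<noteq> 0" using B by auto
  show ?thesis
  proof (rule Aut_set_nontrivial[where g = g and t = B and a' = 1 and b' = "d * B" and c' = B and d' = 1 and R = "proj 0 1"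
      and a = 1 and b = r and c = 0 and d = 1])
    show "rf_apply p q (mobius 1 r 0 1 P) = mobius 1 r 0 1 (g P)" for P
      unfolding g_def inv f ..
    show "algebraic B"
      unfolding B_def using rd(2) by (intro algebraic_csqrt rat_imp_algebraic) auto
    show "1 \<in> rat_span B" "d * B \<in> rat_span B" "B \<in> rat_span B" "1 \<in> rat_span B"
      using rd(2) by (simp_all add: rat_span_simps)
    have dB: "d * B * B = - 3" using B by (simp add: power2_eq_square mult.commute mult.left_commute)
    then show det: "1 * 1 - d * B * B \<noteq> 0" by simp
    fix P
    obtain X Y where P: "P = proj X Y" "(X, Y) \<noteq> (0, 0)" by (rule proj_cases)
    note nz1 = mobius_nz[OF det P(2)] and nz2 = T.nz[OF P(2)]
    have q: "(X + d * B * Y)\<^sup>2 + d * (B * X + Y)\<^sup>2 = - 2 * (X\<^sup>2 + d * Y\<^sup>2) + 4 * (d * B) * (X * Y)"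
      "(X + d * B * Y) * (B * X + Y) = B * (X\<^sup>2 + d * Y\<^sup>2) - 2 * (X * Y)"
      using B by algebra+
    \<comment> \<open>The pair of forms commutes with the matrix up to the factor -2, which
      disappears projectively.\<close>
    have e1: "T.Fp (1 * X + d * B * Y) (B * X + 1 * Y) = - 2 * (1 * T.Fp X Y + d * B * T.Fq X Y)"
      and e2: "T.Fq (1 * X + d * B * Y) (B * X + 1 * Y) = - 2 * (B * T.Fp X Y + 1 * T.Fq X Y)"
      unfolding Fp Fq mult_1 q by (simp_all add: algebra_simps dB)
    show "g (mobius 1 (d * B) B 1 P) = mobius 1 (d * B) B 1 (g P)"
      unfolding P(1) mobius_proj[OF det P(2)] T.f_proj[OF P(2)] T.f_proj[OF nz1] mobius_proj[OF det nz2] e1 e2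
      by (rule proj_scale) simp
  next
    have dB: "d * B * B = - 3" using B by (simp add: power2_eq_square mult.commute mult.left_commute)
    show "mobius 1 (d * B) B 1 (proj 0 1) \<noteq> proj 0 1"
      using mobius_proj[of 1 1 "d * B" B 0 1] dB d0 B0 by (simp add: proj_def)
  qed (use rd in auto)
qed

end

theorem exists_normal_form:
  fixes p q :: "rat poly"
  assumes q: "q \<noteq> 0" and cop: "coprime p q" and deg: "rf_degree (cpoly p) (cpoly q) = 2"
    and crit: "critical_point (cpoly p) (cpoly q) P" and per: "periodic_pt (cpoly p) (cpoly q) 2 P"
    and aut: "Aut_set (cpoly p) (cpoly q) = {id}"
  shows "\<exists>v::rat. v \<noteq> 0 \<and> lin_conj_over \<rat> (cpoly p) (cpoly q) (cpoly (phi_v_num v)) (cpoly phi_v_den)"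
proof -
  let ?f = "rf_apply (cpoly p) (cpoly q)"
  let ?p = "\<lambda>i. complex_of_rat (coeff p i)" and ?q = "\<lambda>i. complex_of_rat (coeff q i)"
  have coeff: "coeff (cpoly h) i = of_rat (coeff h i)" for h i by (simp add: cpoly_def coeff_map_poly)
  have dle: "degree (cpoly p) \<le> 2" "degree (cpoly q) \<le> 2" using deg unfolding rf_degree_def by linarith+
  have p: "cpoly p = [:?p 0, ?p 1, ?p 2:]" and q': "cpoly q = [:?q 0, ?q 1, ?q 2:]"
    using dle[THEN degree_le_2_eq] unfolding coeff by simp_all
  have lead: "(?p 2, ?q 2) \<noteq> (0, 0)"
  proof
    assume "(?p 2, ?q 2) = (0, 0)"
    then have "degree (cpoly p) \<le> 1" "degree (cpoly q) \<le> 1" unfolding p q' by simp_all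
    then show False using deg unfolding rf_degree_def by linarith
  qed
  interpret quad_map ?f "?p 0" "?p 1" "?p 2" "?q 0" "?q 1" "?q 2"
  proof
    fix X Y :: complex assume XY: "(X, Y) \<noteq> (0, 0)"
    show "?f (proj X Y) = proj (qform (?p 0) (?p 1) (?p 2) X Y) (qform (?q 0) (?q 1) (?q 2) X Y)"
      unfolding p q' by (rule rf_apply_proj[OF lead XY])
    show "(qform (?p 0) (?p 1) (?p 2) X Y, qform (?q 0) (?q 1) (?q 2) X Y) \<noteq> (0, 0)"
    proof (cases "Y = 0")
      case True
      then show ?thesis using XY lead by (auto simp: qform_def)
    next
      case False
      have ev: "poly [:c0, c1, c2:] (X / Y) = qform c0 c1 c2 X Y / Y\<^sup>2" for c0 c1 c2
        using False by (simp add: qform_def power2_eq_square field_simps)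
      have "poly (cpoly p) (X / Y) \<noteq> 0 \<or> poly (cpoly q) (X / Y) \<noteq> 0"
        using coprime_no_common_root[OF q cop] by blast
      then show ?thesis unfolding p q' ev by auto
    qed
  qed simp_all
  have per2: "?f (?f P) = P" "?f P \<noteq> P"
  proof -
    show "?f (?f P) = P" using per unfolding periodic_pt_def by (simp add: numeral_2_eq_2)
    have "\<forall>m. 0 < m \<and> m < 2 \<longrightarrow> (?f ^^ m) P \<noteq> P" using per unfolding periodic_pt_def by (elim conjE)
    from this[rule_format, of 1] show "?f P \<noteq> P" by simp
  qed
  note jac = critical_imp_jac[OF crit[unfolded p q'] lead]
  show ?thesis
  proof (cases P)
    case None
    then show ?thesis
      using rational_critical_conj[OF refl aut, of 1 0] jac per2 by (simp add: proj_def)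
  next
    case (Some x)
    show ?thesis
    proof (cases "x \<in> \<rat>")
      case True
      then show ?thesis
        using rational_critical_conj[OF refl aut, of x 1] jac per2 Some by (simp add: proj_def)
    next
      case False
      then show ?thesis
        using irrational_critical_Aut[OF refl False] jac per2 Some aut by simp
    qed
  qed
qed

theorem theorem1p1:
  fixes p q :: "rat poly"
  assumes "q \<noteq> 0" and "coprime p q"
    and "rf_degree (cpoly p) (cpoly q) = 2"
    and "\<exists>P. in_P1_Qbar P \<and> critical_point (cpoly p) (cpoly q) P
              \<and> periodic_pt (cpoly p) (cpoly q) 2 P"
    and "Aut_set (cpoly p) (cpoly q) = {id}"
  shows "(\<exists>v::rat. v \<noteq> 0 \<and>
            lin_conj_over \<rat> (cpoly p) (cpoly q) (cpoly (phi_v_num v)) (cpoly phi_v_den))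
       \<and> (\<forall>v::rat. v \<noteq> 0 \<and> v \<noteq> 3 \<and>
            lin_conj_over \<rat> (cpoly p) (cpoly q) (cpoly (phi_v_num v)) (cpoly phi_v_den) \<longrightarrow>
            (v \<in> Im_eta \<longrightarrow> Gal_group (dynatomic_field3 (cpoly p) (cpoly q)) \<cong> C_group) \<and>
            (v \<notin> Im_eta \<longrightarrow> Gal_group (dynatomic_field3 (cpoly p) (cpoly q)) \<cong> wreath_group))"
proof (intro conjI allI impI)
  show "\<exists>v::rat. v \<noteq> 0 \<and> lin_conj_over \<rat> (cpoly p) (cpoly q) (cpoly (phi_v_num v)) (cpoly phi_v_den)"
    using exists_normal_form[OF assms(1-3) _ _ assms(5)] assms(4) by blast
next
  \<comment> \<open>A conjugation over \<rat> leaves the dynatomic field unchanged as a set of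
    complex numbers, so the Galois groups are literally equal.\<close>
  have field_eq: "dynatomic_field3 (cpoly p) (cpoly q) = dynatomic_field3 (cpoly (phi_v_num v)) (cpoly phi_v_den)"
    if v: "v \<noteq> 0 \<and> v \<noteq> 3 \<and> lin_conj_over \<rat> (cpoly p) (cpoly q) (cpoly (phi_v_num v)) (cpoly phi_v_den)" for v :: rat
  proof -
    obtain a b c d where abcd: "a \<in> \<rat>" "b \<in> \<rat>" "c \<in> \<rat>" "d \<in> \<rat>" "a * d - b * c \<noteq> 0"
      and "Hilbert_Choice.inv (mobius a b c d) \<circ> rf_apply (cpoly p) (cpoly q) \<circ> mobius a b c d
        = rf_apply (cpoly (phi_v_num v)) (cpoly phi_v_den)"
      using v unfolding lin_conj_over_def by blast
    then have "rf_apply (cpoly p) (cpoly q) (mobius a b c d P)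
        = mobius a b c d (rf_apply (cpoly (phi_v_num v)) (cpoly phi_v_den) P)" for P
      using conj_iff[OF abcd(5)] by blast
    moreover have "\<not> periodic_pt (cpoly (phi_v_num v)) (cpoly phi_v_den) 3 None"
      using periodic_imp_sextic[of v "of_rat v" None] v by blast
    moreover have "algebraic x" if "periodic_pt (cpoly (phi_v_num v)) (cpoly phi_v_den) 3 (Some x)" for x
      using periodic_imp_sextic[of v "of_rat v" "Some x"] sextic_algebraic[of v "of_rat v" x] v that by blast
    ultimately show ?thesis by (intro dynatomic_field3_conj[OF abcd(5,1-4)])
  qed
  fix v :: rat
  assume v: "v \<noteq> 0 \<and> v \<noteq> 3 \<and> lin_conj_over \<rat> (cpoly p) (cpoly q) (cpoly (phi_v_num v)) (cpoly phi_v_den)"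
  show "Gal_group (dynatomic_field3 (cpoly p) (cpoly q)) \<cong> C_group" if "v \<in> Im_eta"
    unfolding field_eq[OF v] using Gal_normal_form(1) v that by blast
  show "Gal_group (dynatomic_field3 (cpoly p) (cpoly q)) \<cong> wreath_group" if "v \<notin> Im_eta"
    unfolding field_eq[OF v] using Gal_normal_form(2) v that by blast
qed

end
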